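(* Let $M=N_T\times_{f_1}N_\perp^{n_1}\times_{f_2}N_\theta^{n_2}$ be a $CRS$ bi-warped product, with $N_\theta^{n_2}$ proper pointwise slant with slant function $\theta$, in a $(2m+1)$-dimensional cosymplectic manifold $\widetilde M^{2m+1}$. Let $h$ be the second fundamental form of $M$ in $\widetilde M^{2m+1}$. Then: (i) The squared norm of the second fundamental form satisfies $$\|h\|^2\geq 2n_1\|\nabla(\ln f_1)\|^2+2n_2(1+2\cot^2\theta)\,\|\nabla(\ln f_2)\|^2,$$ where $\nabla(\ln f_1)$ and $\nabla(\ln f_2)$ are the gradients of $\ln f_1$ and $\ln f_2$, respectively. (ii) If the equality sign holds in the inequality of (i), then $N_T$ is totally geodesic in $\widetilde M^{2m+1}$, and $N_\perp^{n_1}$ and $N_\theta^{n_2}$ are totally umbilical submanifolds of $\widetilde M^{2m+1}$. Moreover, $M$ is a $\mathfrak D^\perp\oplus\mathfrak D^\theta$-mixed totally geodesic submanifold but neither $\mathfrak D^T\oplus\mathfrak D^\perp$-mixed totally geodesic nor $\mathfrak D^T\oplus\mathfrak D^\theta$-mixed totally geodesic.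
   Context: An almost contact metric manifold $(\widetilde M^{2m+1},g,\varphi,\xi,\eta)$ is a Riemannian manifold with a $(1,1)$ tensor field $\varphi$, a vector field $\xi$ (the structure vector field) and a $1$-form $\eta$ satisfying $\varphi^2=-\mathrm{Id}+\eta\otimes\xi$, $\eta(\xi)=1$, $\varphi(\xi)=0$, $\eta\circ\varphi=0$, $g(\varphi X,\varphi Y)=g(X,Y)-\eta(X)\eta(Y)$, $\eta(X)=g(X,\xi)$. With $\widetilde\nabla$ its Levi-Civita connection, it is called cosymplectic if $\widetilde\nabla\varphi=0$ and $\widetilde\nabla\xi=0$. A submanifold $N$ of $\widetilde M$ is invariant if it is tangent to $\xi$ and $\varphi(T_xN)\subseteq T_xN$ for all $x\in N$; anti-invariant if $\varphi(T_xN)\subset T_x^\perp N$ for all $x\in N$; pointwise slant if for every $x\in N$ and nonzero $X\in T_xN$ the angle between $\varphi X$ and $T_xN$ is independent of the choice of $X\in T_xN$ (it is then a function $\theta$ of the point, the slant function). A pointwise slant submanifold is proper if $0<\theta<\frac{\pi}{2}$. Given Riemannian manifolds $(B,g_B),(N_1,g_1),(N_2,g_2)$ and positive smooth functions $f_1,f_2$ on $B$, the bi-warped product $B\times_{f_1}N_1\times_{f_2}N_2$ is $B\times N_1\times N_2$ with metric $g_B+f_1^2g_1+f_2^2g_2$. A $CRS$ bi-warped product in $\widetilde M^{2m+1}$ is a submanifold which, with its induced metric, is a bi-warped product $N_T^{2p+1}\times_{f_1}N_\perp^{n_1}\times_{f_2}N_\theta^{n_2}$, where $N_T$ is an invariant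 submanifold tangent to $\xi$, $N_\perp$ is an anti-invariant submanifold of dimension $n_1$, $N_\theta$ is a pointwise slant submanifold of dimension $n_2$ of $\widetilde M$ (the factors being identified with the corresponding leaves), and $f_1,f_2$ are positive smooth functions on $N_T$. $\mathfrak D^T,\mathfrak D^\perp,\mathfrak D^\theta$ denote the tangent bundles of $N_T,N_\perp,N_\theta$, viewed as distributions on $M$, so $TM=\mathfrak D^T\oplus\mathfrak D^\perp\oplus\mathfrak D^\theta$. The second fundamental form $h$ is defined by $\widetilde\nabla_XY=\nabla_XY+h(X,Y)$, and $\|h\|^2=\sum_{i,j}g(h(e_i,e_j),h(e_i,e_j))$ for a local orthonormal frame $\{e_i\}$ of $M$. A submanifold is totally geodesic if its second fundamental form vanishes, and totally umbilical if its second fundamental form equals $g(\cdot,\cdot)H$ with $H$ its mean curvature vector. For two of these distributions $\mathfrak D^1,\mathfrak D^2$, $M$ is $\mathfrak D^1\oplus\mathfrak D^2$-mixed totally geodesic if $h(\mathfrak D^1,\mathfrak D^2)=\{0\}$, i.e. $h(X,Y)=0$ for all $X\in\mathfrak D^1$, $Y\in\mathfrak D^2$.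
   Formalization: In (ii), "not D^T⊕D^⊥-mixed totally geodesic" is claimed only if f_1 is not locally constant, and "not D^T⊕D^θ-mixed totally geodesic" only if f_2 is not locally constant; for constant f_i (e.g. a Riemannian product with h=0) these clauses are false. *)

theory Defs
  imports "HOL-Analysis.Analysis"
begin

section \<open>Smooth manifolds\<close>

text \<open>\<open>Ck_on k S f\<close> is meant for open \<open>S\<close> in a Euclidean space; directional derivatives in all
  directions are required to be of class \<open>C\<^sup>k\<close> again.\<close>

primrec Ck_on ::
  "nat \<Rightarrow> 'e::euclidean_space set \<Rightarrow> ('e \<Rightarrow> 'f::real_normed_vector) \<Rightarrow> bool" where
  "Ck_on 0 S f \<longleftrightarrow> continuous_on S f"
| "Ck_on (Suc k) S f \<longleftrightarrow>
     (\<forall>x\<in>S. f differentiable (at x)) \<and> (\<forall>v. Ck_on k S (\<lambda>x. frechet_derivative f (at x) v))"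

definition smooth_on :: "'e::euclidean_space set \<Rightarrow> ('e \<Rightarrow> 'f::real_normed_vector) \<Rightarrow> bool" where
  "smooth_on S f \<longleftrightarrow> (\<forall>k. Ck_on k S f)"

text \<open>A chart is a pair of its domain and its coordinate map. A manifold consists of all points of
  the type \<open>'a\<close>; it need not be connected, and its atlas need not be maximal. Its dimension is
  that of the model space \<open>'e\<close>.\<close>

type_synonym ('a, 'e) chart = "'a set \<times> ('a \<Rightarrow> 'e)"
type_synonym ('a, 'e) atlas = "('a, 'e) chart set"

definition smooth_manifold ::
  "('a::{t2_space,second_countable_topology}, 'e::euclidean_space) atlas \<Rightarrow> bool" where
  "smooth_manifold A \<longleftrightarrow>
     (\<Union>(U, c)\<in>A. U) = UNIV \<and>
     (\<forall>(U, c)\<in>A. open U \<and> open (c ` U) \<and> homeomorphism U (c ` U) c (inv_into U c)) \<and>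
     (\<forall>(U, c)\<in>A. \<forall>(V, d)\<in>A. smooth_on (c ` (U \<inter> V)) (d \<circ> inv_into U c))"

definition prod_atlas ::
  "('a, 'e) atlas \<Rightarrow> ('b, 'f) atlas \<Rightarrow> ('a \<times> 'b, 'e \<times> 'f) atlas" where
  "prod_atlas A B = {(U \<times> V, map_prod c d) | U c V d. (U, c) \<in> A \<and> (V, d) \<in> B}"

definition smooth_fun_on ::
  "('a::topological_space, 'e::euclidean_space) atlas \<Rightarrow> 'a set \<Rightarrow> ('a \<Rightarrow> real) \<Rightarrow> bool" where
  "smooth_fun_on A W f \<longleftrightarrow> (\<forall>(U, c)\<in>A. smooth_on (c ` (U \<inter> W)) (f \<circ> inv_into U c))"

definition smooth_near ::
  "('a::topological_space, 'e::euclidean_space) atlas \<Rightarrow> 'a \<Rightarrow> ('a \<Rightarrow> real) \<Rightarrow> bool" where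
  "smooth_near A x f \<longleftrightarrow> (\<exists>W. open W \<and> x \<in> W \<and> smooth_fun_on A W f)"

definition smooth_map ::
  "('a::topological_space, 'e::euclidean_space) atlas \<Rightarrow>
   ('b::topological_space, 'f::euclidean_space) atlas \<Rightarrow> ('a \<Rightarrow> 'b) \<Rightarrow> bool" where
  "smooth_map A B F \<longleftrightarrow> continuous_on UNIV F \<and>
     (\<forall>(U, c)\<in>A. \<forall>(V, d)\<in>B. smooth_on (c ` (U \<inter> F -` V)) (d \<circ> F \<circ> inv_into U c))"

section \<open>Tangent vectors\<close>

text \<open>A tangent vector at \<open>x\<close> is a directional derivative operator at \<open>x\<close>, acting on the real functions
  that are smooth near \<open>x\<close>. As HOL functions are total, operators are extended by the value \<open>0\<close> to
  all other functions. The type of operators is introduced so that it becomes a real vector space.\<close>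

typedef 'a tvec = "UNIV :: (('a \<Rightarrow> real) \<Rightarrow> real) set"
  morphisms act Tvec ..

instantiation tvec :: (type) real_vector
begin

definition "0 = Tvec (\<lambda>f. 0)"
definition "v + w = Tvec (\<lambda>f. act v f + act w f)"
definition "- v = Tvec (\<lambda>f. - act v f)"
definition "v - w = Tvec (\<lambda>f. act v f - act w f)"
definition "r *\<^sub>R v = Tvec (\<lambda>f. r * act v f)"

instance
  by standard
    (auto simp: zero_tvec_def plus_tvec_def uminus_tvec_def minus_tvec_def scaleR_tvec_def
      Tvec_inverse act_inverse algebra_simps)

end

type_synonym 'a vfield = "'a \<Rightarrow> 'a tvec"
type_synonym 'a metric = "'a \<Rightarrow> 'a tvec \<Rightarrow> 'a tvec \<Rightarrow> real"

text \<open>The derivative at \<open>x\<close> in the direction with coordinates \<open>u\<close> in the chart \<open>c\<close>.\<close>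

definition chart_vec ::
  "('a::topological_space, 'e::euclidean_space) atlas \<Rightarrow> ('a, 'e) chart \<Rightarrow> 'a \<Rightarrow> 'e \<Rightarrow> 'a tvec" where
  "chart_vec A c x u = Tvec (\<lambda>f. if smooth_near A x f
     then frechet_derivative (f \<circ> inv_into (fst c) (snd c)) (at (snd c x)) u else 0)"

definition tangent_space ::
  "('a::topological_space, 'e::euclidean_space) atlas \<Rightarrow> 'a \<Rightarrow> 'a tvec set" where
  "tangent_space A x = {chart_vec A c x u | c u. c \<in> A \<and> x \<in> fst c}"

text \<open>The differential at \<open>x\<close> of a map \<open>F\<close> into the manifold with atlas \<open>B\<close>.\<close>

definition differential ::
  "('b::topological_space, 'f::euclidean_space) atlas \<Rightarrow> ('a \<Rightarrow> 'b) \<Rightarrow> 'a \<Rightarrow> 'a tvec \<Rightarrow> 'b tvec" where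
  "differential B F x v = Tvec (\<lambda>f. if smooth_near B (F x) f then act v (f \<circ> F) else 0)"

definition smooth_vfield_on ::
  "('a::topological_space, 'e::euclidean_space) atlas \<Rightarrow> 'a set \<Rightarrow> 'a vfield \<Rightarrow> bool" where
  "smooth_vfield_on A W X \<longleftrightarrow> (\<forall>x\<in>W. X x \<in> tangent_space A x) \<and>
     (\<forall>V f. open V \<and> V \<subseteq> W \<and> smooth_fun_on A V f \<longrightarrow> smooth_fun_on A V (\<lambda>x. act (X x) f))"

definition smooth_vfield_near ::
  "('a::topological_space, 'e::euclidean_space) atlas \<Rightarrow> 'a \<Rightarrow> 'a vfield \<Rightarrow> bool" where
  "smooth_vfield_near A x X \<longleftrightarrow> (\<exists>W. open W \<and> x \<in> W \<and> smooth_vfield_on A W X)"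

definition lie_bracket ::
  "('a::topological_space, 'e::euclidean_space) atlas \<Rightarrow> 'a vfield \<Rightarrow> 'a vfield \<Rightarrow> 'a vfield" where
  "lie_bracket A X Y x = Tvec (\<lambda>f. if smooth_near A x f
     then act (X x) (\<lambda>y. act (Y y) f) - act (Y x) (\<lambda>y. act (X y) f) else 0)"

section \<open>Riemannian metrics and the Levi-Civita connection\<close>

definition linear_map_on :: "'v::real_vector set \<Rightarrow> ('v \<Rightarrow> 'w::real_vector) \<Rightarrow> bool" where
  "linear_map_on S L \<longleftrightarrow>
     (\<forall>v\<in>S. \<forall>w\<in>S. L (v + w) = L v + L w) \<and> (\<forall>r. \<forall>v\<in>S. L (r *\<^sub>R v) = r *\<^sub>R L v)"

definition riemannian_manifold ::
  "('a::{t2_space,second_countable_topology}, 'e::euclidean_space) atlas \<Rightarrow> 'a metric \<Rightarrow> bool" where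
  "riemannian_manifold A g \<longleftrightarrow> smooth_manifold A \<and>
     (\<forall>x. \<forall>v\<in>tangent_space A x. linear_map_on (tangent_space A x) (g x v)) \<and>
     (\<forall>x. \<forall>v\<in>tangent_space A x. \<forall>w\<in>tangent_space A x. g x v w = g x w v) \<and>
     (\<forall>x. \<forall>v\<in>tangent_space A x. v \<noteq> 0 \<longrightarrow> g x v v > 0) \<and>
     (\<forall>W X Y. open W \<and> smooth_vfield_on A W X \<and> smooth_vfield_on A W Y \<longrightarrow>
        smooth_fun_on A W (\<lambda>x. g x (X x) (Y x)))"

text \<open>\<open>D x v Y\<close> stands for the covariant derivative at \<open>x\<close> of \<open>Y\<close> in the direction \<open>v\<close>. Connections
  act on vector fields that are only smooth near the point in question, which is the usual
  extension of a connection to local vector fields.\<close>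

type_synonym 'a connection = "'a \<Rightarrow> 'a tvec \<Rightarrow> 'a vfield \<Rightarrow> 'a tvec"

definition affine_connection ::
  "('a::topological_space, 'e::euclidean_space) atlas \<Rightarrow> 'a connection \<Rightarrow> bool" where
  "affine_connection A D \<longleftrightarrow>
     (\<forall>x Y. smooth_vfield_near A x Y \<longrightarrow>
        linear_map_on (tangent_space A x) (\<lambda>v. D x v Y) \<and>
        (\<forall>v\<in>tangent_space A x.
           D x v Y \<in> tangent_space A x \<and>
           (\<forall>Z. smooth_vfield_near A x Z \<longrightarrow> D x v (\<lambda>y. Y y + Z y) = D x v Y + D x v Z) \<and>
           (\<forall>f. smooth_near A x f \<longrightarrow>
              D x v (\<lambda>y. f y *\<^sub>R Y y) = act v f *\<^sub>R Y x + f x *\<^sub>R D x v Y))) \<and>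
     (\<forall>W X Y. open W \<and> smooth_vfield_on A W X \<and> smooth_vfield_on A W Y \<longrightarrow>
        smooth_vfield_on A W (\<lambda>x. D x (X x) Y))"

definition levi_civita ::
  "('a::topological_space, 'e::euclidean_space) atlas \<Rightarrow> 'a metric \<Rightarrow> 'a connection \<Rightarrow> bool" where
  "levi_civita A g D \<longleftrightarrow> affine_connection A D \<and>
     (\<forall>x X Y. smooth_vfield_near A x X \<and> smooth_vfield_near A x Y \<longrightarrow>
        D x (X x) Y - D x (Y x) X = lie_bracket A X Y x) \<and>
     (\<forall>x Y Z. \<forall>v\<in>tangent_space A x. smooth_vfield_near A x Y \<and> smooth_vfield_near A x Z \<longrightarrow>
        act v (\<lambda>y. g y (Y y) (Z y)) = g x (D x v Y) (Z x) + g x (Y x) (D x v Z))"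

definition gradient ::
  "('a::topological_space, 'e::euclidean_space) atlas \<Rightarrow> 'a metric \<Rightarrow> ('a \<Rightarrow> real) \<Rightarrow> 'a vfield" where
  "gradient A g f x =
     (THE w. w \<in> tangent_space A x \<and> (\<forall>v\<in>tangent_space A x. g x w v = act v f))"

definition sq_norm :: "'a metric \<Rightarrow> 'a \<Rightarrow> 'a tvec \<Rightarrow> real" where
  "sq_norm g x v = g x v v"

definition orthonormal_basis ::
  "('a::topological_space, 'e::euclidean_space) atlas \<Rightarrow> 'a metric \<Rightarrow> 'a \<Rightarrow> 'a tvec set \<Rightarrow> bool" where
  "orthonormal_basis A g x B \<longleftrightarrow> finite B \<and> span B = tangent_space A x \<and>
     (\<forall>v\<in>B. \<forall>w\<in>B. g x v w = (if v = w then 1 else 0))"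

definition tangential_part :: "'a metric \<Rightarrow> 'a \<Rightarrow> 'a tvec set \<Rightarrow> 'a tvec \<Rightarrow> 'a tvec" where
  "tangential_part g x S v = (THE t. t \<in> S \<and> (\<forall>s\<in>S. g x (v - t) s = 0))"

definition normal_part :: "'a metric \<Rightarrow> 'a \<Rightarrow> 'a tvec set \<Rightarrow> 'a tvec \<Rightarrow> 'a tvec" where
  "normal_part g x S v = v - tangential_part g x S v"

text \<open>The angle between a vector and its orthogonal projection to \<open>S\<close>; it is \<open>pi / 2\<close> if the
  projection vanishes.\<close>

definition angle_to_subspace :: "'a metric \<Rightarrow> 'a \<Rightarrow> 'a tvec set \<Rightarrow> 'a tvec \<Rightarrow> real" where
  "angle_to_subspace g x S v =
     arccos (sqrt (sq_norm g x (tangential_part g x S v)) / sqrt (sq_norm g x v))"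

section \<open>Submanifolds\<close>

text \<open>A submanifold is given by an immersion \<open>F\<close> of the manifold with atlas \<open>A\<close> into the ambient
  manifold with atlas \<open>B\<close>; injectivity is not needed.\<close>

definition immersion ::
  "('a::topological_space, 'e::euclidean_space) atlas \<Rightarrow>
   ('b::topological_space, 'f::euclidean_space) atlas \<Rightarrow> ('a \<Rightarrow> 'b) \<Rightarrow> bool" where
  "immersion A B F \<longleftrightarrow> smooth_map A B F \<and> (\<forall>x. inj_on (differential B F x) (tangent_space A x))"

definition induced_metric ::
  "('b::topological_space, 'f::euclidean_space) atlas \<Rightarrow> 'b metric \<Rightarrow> ('a \<Rightarrow> 'b) \<Rightarrow> 'a metric" where
  "induced_metric B g F x v w = g (F x) (differential B F x v) (differential B F x w)"

definition tangent_image ::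
  "('a::topological_space, 'e::euclidean_space) atlas \<Rightarrow>
   ('b::topological_space, 'f::euclidean_space) atlas \<Rightarrow> ('a \<Rightarrow> 'b) \<Rightarrow> 'a \<Rightarrow> 'b tvec set" where
  "tangent_image A B F x = differential B F x ` tangent_space A x"

definition chart_at :: "('b, 'f) atlas \<Rightarrow> 'b \<Rightarrow> ('b, 'f) chart" where
  "chart_at B y = (SOME c. c \<in> B \<and> y \<in> fst c)"

text \<open>The ambient covariant derivative of a vector field \<open>Y\<close> along \<open>F\<close> (so \<open>Y x\<close> is a tangent vector
  at \<open>F x\<close>) in the direction \<open>v\<close> tangent at \<open>x\<close>. If \<open>Y = (\<Sum>b. y\<^sub>b *\<^sub>R (E\<^sub>b \<circ> F))\<close> for the coordinate
  frame \<open>E\<^sub>b\<close> of a chart at \<open>F x\<close>, it is \<open>\<Sum>b. (v y\<^sub>b) *\<^sub>R E\<^sub>b + y\<^sub>b *\<^sub>R D\<^bsub>dF v\<^esub> E\<^sub>b\<close>; this does not depend on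
  the chart. If \<open>Y = Z \<circ> F\<close> near \<open>x\<close> it is the derivative of \<open>Z\<close> in the direction \<open>dF v\<close>.\<close>

definition cov_deriv_along ::
  "('b::topological_space, 'f::euclidean_space) atlas \<Rightarrow> 'b connection \<Rightarrow> ('a \<Rightarrow> 'b) \<Rightarrow>
   'a \<Rightarrow> 'a tvec \<Rightarrow> ('a \<Rightarrow> 'b tvec) \<Rightarrow> 'b tvec" where
  "cov_deriv_along B D F x v Y =
     (let c = chart_at B (F x);
          E = (\<lambda>b y. chart_vec B c y b);
          comp = (\<lambda>b x'. act (Y x') (\<lambda>y. snd c y \<bullet> b))
      in \<Sum>b\<in>Basis. act v (comp b) *\<^sub>R E b (F x)
           + comp b x *\<^sub>R D (F x) (differential B F x v) (E b))"

text \<open>The Gauss formula: \<open>h(v,w)\<close> is the normal part of the ambient covariant derivative in the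
  direction \<open>v\<close> of any local tangent vector field with value \<open>w\<close> at \<open>x\<close>, the tangential part being
  the induced covariant derivative. Arguments are tangent vectors of the submanifold, values are
  tangent vectors of the ambient manifold.\<close>

definition second_fundamental_form ::
  "('a::topological_space, 'e::euclidean_space) atlas \<Rightarrow>
   ('b::topological_space, 'f::euclidean_space) atlas \<Rightarrow> 'b metric \<Rightarrow> 'b connection \<Rightarrow>
   ('a \<Rightarrow> 'b) \<Rightarrow> 'a \<Rightarrow> 'a tvec \<Rightarrow> 'a tvec \<Rightarrow> 'b tvec" where
  "second_fundamental_form A B g D F x v w =
     (let Y = (SOME Y. smooth_vfield_near A x Y \<and> Y x = w)
      in normal_part g (F x) (tangent_image A B F x)
           (cov_deriv_along B D F x v (\<lambda>y. differential B F y (Y y))))"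

definition sff_sq_norm ::
  "('a::topological_space, 'e::euclidean_space) atlas \<Rightarrow>
   ('b::topological_space, 'f::euclidean_space) atlas \<Rightarrow> 'b metric \<Rightarrow> 'b connection \<Rightarrow>
   ('a \<Rightarrow> 'b) \<Rightarrow> 'a \<Rightarrow> real" where
  "sff_sq_norm A B g D F x =
     (let e = (SOME e. orthonormal_basis A (induced_metric B g F) x e)
      in \<Sum>v\<in>e. \<Sum>w\<in>e. sq_norm g (F x) (second_fundamental_form A B g D F x v w))"

definition mean_curvature ::
  "('a::topological_space, 'e::euclidean_space) atlas \<Rightarrow>
   ('b::topological_space, 'f::euclidean_space) atlas \<Rightarrow> 'b metric \<Rightarrow> 'b connection \<Rightarrow>
   ('a \<Rightarrow> 'b) \<Rightarrow> 'a \<Rightarrow> 'b tvec" where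
  "mean_curvature A B g D F x =
     (let e = (SOME e. orthonormal_basis A (induced_metric B g F) x e)
      in (1 / real DIM('e)) *\<^sub>R (\<Sum>v\<in>e. second_fundamental_form A B g D F x v v))"

definition totally_geodesic ::
  "('a::topological_space, 'e::euclidean_space) atlas \<Rightarrow>
   ('b::topological_space, 'f::euclidean_space) atlas \<Rightarrow> 'b metric \<Rightarrow> 'b connection \<Rightarrow>
   ('a \<Rightarrow> 'b) \<Rightarrow> bool" where
  "totally_geodesic A B g D F \<longleftrightarrow>
     (\<forall>x. \<forall>v\<in>tangent_space A x. \<forall>w\<in>tangent_space A x. second_fundamental_form A B g D F x v w = 0)"

definition totally_umbilical ::
  "('a::topological_space, 'e::euclidean_space) atlas \<Rightarrow>
   ('b::topological_space, 'f::euclidean_space) atlas \<Rightarrow> 'b metric \<Rightarrow> 'b connection \<Rightarrow>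
   ('a \<Rightarrow> 'b) \<Rightarrow> bool" where
  "totally_umbilical A B g D F \<longleftrightarrow>
     (\<forall>x. \<forall>v\<in>tangent_space A x. \<forall>w\<in>tangent_space A x.
        second_fundamental_form A B g D F x v w
          = induced_metric B g F x v w *\<^sub>R mean_curvature A B g D F x)"

definition mixed_totally_geodesic ::
  "('a::topological_space, 'e::euclidean_space) atlas \<Rightarrow>
   ('b::topological_space, 'f::euclidean_space) atlas \<Rightarrow> 'b metric \<Rightarrow> 'b connection \<Rightarrow>
   ('a \<Rightarrow> 'b) \<Rightarrow> ('a \<Rightarrow> 'a tvec set) \<Rightarrow> ('a \<Rightarrow> 'a tvec set) \<Rightarrow> bool" where
  "mixed_totally_geodesic A B g D F D1 D2 \<longleftrightarrow>
     (\<forall>x. \<forall>v\<in>D1 x. \<forall>w\<in>D2 x. second_fundamental_form A B g D F x v w = 0)"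

section \<open>Almost contact metric and cosymplectic manifolds\<close>

definition almost_contact_metric ::
  "('b::{t2_space,second_countable_topology}, 'f::euclidean_space) atlas \<Rightarrow> 'b metric \<Rightarrow>
   ('b \<Rightarrow> 'b tvec \<Rightarrow> 'b tvec) \<Rightarrow> 'b vfield \<Rightarrow> ('b \<Rightarrow> 'b tvec \<Rightarrow> real) \<Rightarrow> bool" where
  "almost_contact_metric B g \<phi> \<xi> \<eta> \<longleftrightarrow> riemannian_manifold B g \<and>
     (\<forall>x. linear_map_on (tangent_space B x) (\<phi> x) \<and> \<phi> x ` tangent_space B x \<subseteq> tangent_space B x) \<and>
     (\<forall>W X. open W \<and> smooth_vfield_on B W X \<longrightarrow> smooth_vfield_on B W (\<lambda>x. \<phi> x (X x))) \<and>
     smooth_vfield_on B UNIV \<xi> \<and>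
     (\<forall>x. linear_map_on (tangent_space B x) (\<eta> x)) \<and>
     (\<forall>W X. open W \<and> smooth_vfield_on B W X \<longrightarrow> smooth_fun_on B W (\<lambda>x. \<eta> x (X x))) \<and>
     (\<forall>x. \<forall>v\<in>tangent_space B x. \<phi> x (\<phi> x v) = - v + \<eta> x v *\<^sub>R \<xi> x) \<and>
     (\<forall>x. \<eta> x (\<xi> x) = 1) \<and>
     (\<forall>x. \<phi> x (\<xi> x) = 0) \<and>
     (\<forall>x. \<forall>v\<in>tangent_space B x. \<eta> x (\<phi> x v) = 0) \<and>
     (\<forall>x. \<forall>v\<in>tangent_space B x. \<forall>w\<in>tangent_space B x.
        g x (\<phi> x v) (\<phi> x w) = g x v w - \<eta> x v * \<eta> x w) \<and>
     (\<forall>x. \<forall>v\<in>tangent_space B x. \<eta> x v = g x v (\<xi> x))"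

definition cosymplectic ::
  "('b::{t2_space,second_countable_topology}, 'f::euclidean_space) atlas \<Rightarrow> 'b metric \<Rightarrow>
   ('b \<Rightarrow> 'b tvec \<Rightarrow> 'b tvec) \<Rightarrow> 'b vfield \<Rightarrow> ('b \<Rightarrow> 'b tvec \<Rightarrow> real) \<Rightarrow> 'b connection \<Rightarrow> bool" where
  "cosymplectic B g \<phi> \<xi> \<eta> D \<longleftrightarrow> almost_contact_metric B g \<phi> \<xi> \<eta> \<and> levi_civita B g D \<and>
     (\<forall>x Y. \<forall>v\<in>tangent_space B x. smooth_vfield_near B x Y \<longrightarrow>
        D x v (\<lambda>y. \<phi> y (Y y)) - \<phi> x (D x v Y) = 0) \<and>
     (\<forall>x. \<forall>v\<in>tangent_space B x. D x v \<xi> = 0)"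

definition invariant_submanifold ::
  "('a::topological_space, 'e::euclidean_space) atlas \<Rightarrow>
   ('b::topological_space, 'f::euclidean_space) atlas \<Rightarrow>
   ('b \<Rightarrow> 'b tvec \<Rightarrow> 'b tvec) \<Rightarrow> 'b vfield \<Rightarrow> ('a \<Rightarrow> 'b) \<Rightarrow> bool" where
  "invariant_submanifold A B \<phi> \<xi> F \<longleftrightarrow> (\<forall>x. \<xi> (F x) \<in> tangent_image A B F x \<and>
     \<phi> (F x) ` tangent_image A B F x \<subseteq> tangent_image A B F x)"

definition anti_invariant_submanifold ::
  "('a::topological_space, 'e::euclidean_space) atlas \<Rightarrow>
   ('b::topological_space, 'f::euclidean_space) atlas \<Rightarrow> 'b metric \<Rightarrow>
   ('b \<Rightarrow> 'b tvec \<Rightarrow> 'b tvec) \<Rightarrow> ('a \<Rightarrow> 'b) \<Rightarrow> bool" where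
  "anti_invariant_submanifold A B g \<phi> F \<longleftrightarrow>
     (\<forall>x. \<forall>v\<in>tangent_image A B F x. \<forall>w\<in>tangent_image A B F x. g (F x) (\<phi> (F x) v) w = 0)"

definition pointwise_slant ::
  "('a::topological_space, 'e::euclidean_space) atlas \<Rightarrow>
   ('b::topological_space, 'f::euclidean_space) atlas \<Rightarrow> 'b metric \<Rightarrow>
   ('b \<Rightarrow> 'b tvec \<Rightarrow> 'b tvec) \<Rightarrow> ('a \<Rightarrow> 'b) \<Rightarrow> ('a \<Rightarrow> real) \<Rightarrow> bool" where
  "pointwise_slant A B g \<phi> F \<theta> \<longleftrightarrow>
     (\<forall>x. \<forall>v\<in>tangent_image A B F x. v \<noteq> 0 \<longrightarrow>
        angle_to_subspace g (F x) (tangent_image A B F x) (\<phi> (F x) v) = \<theta> x)"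

definition proper_pointwise_slant ::
  "('a::topological_space, 'e::euclidean_space) atlas \<Rightarrow>
   ('b::topological_space, 'f::euclidean_space) atlas \<Rightarrow> 'b metric \<Rightarrow>
   ('b \<Rightarrow> 'b tvec \<Rightarrow> 'b tvec) \<Rightarrow> ('a \<Rightarrow> 'b) \<Rightarrow> ('a \<Rightarrow> real) \<Rightarrow> bool" where
  "proper_pointwise_slant A B g \<phi> F \<theta> \<longleftrightarrow>
     pointwise_slant A B g \<phi> F \<theta> \<and> (\<forall>x. 0 < \<theta> x \<and> \<theta> x < pi / 2)"

section \<open>Bi-warped products\<close>

abbreviation triple_atlas ::
  "('a, 'e) atlas \<Rightarrow> ('b, 'f) atlas \<Rightarrow> ('c, 'k) atlas \<Rightarrow> ('a \<times> 'b \<times> 'c, 'e \<times> 'f \<times> 'k) atlas" where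
  "triple_atlas A1 A2 A3 \<equiv> prod_atlas A1 (prod_atlas A2 A3)"

definition biwarped_metric ::
  "('a::topological_space, 'e::euclidean_space) atlas \<Rightarrow> 'a metric \<Rightarrow>
   ('b::topological_space, 'f::euclidean_space) atlas \<Rightarrow> 'b metric \<Rightarrow>
   ('c::topological_space, 'k::euclidean_space) atlas \<Rightarrow> 'c metric \<Rightarrow>
   ('a \<Rightarrow> real) \<Rightarrow> ('a \<Rightarrow> real) \<Rightarrow> ('a \<times> 'b \<times> 'c) metric" where
  "biwarped_metric A1 g1 A2 g2 A3 g3 f1 f2 = (\<lambda>(x, y, z) v w.
     g1 x (differential A1 fst (x, y, z) v) (differential A1 fst (x, y, z) w)
     + (f1 x)\<^sup>2 * g2 y (differential A2 (fst \<circ> snd) (x, y, z) v)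
                       (differential A2 (fst \<circ> snd) (x, y, z) w)
     + (f2 x)\<^sup>2 * g3 z (differential A3 (snd \<circ> snd) (x, y, z) v)
                       (differential A3 (snd \<circ> snd) (x, y, z) w))"

text \<open>The inclusions of the leaves through the point with the given remaining components.\<close>

definition leaf1 :: "'b \<Rightarrow> 'c \<Rightarrow> 'a \<Rightarrow> 'a \<times> 'b \<times> 'c" where "leaf1 y z = (\<lambda>x. (x, y, z))"
definition leaf2 :: "'a \<Rightarrow> 'c \<Rightarrow> 'b \<Rightarrow> 'a \<times> 'b \<times> 'c" where "leaf2 x z = (\<lambda>y. (x, y, z))"
definition leaf3 :: "'a \<Rightarrow> 'b \<Rightarrow> 'c \<Rightarrow> 'a \<times> 'b \<times> 'c" where "leaf3 x y = (\<lambda>z. (x, y, z))"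

definition factor_dist1 ::
  "('a::topological_space, 'e::euclidean_space) atlas \<Rightarrow>
   ('b::topological_space, 'f::euclidean_space) atlas \<Rightarrow>
   ('c::topological_space, 'k::euclidean_space) atlas \<Rightarrow>
   'a \<times> 'b \<times> 'c \<Rightarrow> ('a \<times> 'b \<times> 'c) tvec set" where
  "factor_dist1 A1 A2 A3 = (\<lambda>(x, y, z). tangent_image A1 (triple_atlas A1 A2 A3) (leaf1 y z) x)"

definition factor_dist2 ::
  "('a::topological_space, 'e::euclidean_space) atlas \<Rightarrow>
   ('b::topological_space, 'f::euclidean_space) atlas \<Rightarrow>
   ('c::topological_space, 'k::euclidean_space) atlas \<Rightarrow>
   'a \<times> 'b \<times> 'c \<Rightarrow> ('a \<times> 'b \<times> 'c) tvec set" where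
  "factor_dist2 A1 A2 A3 = (\<lambda>(x, y, z). tangent_image A2 (triple_atlas A1 A2 A3) (leaf2 x z) y)"

definition factor_dist3 ::
  "('a::topological_space, 'e::euclidean_space) atlas \<Rightarrow>
   ('b::topological_space, 'f::euclidean_space) atlas \<Rightarrow>
   ('c::topological_space, 'k::euclidean_space) atlas \<Rightarrow>
   'a \<times> 'b \<times> 'c \<Rightarrow> ('a \<times> 'b \<times> 'c) tvec set" where
  "factor_dist3 A1 A2 A3 = (\<lambda>(x, y, z). tangent_image A3 (triple_atlas A1 A2 A3) (leaf3 x y) z)"

definition biwarped_submanifold ::
  "('a::{t2_space,second_countable_topology}, 'e::euclidean_space) atlas \<Rightarrow> 'a metric \<Rightarrow>
   ('b::{t2_space,second_countable_topology}, 'f::euclidean_space) atlas \<Rightarrow> 'b metric \<Rightarrow>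
   ('c::{t2_space,second_countable_topology}, 'k::euclidean_space) atlas \<Rightarrow> 'c metric \<Rightarrow>
   ('a \<Rightarrow> real) \<Rightarrow> ('a \<Rightarrow> real) \<Rightarrow>
   ('q::topological_space, 'm::euclidean_space) atlas \<Rightarrow> 'q metric \<Rightarrow>
   ('a \<times> 'b \<times> 'c \<Rightarrow> 'q) \<Rightarrow> bool" where
  "biwarped_submanifold A1 g1 A2 g2 A3 g3 f1 f2 B g F \<longleftrightarrow>
     riemannian_manifold A1 g1 \<and> riemannian_manifold A2 g2 \<and> riemannian_manifold A3 g3 \<and>
     smooth_fun_on A1 UNIV f1 \<and> (\<forall>x. f1 x > 0) \<and>
     smooth_fun_on A1 UNIV f2 \<and> (\<forall>x. f2 x > 0) \<and>
     immersion (triple_atlas A1 A2 A3) B F \<and>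
     (\<forall>x. \<forall>v\<in>tangent_space (triple_atlas A1 A2 A3) x. \<forall>w\<in>tangent_space (triple_atlas A1 A2 A3) x.
        induced_metric B g F x v w = biwarped_metric A1 g1 A2 g2 A3 g3 f1 f2 x v w)"

text \<open>\<open>\<theta>\<close> is the slant function of the leaves tangent to the third factor, as a function on the
  product.\<close>

definition CRS_biwarped ::
  "('a::{t2_space,second_countable_topology}, 'e::euclidean_space) atlas \<Rightarrow> 'a metric \<Rightarrow>
   ('b::{t2_space,second_countable_topology}, 'f::euclidean_space) atlas \<Rightarrow> 'b metric \<Rightarrow>
   ('c::{t2_space,second_countable_topology}, 'k::euclidean_space) atlas \<Rightarrow> 'c metric \<Rightarrow>
   ('a \<Rightarrow> real) \<Rightarrow> ('a \<Rightarrow> real) \<Rightarrow>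
   ('q::topological_space, 'm::euclidean_space) atlas \<Rightarrow> 'q metric \<Rightarrow>
   ('q \<Rightarrow> 'q tvec \<Rightarrow> 'q tvec) \<Rightarrow> 'q vfield \<Rightarrow>
   ('a \<times> 'b \<times> 'c \<Rightarrow> 'q) \<Rightarrow> ('a \<times> 'b \<times> 'c \<Rightarrow> real) \<Rightarrow> bool" where
  "CRS_biwarped AT gT Ap gp As gs f1 f2 B g \<phi> \<xi> F \<theta> \<longleftrightarrow>
     biwarped_submanifold AT gT Ap gp As gs f1 f2 B g F \<and>
     (\<forall>y z. invariant_submanifold AT B \<phi> \<xi> (F \<circ> leaf1 y z)) \<and>
     (\<forall>x z. anti_invariant_submanifold Ap B g \<phi> (F \<circ> leaf2 x z)) \<and>
     (\<forall>x y. pointwise_slant As B g \<phi> (F \<circ> leaf3 x y) (\<theta> \<circ> leaf3 x y))"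

text \<open>For connected domains this means constant.\<close>

definition locally_constant :: "('a::topological_space \<Rightarrow> real) \<Rightarrow> bool" where
  "locally_constant f \<longleftrightarrow> (\<forall>x. \<exists>U. open U \<and> x \<in> U \<and> f constant_on U)"

end

theory Submission
  imports Defs
begin

text \<open>
  Notation: \<open>X\<close> is tangent to \<open>N\<^sub>T\<close>; \<open>V\<close> and \<open>W\<close> are tangent to one of the other two factors, with warping
  function \<open>f\<close>; \<open>h\<close> is the second fundamental form of the product.

  The proof works with the coordinate fields of a product chart. Let \<open>S(U, U')\<close> be the ambient
  derivative of the field \<open>U'\<close> in the direction \<open>U\<close>, called \<open>nab U U'\<close> below. It is symmetric because
  coordinate fields commute, and \<open>h(U, U')\<close> is its normal part. The Koszul formula expresses its tangential part by first
  derivatives of the induced metric, and for a bi-warped metric it follows that \<open>S(X, V)\<close> has tangential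
  part \<open>X(ln f) V\<close> and that \<open>g(S(V, W), X) = - X(ln f) g(V, W)\<close>.

  The cosymplectic structure enters through the parallel two-form \<open>g(\<phi> _, _)\<close>. It vanishes on pairs of
  a vector tangent to \<open>N\<^sub>T\<close> and one tangent to the other factors, because \<open>N\<^sub>T\<close> is invariant. The
  derivative of this relation (lemma \<open>parallel_mixed\<close>) turns the second formula above into
  \<open>g(h(X, V), \<phi> W) = - (\<phi> X)(ln f) g(V, W) + X(ln f) g(\<phi> V, W)\<close>, which is lemma \<open>II_phi\<close>. The same
  argument with the parallel endomorphism \<open>\<phi>\<^sup>2\<close> yields \<open>\<xi>(ln f) = 0\<close> (lemma \<open>dlog_xi\<close>).

  The rest is linear algebra at one point. Let \<open>P V\<close> be the orthogonal projection of \<open>\<phi> V\<close> to the factor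
  of \<open>V\<close>, so that \<open>\<bar>P V\<bar>\<^sup>2 = C \<bar>V\<bar>\<^sup>2\<close>, where \<open>C = 0\<close> on \<open>N\<^sub>\<bottom>\<close> and \<open>C = cos\<^sup>2 \<theta>\<close> on \<open>N\<^sub>\<theta>\<close>. For
  \<open>W = - (\<phi> X)(ln f) V + X(ln f) P V\<close> the identity reads \<open>g(h(X, V), \<phi> W) = \<bar>W\<bar>\<^sup>2\<close>. As \<open>h(X, V)\<close> only sees
  \<open>\<phi> W - P W\<close>, which has squared length \<open>(1 - C) \<bar>W\<bar>\<^sup>2\<close>, the Cauchy-Schwarz inequality gives
  \<open>(1 - C) \<bar>h(X, V)\<bar>\<^sup>2 \<ge> ((\<phi> X)(ln f))\<^sup>2 + C (X(ln f))\<^sup>2\<close> for unit vectors \<open>V\<close> (lemma \<open>pointwise_bound\<close>).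
  Summation over orthonormal bases gives \<open>n (1 + C) / (1 - C) \<bar>\<nabla> ln f\<bar>\<^sup>2\<close>, as \<open>\<phi>\<close> preserves the length of
  \<open>\<nabla> ln f\<close>, and \<open>(1 + cos\<^sup>2 \<theta>) / (1 - cos\<^sup>2 \<theta>) = 1 + 2 cot\<^sup>2 \<theta>\<close>. The two mixed blocks of \<open>h\<close> occur twice
  each in \<open>\<bar>h\<bar>\<^sup>2\<close>, whence the inequality.

  In the case of equality all other blocks of \<open>h\<close> vanish. Then \<open>S\<close> is tangent to the product on each
  factor, where the formulas for its tangential part show that the leaves of \<open>N\<^sub>T\<close> are totally geodesic
  and the other leaves totally umbilical with mean curvature vector \<open>- \<nabla> ln f\<close>. Finally, if one of the
  two mixed blocks vanishes, the identity for \<open>g(h(X, V), \<phi> W)\<close> forces \<open>\<nabla> ln f = 0\<close>, so \<open>f\<close> is locally constant.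
\<close>

section \<open>Iterated differentiability\<close>

lemma Ck_on_subset: "Ck_on k S f \<Longrightarrow> T \<subseteq> S \<Longrightarrow> Ck_on k T f"
  by (induction k arbitrary: f) (auto intro: continuous_on_subset)

lemma Ck_on_SucD: "Ck_on (Suc k) S f \<Longrightarrow> Ck_on k S f"
proof (induction k arbitrary: f)
  case 0
  then show ?case
    by (auto intro!: differentiable_imp_continuous_on simp: differentiable_on_def differentiable_at_withinI)
next
  case (Suc k)
  then have 1: "\<forall>v. Ck_on (Suc k) S (\<lambda>x. frechet_derivative f (at x) v)" "\<forall>x\<in>S. f differentiable at x"
    using Ck_on.simps(2)[of "Suc k" S f] by blast+
  from Suc.IH 1(1) have "\<forall>v. Ck_on k S (\<lambda>x. frechet_derivative f (at x) v)" by blast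
  with 1(2) show ?case by simp
qed

lemma Ck_on_cong:
  assumes "open S" "\<And>x. x \<in> S \<Longrightarrow> f x = g x" "Ck_on k S f"
  shows "Ck_on k S g"
  using assms(2,3)
proof (induction k arbitrary: f g)
  case 0
  then show ?case using continuous_on_cong by force
next
  case (Suc k)
  have fd: "f differentiable at x" if "x \<in> S" for x using Suc.prems(2) that by auto
  have gd: "g differentiable at x" if "x \<in> S" for x
    using has_derivative_transform_within_open[of f _ x UNIV S g, OF _ assms(1) that Suc.prems(1)] fd[OF that]
    unfolding differentiable_def by blast
  have eq: "frechet_derivative f (at x) = frechet_derivative g (at x)" if "x \<in> S" for x
    by (rule frechet_derivative_transform_within_open[OF fd[OF that] assms(1) that Suc.prems(1)])
  have "Ck_on k S (\<lambda>x. frechet_derivative g (at x) v)" for v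
    by (rule Suc.IH[where f = "\<lambda>x. frechet_derivative f (at x) v"]) (use eq Suc.prems(2) in auto)
  with gd show ?case by auto
qed

text \<open>The predicate \<open>Ck_on\<close> refers to \<open>frechet_derivative\<close>; this rule allows the derivative to be given by
  any formula.\<close>

lemma Ck_on_SucI:
  assumes "open S" "\<And>x. x \<in> S \<Longrightarrow> (f has_derivative f' x) (at x)" "\<And>v. Ck_on k S (\<lambda>x. f' x v)"
  shows "Ck_on (Suc k) S f"
proof -
  have eq: "f' x = frechet_derivative f (at x)" if "x \<in> S" for x
    by (rule frechet_derivative_at[OF assms(2)[OF that]])
  have "Ck_on k S (\<lambda>x. frechet_derivative f (at x) v)" for v
    by (rule Ck_on_cong[OF assms(1) _ assms(3)[of v]]) (simp add: eq)
  then show ?thesis using assms(2) by (auto simp: differentiable_def)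
qed

lemma Ck_on_Suc_has_derivative:
  "Ck_on (Suc k) S f \<Longrightarrow> x \<in> S \<Longrightarrow> (f has_derivative frechet_derivative f (at x)) (at x)"
  by (auto simp: frechet_derivative_works)

lemma Ck_on_const: "Ck_on k S (\<lambda>x. c)"
  by (induction k arbitrary: c) auto

lemma Ck_on_bounded_linear_comp:
  assumes "open S" "bounded_linear L" "Ck_on k S f"
  shows "Ck_on k S (\<lambda>x. L (f x))"
  using assms(3)
proof (induction k arbitrary: f)
  case 0
  then show ?case using bounded_linear.continuous_on[OF assms(2)] by auto
next
  case (Suc k)
  show ?case
    by (rule Ck_on_SucI[OF assms(1) bounded_linear.has_derivative[OF assms(2) Ck_on_Suc_has_derivative[OF Suc.prems]]])
      (use Suc in auto)
qed

lemma Ck_on_id: "Ck_on k S (\<lambda>x. x)"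
  by (cases k) (auto simp: Ck_on_const)

lemma Ck_on_add:
  assumes "open S" "Ck_on k S f" "Ck_on k S g"
  shows "Ck_on k S (\<lambda>x. f x + g x)"
  using assms(2,3)
proof (induction k arbitrary: f g)
  case 0
  then show ?case by (auto intro: continuous_intros)
next
  case (Suc k)
  show ?case
    by (rule Ck_on_SucI[OF assms(1) has_derivative_add[OF Ck_on_Suc_has_derivative[OF Suc.prems(1)]
        Ck_on_Suc_has_derivative[OF Suc.prems(2)]]]) (use Suc in auto)
qed

lemma Ck_on_sum:
  assumes "open S" "\<And>i. i \<in> I \<Longrightarrow> Ck_on k S (f i)"
  shows "Ck_on k S (\<lambda>x. \<Sum>i\<in>I. f i x)"
  using assms(2)
  by (induction I rule: infinite_finite_induct) (auto simp: Ck_on_const intro: Ck_on_add[OF assms(1)])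

lemma Ck_on_bilinear:
  assumes "open S" "bounded_bilinear pr" "Ck_on k S f" "Ck_on k S g"
  shows "Ck_on k S (\<lambda>x. pr (f x) (g x))"
  using assms(3,4)
proof (induction k arbitrary: f g)
  case 0
  then show ?case using bounded_bilinear.continuous_on[OF assms(2)] by auto
next
  case (Suc k)
  show ?case
    by (rule Ck_on_SucI[OF assms(1) bounded_bilinear.FDERIV[OF assms(2) Ck_on_Suc_has_derivative[OF Suc.prems(1)]
        Ck_on_Suc_has_derivative[OF Suc.prems(2)]]])
      (use Suc Ck_on_SucD[OF Suc.prems(1)] Ck_on_SucD[OF Suc.prems(2)] in
        \<open>auto intro!: Ck_on_add[OF assms(1)]\<close>)
qed

lemma has_derivative_expand_Basis:
  fixes f :: "'e::euclidean_space \<Rightarrow> 'f::real_normed_vector"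
  assumes "(f has_derivative f') (at x)"
  shows "f' v = (\<Sum>b\<in>Basis. (v \<bullet> b) *\<^sub>R f' b)"
proof -
  have "f' v = f' (\<Sum>b\<in>Basis. (v \<bullet> b) *\<^sub>R b)" by (simp add: euclidean_representation)
  also have "\<dots> = (\<Sum>b\<in>Basis. (v \<bullet> b) *\<^sub>R f' b)"
    using has_derivative_linear[OF assms] by (simp add: linear_sum linear_cmul)
  finally show ?thesis .
qed

text \<open>The chain rule is expanded in a basis, because the induction hypothesis applies to the partial
  derivatives of \<open>g\<close> in fixed directions.\<close>

lemma Ck_on_comp:
  fixes f :: "'e::euclidean_space \<Rightarrow> 'f::euclidean_space" and g :: "'f \<Rightarrow> 'g::real_normed_vector"
  assumes "open S" "f ` S \<subseteq> T" "Ck_on k S f" "Ck_on k T g"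
  shows "Ck_on k S (g \<circ> f)"
  using assms(3,4)
proof (induction k arbitrary: g)
  case 0
  then show ?case using continuous_on_compose[of S f g] continuous_on_subset assms(2) by auto
next
  case (Suc k)
  let ?f' = "\<lambda>x. frechet_derivative f (at x)" and ?g' = "\<lambda>x. frechet_derivative g (at x)"
  have gd: "(g has_derivative ?g' (f x)) (at (f x))" if "x \<in> S" for x
    by (rule Ck_on_Suc_has_derivative[OF Suc.prems(2)]) (use that assms(2) in auto)
  have fd: "(f has_derivative ?f' x) (at x)" if "x \<in> S" for x
    by (rule Ck_on_Suc_has_derivative[OF Suc.prems(1) that])
  have "Ck_on k S (\<lambda>x. \<Sum>b\<in>Basis. (?f' x v \<bullet> b) *\<^sub>R ?g' (f x) b)" for v
  proof (rule Ck_on_sum[OF assms(1)])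
    fix b :: 'f
    have 1: "Ck_on k S (\<lambda>x. ?f' x v \<bullet> b)"
      by (rule Ck_on_bounded_linear_comp[OF assms(1) bounded_linear_inner_left]) (use Suc.prems in auto)
    have "Ck_on k S ((\<lambda>y. ?g' y b) \<circ> f)"
      by (rule Suc.IH) (use Suc.prems Ck_on_SucD in auto)
    then show "Ck_on k S (\<lambda>x. (?f' x v \<bullet> b) *\<^sub>R ?g' (f x) b)"
      using Ck_on_bilinear[OF assms(1) bounded_bilinear_scaleR 1] by (simp add: o_def)
  qed
  then have "Ck_on k S (\<lambda>x. ?g' (f x) (?f' x v))" for v
    by (rule Ck_on_cong[OF assms(1), rotated]) (use has_derivative_expand_Basis[OF gd] in auto)
  moreover have "(g \<circ> f has_derivative (\<lambda>v. ?g' (f x) (?f' x v))) (at x)" if "x \<in> S" for x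
    using diff_chain_at[OF fd gd] that by (simp add: o_def)
  ultimately show ?case
    by (rule Ck_on_SucI[OF assms(1), where f' = "\<lambda>x v. ?g' (f x) (?f' x v)", rotated])
qed

lemma Ck_on_local:
  assumes "\<And>x. x \<in> S \<Longrightarrow> \<exists>T. open T \<and> x \<in> T \<and> Ck_on k T f"
  shows "Ck_on k S f"
  using assms
proof (induction k arbitrary: f)
  case 0
  have "isCont f x" if "x \<in> S" for x
  proof -
    obtain T where "open T" "x \<in> T" "Ck_on 0 T f" using 0 \<open>x \<in> S\<close> by blast
    then show ?thesis using continuous_on_eq_continuous_at[of T f] by auto
  qed
  then show ?case by (simp add: continuous_at_imp_continuous_on)
next
  case (Suc k)
  have "Ck_on k S (\<lambda>x. frechet_derivative f (at x) v)" for v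
    by (rule Suc.IH) (metis Suc.prems Ck_on.simps(2))
  moreover have "f differentiable at x" if "x \<in> S" for x
    by (metis Suc.prems that Ck_on.simps(2))
  ultimately show ?case by simp
qed

lemma smooth_on_subset: "smooth_on S f \<Longrightarrow> T \<subseteq> S \<Longrightarrow> smooth_on T f"
  unfolding smooth_on_def using Ck_on_subset by blast

lemma smooth_on_cong: "smooth_on S f \<Longrightarrow> open S \<Longrightarrow> (\<And>x. x \<in> S \<Longrightarrow> f x = g x) \<Longrightarrow> smooth_on S g"
  unfolding smooth_on_def using Ck_on_cong by blast

lemma smooth_on_local: "(\<And>x. x \<in> S \<Longrightarrow> \<exists>T. open T \<and> x \<in> T \<and> smooth_on T f) \<Longrightarrow> smooth_on S f"
  unfolding smooth_on_def by (meson Ck_on_local)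

lemma smooth_on_const: "smooth_on S (\<lambda>x. c)"
  unfolding smooth_on_def by (simp add: Ck_on_const)

lemma smooth_on_id: "smooth_on S (\<lambda>x. x)"
  unfolding smooth_on_def by (simp add: Ck_on_id)

lemma smooth_on_bounded_linear:
  "smooth_on S f \<Longrightarrow> open S \<Longrightarrow> bounded_linear L \<Longrightarrow> smooth_on S (\<lambda>x. L (f x))"
  unfolding smooth_on_def using Ck_on_bounded_linear_comp by blast

lemma smooth_on_add: "smooth_on S f \<Longrightarrow> smooth_on S g \<Longrightarrow> open S \<Longrightarrow> smooth_on S (\<lambda>x. f x + g x)"
  unfolding smooth_on_def using Ck_on_add by blast

lemma smooth_on_sum: "(\<And>i. i \<in> I \<Longrightarrow> smooth_on S (f i)) \<Longrightarrow> open S \<Longrightarrow> smooth_on S (\<lambda>x. \<Sum>i\<in>I. f i x)"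
  unfolding smooth_on_def by (simp add: Ck_on_sum)

lemma smooth_on_scaleR:
  fixes f :: "'e::euclidean_space \<Rightarrow> real"
  shows "smooth_on S f \<Longrightarrow> smooth_on S g \<Longrightarrow> open S \<Longrightarrow> smooth_on S (\<lambda>x. f x *\<^sub>R g x)"
  unfolding smooth_on_def using Ck_on_bilinear[OF _ bounded_bilinear_scaleR] by blast

lemma smooth_on_comp:
  "smooth_on S f \<Longrightarrow> smooth_on T g \<Longrightarrow> open S \<Longrightarrow> f ` S \<subseteq> T \<Longrightarrow> smooth_on S (g \<circ> f)"
  unfolding smooth_on_def using Ck_on_comp by blast

lemma smooth_on_componentwise:
  fixes f :: "'e::euclidean_space \<Rightarrow> 'f::euclidean_space"
  assumes "open S" "\<And>b. b \<in> Basis \<Longrightarrow> smooth_on S (\<lambda>x. f x \<bullet> b)"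
  shows "smooth_on S f"
proof -
  have "smooth_on S (\<lambda>x. \<Sum>b\<in>Basis. (f x \<bullet> b) *\<^sub>R b)"
    by (intro smooth_on_sum smooth_on_scaleR smooth_on_const assms)
  then show ?thesis by (simp add: euclidean_representation)
qed

lemma smooth_on_Pair:
  assumes "smooth_on S f" "smooth_on S g" "open S"
  shows "smooth_on S (\<lambda>x. (f x, g x))"
proof -
  have "smooth_on S (\<lambda>x. (f x, 0) + (0, g x))"
    by (intro smooth_on_add smooth_on_bounded_linear[OF assms(1)] smooth_on_bounded_linear[OF assms(2)] assms(3)
        bounded_linear_Pair bounded_linear_ident bounded_linear_zero)
  then show ?thesis by simp
qed

lemma smooth_on_has_derivative:
  "smooth_on S f \<Longrightarrow> x \<in> S \<Longrightarrow> (f has_derivative frechet_derivative f (at x)) (at x)"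
  unfolding smooth_on_def using Ck_on_Suc_has_derivative by blast

lemma smooth_on_differentiable: "smooth_on S f \<Longrightarrow> x \<in> S \<Longrightarrow> f differentiable (at x)"
  by (meson differentiableI smooth_on_has_derivative)

lemma smooth_on_frechet_derivative:
  "smooth_on S f \<Longrightarrow> smooth_on S (\<lambda>x. frechet_derivative f (at x) v)"
  unfolding smooth_on_def using Ck_on.simps(2) by blast

text \<open>The derivatives of the inverse function are products of inverse functions again.\<close>

lemma smooth_on_ln: "smooth_on {0<..} (ln :: real \<Rightarrow> real)"
  unfolding smooth_on_def
proof
  have inv: "Ck_on k {0<..} (inverse :: real \<Rightarrow> real)" for k
  proof (induction k)
    case 0
    then show ?case by (auto intro!: continuous_intros)
  next
    case (Suc k)
    have sq: "Ck_on k {0<..} (\<lambda>x::real. inverse x * inverse x)"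
      by (rule Ck_on_bilinear[OF _ bounded_bilinear_mult Suc Suc]) simp
    have "bounded_linear (\<lambda>t::real. - (t * v))" for v
      by (intro bounded_linear_minus bounded_linear_mult_left)
    from Ck_on_bounded_linear_comp[OF _ this sq]
    have d: "Ck_on k {0<..} (\<lambda>x. - (inverse x * inverse x * v))" for v :: real by simp
    show ?case
      by (rule Ck_on_SucI[OF _ _ d]) (auto intro!: derivative_eq_intros simp: fun_eq_iff)
  qed
  fix k
  have "Ck_on (Suc k) {0<..} (ln :: real \<Rightarrow> real)"
  proof (rule Ck_on_SucI)
    show "(ln has_derivative (\<lambda>v. v * inverse x)) (at x)" if "x \<in> {0<..}" for x :: real
      using that by (auto intro!: derivative_eq_intros simp: fun_eq_iff divide_inverse)
    show "Ck_on k {0<..} (\<lambda>x. v * inverse x)" for v :: real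
      by (rule Ck_on_bounded_linear_comp[OF _ bounded_linear_mult_right inv]) simp
  qed simp
  then show "Ck_on k {0<..} (ln :: real \<Rightarrow> real)" by (rule Ck_on_SucD)
qed

text \<open>It suffices to differentiate the formula \<open>h\<close> along a line, so nothing has to be known about the
  smoothness of those parts of \<open>h\<close> that are constant on the line.\<close>

lemma derivative_along_line:
  fixes f :: "'e::euclidean_space \<Rightarrow> real"
  assumes f: "(f has_derivative f') (at q)" and N: "open N" "q \<in> N" "\<And>p. p \<in> N \<Longrightarrow> f p = h p"
    and d: "((\<lambda>t. h (q + t *\<^sub>R w)) has_real_derivative d) (at 0)"
  shows "f' w = d"
proof -
  have "(h has_derivative f') (at (q + 0 *\<^sub>R w))"
    using has_derivative_transform_within_open[OF f N] by simp
  moreover have "((\<lambda>t. q + t *\<^sub>R w) has_derivative (\<lambda>t. t *\<^sub>R w)) (at (0::real))"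
    by (auto intro!: derivative_eq_intros)
  ultimately have "(h \<circ> (\<lambda>t. q + t *\<^sub>R w) has_derivative f' \<circ> (\<lambda>t. t *\<^sub>R w)) (at 0)"
    by (rule diff_chain_at[rotated])
  moreover have "f' \<circ> (\<lambda>t. t *\<^sub>R w) = (*) (f' w)"
    using linear_cmul[OF has_derivative_linear[OF f]] by (auto simp: fun_eq_iff)
  ultimately have "((\<lambda>t. h (q + t *\<^sub>R w)) has_real_derivative f' w) (at 0)"
    by (simp add: has_field_derivative_def o_def)
  from DERIV_unique[OF this d] show ?thesis .
qed

text \<open>Two applications of the mean value theorem to the second difference. As the second difference is
  symmetric in \<open>u\<close> and \<open>v\<close>, so are the second derivatives in the limit.\<close>

lemma second_difference_mean_value:
  fixes f :: "'e::euclidean_space \<Rightarrow> real"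
  assumes C: "Ck_on 2 S f" and h: "h > 0"
    and S: "\<And>s t. \<bar>s\<bar> \<le> h \<Longrightarrow> \<bar>t\<bar> \<le> h \<Longrightarrow> x + s *\<^sub>R u + t *\<^sub>R v \<in> S"
  obtains s t where "0 < s" "s < h" "0 < t" "t < h"
    "f (x + h *\<^sub>R u + h *\<^sub>R v) - f (x + h *\<^sub>R v) - f (x + h *\<^sub>R u) + f x =
     h\<^sup>2 * frechet_derivative (\<lambda>y. frechet_derivative f (at y) v) (at (x + s *\<^sub>R u + t *\<^sub>R v)) u"
proof -
  let ?f' = "\<lambda>y. frechet_derivative f (at y)"
  have C1: "Ck_on (Suc 1) S f" using C by (simp add: numeral_2_eq_2)
  have C2: "Ck_on (Suc 0) S (\<lambda>y. ?f' y v)" using C1 by simp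
  have D: "((\<lambda>t. f (x + s *\<^sub>R u + t *\<^sub>R v)) has_real_derivative ?f' (x + s *\<^sub>R u + t *\<^sub>R v) v) (at t)"
    if "\<bar>s\<bar> \<le> h" "\<bar>t\<bar> \<le> h" for s t
  proof -
    have fd: "(f has_derivative ?f' (x + s *\<^sub>R u + t *\<^sub>R v)) (at (x + s *\<^sub>R u + t *\<^sub>R v))"
      by (rule Ck_on_Suc_has_derivative[OF C1 S[OF that]])
    have "((\<lambda>t. x + s *\<^sub>R u + t *\<^sub>R v) has_derivative (\<lambda>t. t *\<^sub>R v)) (at t)"
      by (auto intro!: derivative_eq_intros)
    from diff_chain_at[OF this fd] show ?thesis
      using has_derivative_linear[OF fd]
      by (simp add: has_field_derivative_def o_def linear_cmul mult_commute_abs)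
  qed
  have "\<exists>t>0. t < h \<and> f (x + h *\<^sub>R u + h *\<^sub>R v) - f (x + 0 *\<^sub>R u + h *\<^sub>R v)
      - (f (x + h *\<^sub>R u + 0 *\<^sub>R v) - f (x + 0 *\<^sub>R u + 0 *\<^sub>R v))
     = (h - 0) * (?f' (x + h *\<^sub>R u + t *\<^sub>R v) v - ?f' (x + 0 *\<^sub>R u + t *\<^sub>R v) v)"
  proof (rule MVT2[OF h])
    fix t assume "0 \<le> t" "t \<le> h"
    then show "((\<lambda>t. f (x + h *\<^sub>R u + t *\<^sub>R v) - f (x + 0 *\<^sub>R u + t *\<^sub>R v)) has_real_derivative
      ?f' (x + h *\<^sub>R u + t *\<^sub>R v) v - ?f' (x + 0 *\<^sub>R u + t *\<^sub>R v) v) (at t)"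
      using h by (intro DERIV_diff D) auto
  qed
  then obtain t where t: "0 < t" "t < h"
    and e1: "f (x + h *\<^sub>R u + h *\<^sub>R v) - f (x + h *\<^sub>R v) - f (x + h *\<^sub>R u) + f x
     = h * (?f' (x + h *\<^sub>R u + t *\<^sub>R v) v - ?f' (x + 0 *\<^sub>R u + t *\<^sub>R v) v)" by auto
  let ?g = "\<lambda>y. frechet_derivative (\<lambda>y. ?f' y v) (at y)"
  have "((\<lambda>s. ?f' (x + s *\<^sub>R u + t *\<^sub>R v) v) has_real_derivative ?g (x + s *\<^sub>R u + t *\<^sub>R v) u) (at s)"
    if "0 \<le> s" "s \<le> h" for s
  proof -
    have fd: "((\<lambda>y. ?f' y v) has_derivative ?g (x + s *\<^sub>R u + t *\<^sub>R v)) (at (x + s *\<^sub>R u + t *\<^sub>R v))"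
      by (rule Ck_on_Suc_has_derivative[OF C2 S]) (use that t in auto)
    have "((\<lambda>s. x + s *\<^sub>R u + t *\<^sub>R v) has_derivative (\<lambda>s. s *\<^sub>R u)) (at s)"
      by (auto intro!: derivative_eq_intros)
    from diff_chain_at[OF this fd] show ?thesis
      using has_derivative_linear[OF fd]
      by (simp add: has_field_derivative_def o_def linear_cmul mult_commute_abs)
  qed
  from MVT2[OF h this] obtain s where s: "0 < s" "s < h"
    and e2: "?f' (x + h *\<^sub>R u + t *\<^sub>R v) v - ?f' (x + 0 *\<^sub>R u + t *\<^sub>R v) v = (h - 0) * ?g (x + s *\<^sub>R u + t *\<^sub>R v) u"
    by blast
  show ?thesis by (rule that[OF s t]) (simp only: e1 e2, simp add: power2_eq_square)
qed

lemma second_derivative_symmetric_real: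
  fixes f :: "'e::euclidean_space \<Rightarrow> real"
  assumes C: "Ck_on 2 S f" and S: "open S" "x \<in> S"
  shows "frechet_derivative (\<lambda>y. frechet_derivative f (at y) v) (at x) u =
    frechet_derivative (\<lambda>y. frechet_derivative f (at y) u) (at x) v"
    (is "?A x = ?B x")
proof -
  let ?r = "\<lambda>u v s. frechet_derivative (\<lambda>y. frechet_derivative f (at y) v) (at s) u"
  have close: "\<exists>d>0. \<forall>s t. \<bar>s\<bar> < d \<longrightarrow> \<bar>t\<bar> < d \<longrightarrow>
      x + s *\<^sub>R u + t *\<^sub>R v \<in> S \<and> \<bar>?r u v (x + s *\<^sub>R u + t *\<^sub>R v) - ?r u v x\<bar> < e" if "e > 0" for e u v
  proof -
    have "Ck_on (Suc (Suc 0)) S f" using C by (simp add: numeral_2_eq_2)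
    then have "continuous_on S (?r u v)" by simp
    then have "isCont (?r u v) x" using S continuous_on_eq_continuous_at by blast
    then have "\<forall>\<^sub>F y in nhds x. dist (?r u v y) (?r u v x) < e"
      using that by (simp add: continuous_at_eps_delta eventually_nhds_metric)
    moreover have "\<forall>\<^sub>F y in nhds x. y \<in> S" using S by (rule eventually_nhds_in_open)
    ultimately have "\<forall>\<^sub>F y in nhds x. y \<in> S \<and> dist (?r u v y) (?r u v x) < e"
      by (rule eventually_conj[rotated])
    then obtain d where d: "d > 0" "\<And>y. dist y x < d \<Longrightarrow> y \<in> S \<and> dist (?r u v y) (?r u v x) < e"
      unfolding eventually_nhds_metric by blast
    define c where "c = d / (norm u + norm v + 1)"
    have n: "norm u + norm v + 1 > 0" using norm_ge_zero[of u] norm_ge_zero[of v] by linarith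
    then have c: "c > 0" "c * (norm u + norm v + 1) = d"
      using d(1) unfolding c_def by (auto simp del: add_pos_nonneg)
    have "dist (x + s *\<^sub>R u + t *\<^sub>R v) x < d" if "\<bar>s\<bar> < c" "\<bar>t\<bar> < c" for s t
    proof -
      have "dist (x + s *\<^sub>R u + t *\<^sub>R v) x = norm (s *\<^sub>R u + t *\<^sub>R v)"
        by (simp add: dist_norm add.assoc)
      also have "\<dots> \<le> \<bar>s\<bar> * norm u + \<bar>t\<bar> * norm v" by (metis norm_triangle_ineq norm_scaleR)
      also have "\<dots> \<le> c * norm u + c * norm v" using that by (intro add_mono mult_right_mono) auto
      also have "\<dots> < d" using c by (simp add: algebra_simps)
      finally show ?thesis .
    qed
    then have "\<forall>s t. \<bar>s\<bar> < c \<longrightarrow> \<bar>t\<bar> < c \<longrightarrow> x + s *\<^sub>R u + t *\<^sub>R v \<in> S \<and>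
       \<bar>?r u v (x + s *\<^sub>R u + t *\<^sub>R v) - ?r u v x\<bar> < e" using d(2) by (simp add: dist_real_def)
    then show ?thesis using c(1) by blast
  qed
  have "\<bar>?A x - ?B x\<bar> \<le> e" if "e > 0" for e
  proof -
    have e2: "e/2 > 0" using that by simp
    obtain d1 where d1: "d1 > 0" "\<And>s t. \<bar>s\<bar> < d1 \<Longrightarrow> \<bar>t\<bar> < d1 \<Longrightarrow>
      x + s *\<^sub>R u + t *\<^sub>R v \<in> S \<and> \<bar>?r u v (x + s *\<^sub>R u + t *\<^sub>R v) - ?r u v x\<bar> < e/2"
      using close[OF e2, of u v] by blast
    obtain d2 where d2: "d2 > 0" "\<And>s t. \<bar>s\<bar> < d2 \<Longrightarrow> \<bar>t\<bar> < d2 \<Longrightarrow>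
      x + s *\<^sub>R v + t *\<^sub>R u \<in> S \<and> \<bar>?r v u (x + s *\<^sub>R v + t *\<^sub>R u) - ?r v u x\<bar> < e/2"
      using close[OF e2, of v u] by blast
    define h where "h = min d1 d2 / 2"
    have h: "h > 0" "h < d1" "h < d2" using d1(1) d2(1) by (auto simp: h_def)
    obtain s t where st: "0 < s" "s < h" "0 < t" "t < h" and
      1: "f (x + h *\<^sub>R u + h *\<^sub>R v) - f (x + h *\<^sub>R v) - f (x + h *\<^sub>R u) + f x = h\<^sup>2 * ?r u v (x + s *\<^sub>R u + t *\<^sub>R v)"
      by (rule second_difference_mean_value[OF C h(1), of x u v]) (use d1(2) h in auto)
    obtain s' t' where st': "0 < s'" "s' < h" "0 < t'" "t' < h" and
      2: "f (x + h *\<^sub>R v + h *\<^sub>R u) - f (x + h *\<^sub>R u) - f (x + h *\<^sub>R v) + f x = h\<^sup>2 * ?r v u (x + s' *\<^sub>R v + t' *\<^sub>R u)"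
      by (rule second_difference_mean_value[OF C h(1), of x v u]) (use d2(2) h in auto)
    have "h\<^sup>2 * ?r u v (x + s *\<^sub>R u + t *\<^sub>R v) = h\<^sup>2 * ?r v u (x + s' *\<^sub>R v + t' *\<^sub>R u)"
    proof -
      have "x + h *\<^sub>R u + h *\<^sub>R v = x + h *\<^sub>R v + h *\<^sub>R u" by (simp add: add_ac)
      then have "f (x + h *\<^sub>R u + h *\<^sub>R v) = f (x + h *\<^sub>R v + h *\<^sub>R u)" by (rule arg_cong)
      then show ?thesis using 1 2 by linarith
    qed
    then have "?r u v (x + s *\<^sub>R u + t *\<^sub>R v) = ?r v u (x + s' *\<^sub>R v + t' *\<^sub>R u)" using h by simp
    moreover have "\<bar>?r u v (x + s *\<^sub>R u + t *\<^sub>R v) - ?r u v x\<bar> < e/2"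
      "\<bar>?r v u (x + s' *\<^sub>R v + t' *\<^sub>R u) - ?r v u x\<bar> < e/2"
      using d1(2)[of s t] d2(2)[of s' t'] st st' h by auto
    ultimately show ?thesis by linarith
  qed
  then have "\<And>e. e > 0 \<Longrightarrow> \<bar>?A x - ?B x\<bar> \<le> 0 + e" by simp
  then have "\<bar>?A x - ?B x\<bar> \<le> 0" by (rule field_le_epsilon)
  then show ?thesis by simp
qed

lemma frechet_derivative_inner_left:
  assumes "f differentiable (at x)"
  shows "frechet_derivative (\<lambda>y. f y \<bullet> b) (at x) u = frechet_derivative f (at x) u \<bullet> b"
  using bounded_linear.has_derivative[OF bounded_linear_inner_left[of b] assms[unfolded frechet_derivative_works]]
  by (metis frechet_derivative_at)

lemma second_derivative_symmetric:
  fixes f :: "'e::euclidean_space \<Rightarrow> 'f::euclidean_space"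
  assumes C: "smooth_on S f" and S: "open S" "x \<in> S"
  shows "frechet_derivative (\<lambda>y. frechet_derivative f (at y) v) (at x) u =
    frechet_derivative (\<lambda>y. frechet_derivative f (at y) u) (at x) v"
proof (rule euclidean_eqI)
  fix b :: 'f assume "b \<in> Basis"
  have *: "frechet_derivative (\<lambda>y. frechet_derivative f (at y) v) (at x) u \<bullet> b =
    frechet_derivative (\<lambda>y. frechet_derivative (\<lambda>y. f y \<bullet> b) (at y) v) (at x) u" for u v
  proof -
    have d: "(\<lambda>y. frechet_derivative f (at y) v) differentiable at x"
      using smooth_on_differentiable[OF smooth_on_frechet_derivative[OF C]] S by auto
    have "frechet_derivative (\<lambda>y. frechet_derivative f (at y) v \<bullet> b) (at x) =
      frechet_derivative (\<lambda>y. frechet_derivative (\<lambda>y. f y \<bullet> b) (at y) v) (at x)"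
    proof (rule frechet_derivative_transform_within_open[OF _ S])
      show "(\<lambda>y. frechet_derivative f (at y) v \<bullet> b) differentiable at x" using d by simp
      show "frechet_derivative f (at y) v \<bullet> b = frechet_derivative (\<lambda>y. f y \<bullet> b) (at y) v" if "y \<in> S" for y
        using frechet_derivative_inner_left[OF smooth_on_differentiable[OF C that]] by simp
    qed
    then show ?thesis using frechet_derivative_inner_left[OF d, of b u] by (simp only:)
  qed
  have "Ck_on 2 S (\<lambda>y. f y \<bullet> b)"
    using smooth_on_bounded_linear[OF C S(1) bounded_linear_inner_left[of b]] unfolding smooth_on_def by auto
  from second_derivative_symmetric_real[OF this S]
  show "frechet_derivative (\<lambda>y. frechet_derivative f (at y) v) (at x) u \<bullet> b =
     frechet_derivative (\<lambda>y. frechet_derivative f (at y) u) (at x) v \<bullet> b" by (simp only: *)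
qed

section \<open>Subspaces with an inner product\<close>

text \<open>Tangent spaces are subspaces of the type of all operators, and a metric is meaningful on them only;
  hence the linear algebra is relative to a subspace.\<close>

locale inner_at =
  fixes g :: "'a metric" and x :: 'a and V :: "'a tvec set"
  assumes subspace_V: "subspace V"
    and finite_dim: "\<exists>B. finite B \<and> span B = V"
    and linear_right: "v \<in> V \<Longrightarrow> linear_map_on V (g x v)"
    and sym: "v \<in> V \<Longrightarrow> w \<in> V \<Longrightarrow> g x v w = g x w v"
    and pos: "v \<in> V \<Longrightarrow> v \<noteq> 0 \<Longrightarrow> g x v v > 0"
begin

abbreviation G where "G \<equiv> g x"

lemma V_mem [simp]: "0 \<in> V" "v \<in> V \<Longrightarrow> w \<in> V \<Longrightarrow> v + w \<in> V" "v \<in> V \<Longrightarrow> w \<in> V \<Longrightarrow> v - w \<in> V"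
  "v \<in> V \<Longrightarrow> - v \<in> V" "v \<in> V \<Longrightarrow> r *\<^sub>R v \<in> V"
  using subspace_V by (auto simp: subspace_0 subspace_add subspace_diff subspace_neg subspace_scale)

lemma V_sum [simp]: "(\<And>i. i \<in> I \<Longrightarrow> f i \<in> V) \<Longrightarrow> (\<Sum>i\<in>I. f i) \<in> V"
  using subspace_V by (auto intro: subspace_sum)

lemma add_right: "v \<in> V \<Longrightarrow> a \<in> V \<Longrightarrow> b \<in> V \<Longrightarrow> G v (a + b) = G v a + G v b"
  and scale_right: "v \<in> V \<Longrightarrow> a \<in> V \<Longrightarrow> G v (r *\<^sub>R a) = r * G v a"
  using linear_right by (auto simp: linear_map_on_def)

lemma add_left: "v \<in> V \<Longrightarrow> a \<in> V \<Longrightarrow> b \<in> V \<Longrightarrow> G (a + b) v = G a v + G b v"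
  by (simp add: sym[of _ v] add_right)

lemma scale_left: "v \<in> V \<Longrightarrow> a \<in> V \<Longrightarrow> G (r *\<^sub>R a) v = r * G a v"
  by (simp add: sym[of _ v] scale_right)

lemma zero_right [simp]: "v \<in> V \<Longrightarrow> G v 0 = 0"
  using scale_right[of v 0 0] by simp

lemma zero_left [simp]: "v \<in> V \<Longrightarrow> G 0 v = 0"
  using scale_left[of v 0 0] by simp

lemma minus_right: "v \<in> V \<Longrightarrow> a \<in> V \<Longrightarrow> G v (- a) = - G v a"
  using scale_right[of v a "-1"] by simp

lemma minus_left: "v \<in> V \<Longrightarrow> a \<in> V \<Longrightarrow> G (- a) v = - G a v"
  using scale_left[of v a "-1"] by simp

lemma diff_right: "v \<in> V \<Longrightarrow> a \<in> V \<Longrightarrow> b \<in> V \<Longrightarrow> G v (a - b) = G v a - G v b"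
  using add_right[of v a "- b"] minus_right[of v b] by simp

lemma diff_left: "v \<in> V \<Longrightarrow> a \<in> V \<Longrightarrow> b \<in> V \<Longrightarrow> G (a - b) v = G a v - G b v"
  using add_left[of v a "- b"] minus_left[of v b] by simp

lemma sum_right: "v \<in> V \<Longrightarrow> (\<And>i. i \<in> I \<Longrightarrow> f i \<in> V) \<Longrightarrow> G v (\<Sum>i\<in>I. f i) = (\<Sum>i\<in>I. G v (f i))"
  by (induction I rule: infinite_finite_induct) (auto simp: add_right)

lemma sum_left: "v \<in> V \<Longrightarrow> (\<And>i. i \<in> I \<Longrightarrow> f i \<in> V) \<Longrightarrow> G (\<Sum>i\<in>I. f i) v = (\<Sum>i\<in>I. G (f i) v)"
  by (induction I rule: infinite_finite_induct) (auto simp: add_left)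

lemmas bilin = add_right add_left scale_right scale_left minus_right minus_left diff_right diff_left

lemma nonneg: "v \<in> V \<Longrightarrow> G v v \<ge> 0"
  using pos[of v] by (cases "v = 0") auto

lemma eq_0_iff: "v \<in> V \<Longrightarrow> G v v = 0 \<longleftrightarrow> v = 0"
  using pos[of v] by (cases "v = 0") auto

lemma eqI:
  assumes "U \<subseteq> V" "subspace U" "v \<in> U" "w \<in> U" "\<And>s. s \<in> U \<Longrightarrow> G v s = G w s"
  shows "v = w"
proof -
  have "v - w \<in> U" using assms by (simp add: subspace_diff)
  then have "G (v - w) (v - w) = 0"
    using assms(1,3,4) assms(5)[of "v - w"] by (subst diff_left) auto
  then show ?thesis using eq_0_iff[of "v - w"] \<open>v - w \<in> U\<close> assms(1) by auto
qed

lemma cauchy_schwarz: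
  assumes "v \<in> V" "w \<in> V"
  shows "(G v w)\<^sup>2 \<le> G v v * G w w"
proof (cases "w = 0")
  case False
  define r where "r = G w w"
  have r: "r > 0" using pos assms False by (simp add: r_def)
  have "0 \<le> G (r *\<^sub>R v - G v w *\<^sub>R w) (r *\<^sub>R v - G v w *\<^sub>R w)"
    by (rule nonneg) (use assms in auto)
  also have "\<dots> = r * (r * G v v - (G v w)\<^sup>2)"
    using assms by (simp add: bilin r_def sym[of w v] power2_eq_square algebra_simps)
  finally show ?thesis using r by (simp add: zero_le_mult_iff r_def mult.commute)
qed (use assms in simp)

definition orthonormal :: "'a tvec set \<Rightarrow> bool" where
  "orthonormal e \<longleftrightarrow> finite e \<and> e \<subseteq> V \<and> (\<forall>v\<in>e. \<forall>w\<in>e. G v w = (if v = w then 1 else 0))"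

lemma span_in_V: "e \<subseteq> V \<Longrightarrow> span e \<subseteq> V"
  using subspace_V by (rule span_minimal[rotated])

lemma orthonormal_coeff:
  assumes "orthonormal e" "b \<in> e"
  shows "G (\<Sum>a\<in>e. c a *\<^sub>R a) b = c b"
proof -
  have "G (\<Sum>a\<in>e. c a *\<^sub>R a) b = (\<Sum>a\<in>e. c a * G a b)"
    using assms by (subst sum_left) (auto simp: orthonormal_def scale_left subset_iff)
  also have "\<dots> = (\<Sum>a\<in>e. if a = b then c a else 0)"
    using assms by (intro sum.cong) (auto simp: orthonormal_def)
  also have "\<dots> = c b" using assms by (simp add: orthonormal_def)
  finally show ?thesis .
qed

lemma orthogonal_span:
  assumes "v \<in> V" "e \<subseteq> V" "\<And>b. b \<in> e \<Longrightarrow> G v b = 0" "s \<in> span e"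
  shows "G v s = 0"
proof -
  have "subspace {s \<in> V. G v s = 0}"
    using assms(1) by (auto simp: subspace_def bilin)
  then have "span e \<subseteq> {s \<in> V. G v s = 0}" using assms by (intro span_minimal) auto
  then show ?thesis using assms(4) by auto
qed

lemma fourier_orthogonal:
  assumes e: "orthonormal e" and v: "v \<in> V" and s: "s \<in> span e"
  shows "G (v - (\<Sum>b\<in>e. G v b *\<^sub>R b)) s = 0"
proof (rule orthogonal_span[OF _ _ _ s])
  show eV: "e \<subseteq> V" using e by (simp add: orthonormal_def)
  then show "v - (\<Sum>b\<in>e. G v b *\<^sub>R b) \<in> V" using v by (auto simp: subset_iff)
  fix b assume b: "b \<in> e"
  then show "G (v - (\<Sum>b\<in>e. G v b *\<^sub>R b)) b = 0"
    using orthonormal_coeff[OF e b] v eV by (subst diff_left) (auto simp: subset_iff)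
qed

lemma fourier_in_span: "(\<Sum>b\<in>e. c b *\<^sub>R b) \<in> span e"
  by (intro span_sum span_scale span_base)

lemma fourier:
  assumes "orthonormal e" "v \<in> span e"
  shows "v = (\<Sum>b\<in>e. G v b *\<^sub>R b)"
proof (rule eqI[OF span_in_V subspace_span])
  show "e \<subseteq> V" using assms by (simp add: orthonormal_def)
  then have V: "span e \<subseteq> V" by (rule span_in_V)
  show "v \<in> span e" by fact
  show "(\<Sum>b\<in>e. G v b *\<^sub>R b) \<in> span e" by (rule fourier_in_span)
  fix s assume s: "s \<in> span e"
  show "G v s = G (\<Sum>b\<in>e. G v b *\<^sub>R b) s"
  proof -
    have "v \<in> V" "s \<in> V" "(\<Sum>b\<in>e. G v b *\<^sub>R b) \<in> V"
      using V assms(2) s fourier_in_span[of "\<lambda>b. G v b" e] by auto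
    then show ?thesis using fourier_orthogonal[OF assms(1) _ s, of v] by (simp add: diff_left)
  qed
qed

lemma parseval:
  assumes e: "orthonormal e" and v: "v \<in> span e"
  shows "G v v = (\<Sum>b\<in>e. (G v b)\<^sup>2)"
proof -
  have V: "e \<subseteq> V" "v \<in> V" using e span_in_V v by (auto simp: orthonormal_def)
  have "G v v = G v (\<Sum>b\<in>e. G v b *\<^sub>R b)" using fourier[OF e v] by simp
  also have "\<dots> = (\<Sum>b\<in>e. (G v b)\<^sup>2)"
    using V by (subst sum_right) (auto simp: scale_right power2_eq_square subset_iff)
  finally show ?thesis .
qed

text \<open>One step of the Gram-Schmidt process.\<close>

lemma orthonormal_insert:
  assumes e: "orthonormal e" and b: "b \<in> V"
  obtains e' where "orthonormal e'" "span e' = span (insert b e)"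
proof -
  define w where "w = b - (\<Sum>a\<in>e. G b a *\<^sub>R a)"
  have eV: "e \<subseteq> V" using e by (simp add: orthonormal_def)
  have p: "(\<Sum>a\<in>e. G b a *\<^sub>R a) \<in> span e" by (rule fourier_in_span)
  have w: "w \<in> V" using p span_in_V[OF eV] b by (auto simp: w_def)
  have orth: "G w s = 0" if "s \<in> span e" for s
    unfolding w_def by (rule fourier_orthogonal[OF e b that])
  show ?thesis
  proof (cases "w = 0")
    case True
    then have "b \<in> span e" using p by (simp add: w_def)
    then show ?thesis using that[OF e] by (simp add: span_redundant)
  next
    case False
    define n where "n = (1 / sqrt (G w w)) *\<^sub>R w"
    have gw: "G w w > 0" by (rule pos[OF w False])
    have nV: "n \<in> V" using w by (simp add: n_def)
    have nn: "G n n = 1" using gw w by (simp add: n_def bilin)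
    have on: "G n s = 0" if "s \<in> e" for s
      using orth[of s] w eV that by (auto simp: n_def bilin span_base)
    have "orthonormal (insert n e)"
      unfolding orthonormal_def
    proof (intro conjI ballI)
      show "finite (insert n e)" "insert n e \<subseteq> V" using e eV nV by (auto simp: orthonormal_def)
      fix v w assume vw: "v \<in> insert n e" "w \<in> insert n e"
      have n: "n \<notin> e" using on[of n] nn by auto
      have on': "G s n = 0" if "s \<in> e" for s
        using on[OF that] sym[OF nV, of s] eV that by auto
      show "G v w = (if v = w then 1 else 0)"
      proof (cases "v = n"; cases "w = n")
        assume "v \<noteq> n" "w \<noteq> n"
        then show ?thesis using e vw unfolding orthonormal_def by blast
      qed (use vw nn on on' n in auto)
    qed
    moreover have "span (insert n e) = span (insert b e)"
    proof -
      have wb: "b = w + (\<Sum>a\<in>e. G b a *\<^sub>R a)" by (simp add: w_def)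
      have mono: "span e \<subseteq> span (insert a e)" for a by (rule span_mono) auto
      have "w = sqrt (G w w) *\<^sub>R n" using gw by (simp add: n_def)
      then have "w \<in> span (insert n e)" by (metis insertI1 span_base span_scale)
      then have "b \<in> span (insert n e)" using wb p mono[of n] by (metis span_add subsetD)
      moreover have "w \<in> span (insert b e)" unfolding w_def using p mono[of b]
        by (meson insertI1 span_base span_diff subsetD)
      then have "n \<in> span (insert b e)" unfolding n_def by (rule span_scale)
      ultimately show ?thesis
        by (intro subset_antisym span_minimal subspace_span) (auto intro: span_base)
    qed
    ultimately show ?thesis by (rule that)
  qed
qed

lemma exists_orthonormal:
  assumes "subspace S" "S \<subseteq> V"
  obtains e where "orthonormal e" "span e = S"
proof -
  obtain B where B: "finite B" "span B = V" using finite_dim by blast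
  obtain C where C: "C \<subseteq> S" "independent C" "S \<subseteq> span C" by (meson maximal_independent_subset)
  have fin: "finite C" using independent_span_bound[OF B(1) C(2)] C(1) assms(2) B(2) by auto
  have ex: "\<exists>e. orthonormal e \<and> span e = span C'" if "finite C'" "C' \<subseteq> V" for C'
    using that
  proof (induction C' rule: finite_induct)
    case empty
    then show ?case by (intro exI[of _ "{}"]) (simp add: orthonormal_def)
  next
    case (insert b C')
    then obtain e where e: "orthonormal e" "span e = span C'" by auto
    obtain e' where "orthonormal e'" "span e' = span (insert b e)"
      by (rule orthonormal_insert[OF e(1)]) (use insert.prems in auto)
    moreover have "span (insert b e) = span (insert b C')"
      using e(2) by (metis span_insert)
    ultimately show ?case by auto
  qed
  from ex[OF fin] C(1) assms(2) obtain e where "orthonormal e" "span e = span C" by blast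
  moreover have "span C = S" using C span_minimal[OF C(1) assms(1)] by blast
  ultimately show ?thesis using that by blast
qed

lemma orthonormal_independent:
  assumes e: "orthonormal e"
  shows "independent e"
proof -
  have f: "finite e" using e by (simp add: orthonormal_def)
  show ?thesis
    unfolding independent_explicit_module
  proof (intro allI impI)
    fix A u v assume A: "finite A" "A \<subseteq> e" "(\<Sum>v\<in>A. u v *\<^sub>R v) = 0" "v \<in> A"
    have "orthonormal A" using e A finite_subset unfolding orthonormal_def by blast
    from orthonormal_coeff[OF this A(4), of u] show "u v = 0"
      using A e by (auto simp: orthonormal_def subset_iff)
  qed
qed

text \<open>The elements of \<open>e\<close> are expanded in \<open>e'\<close>; the coefficients satisfy
  \<open>(\<Sum>v\<in>e. G v w * G v w') = G w w'\<close> by the expansion of \<open>w\<close> in \<open>e\<close>.\<close>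

lemma trace_independent:
  assumes e: "orthonormal e" and e': "orthonormal e'" and sp: "span e' = span e"
    and l: "\<And>v. v \<in> span e \<Longrightarrow> linear_map_on (span e) (b v)"
    and r: "\<And>w. w \<in> span e \<Longrightarrow> linear_map_on (span e) (\<lambda>v. b v w)"
  shows "(\<Sum>v\<in>e. b v v) = (\<Sum>w\<in>e'. b w w :: real)"
proof -
  let ?U = "span e"
  have lin_sum: "L (\<Sum>i\<in>I. c i *\<^sub>R f i) = (\<Sum>i\<in>I. c i * L (f i))"
    if "linear_map_on ?U L" "\<And>i. i \<in> I \<Longrightarrow> f i \<in> ?U" "finite I" for L :: "'a tvec \<Rightarrow> real" and I c and f :: "'a tvec \<Rightarrow> 'a tvec"
    using that(3,2)
  proof (induction I)
    case empty
    have "L (0 *\<^sub>R 0) = 0 *\<^sub>R L 0" using that(1) unfolding linear_map_on_def by (meson span_zero)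
    then show ?case by simp
  next
    case (insert i I)
    have "(\<Sum>i\<in>I. c i *\<^sub>R f i) \<in> ?U" using insert.prems by (intro span_sum span_scale) auto
    moreover have "c i *\<^sub>R f i \<in> ?U" "f i \<in> ?U" using insert.prems by (auto intro: span_scale)
    ultimately show ?case using insert that(1) unfolding linear_map_on_def by auto
  qed
  have fin: "finite e" "finite e'" using e e' by (auto simp: orthonormal_def)
  have eV: "e \<subseteq> V" "e' \<subseteq> V" using e e' by (auto simp: orthonormal_def)
  have U: "v \<in> ?U" if "v \<in> e \<or> v \<in> e'" for v using that sp by (metis span_base)
  have "(\<Sum>v\<in>e. b v v) = (\<Sum>v\<in>e. \<Sum>w\<in>e'. \<Sum>w'\<in>e'. G v w * G v w' * b w w')"
  proof (intro sum.cong refl)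
    fix v assume v: "v \<in> e"
    have ex: "v = (\<Sum>w\<in>e'. G v w *\<^sub>R w)" using fourier[OF e', of v] U v sp by auto
    have "b v v = (\<Sum>w\<in>e'. G v w * b w v)"
      using lin_sum[OF r[of v], of e' "\<lambda>w. w" "\<lambda>w. G v w"] U v fin ex by auto
    also have "\<dots> = (\<Sum>w\<in>e'. G v w * (\<Sum>w'\<in>e'. G v w' * b w w'))"
    proof (intro sum.cong refl arg_cong2[where f = "(*)"])
      fix w assume "w \<in> e'"
      then show "b w v = (\<Sum>w'\<in>e'. G v w' * b w w')"
        using lin_sum[OF l[of w], of e' "\<lambda>w. w" "\<lambda>w. G v w"] U fin ex by auto
    qed
    finally show "b v v = (\<Sum>w\<in>e'. \<Sum>w'\<in>e'. G v w * G v w' * b w w')"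
      by (simp add: sum_distrib_left mult.assoc)
  qed
  also have "\<dots> = (\<Sum>w\<in>e'. \<Sum>w'\<in>e'. \<Sum>v\<in>e. G v w * G v w' * b w w')"
    by (subst sum.swap) (intro sum.cong refl sum.swap)
  also have "\<dots> = (\<Sum>w\<in>e'. \<Sum>w'\<in>e'. if w = w' then b w w' else 0)"
  proof (intro sum.cong refl)
    fix w w' assume w: "w \<in> e'" "w' \<in> e'"
    have "(\<Sum>v\<in>e. G v w * G v w') = G w w'"
    proof -
      have "G w w' = G (\<Sum>v\<in>e. G w v *\<^sub>R v) w'" using fourier[OF e, of w] U w by auto
      also have "\<dots> = (\<Sum>v\<in>e. G w v * G v w')"
        using eV w by (subst sum_left) (auto simp: scale_left subset_iff)
      also have "\<dots> = (\<Sum>v\<in>e. G v w * G v w')"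
        using eV w by (intro sum.cong refl) (auto simp: subset_iff sym[of w])
      finally show ?thesis ..
    qed
    then show "(\<Sum>v\<in>e. G v w * G v w' * b w w') = (if w = w' then b w w' else 0)"
      using e' w by (simp flip: sum_distrib_right add: orthonormal_def)
  qed
  also have "\<dots> = (\<Sum>w\<in>e'. b w w)" using fin by (simp add: sum.delta)
  finally show ?thesis .
qed

definition bilinear_on :: "'a tvec set \<Rightarrow> ('a tvec \<Rightarrow> 'a tvec \<Rightarrow> 'a tvec) \<Rightarrow> bool" where
  "bilinear_on T H \<longleftrightarrow> (\<forall>v\<in>T. linear_map_on T (H v)) \<and> (\<forall>w\<in>T. linear_map_on T (\<lambda>v. H v w)) \<and>
     (\<forall>v\<in>T. \<forall>w\<in>T. H v w \<in> V)"

text \<open>The sum is a trace in each of the two arguments of \<open>H\<close>.\<close>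

lemma sq_sum_independent:
  assumes e: "orthonormal e" and e': "orthonormal e'" and sp: "span e' = span e"
    and H: "bilinear_on (span e) H"
  shows "(\<Sum>v\<in>e. \<Sum>w\<in>e. G (H v w) (H v w)) = (\<Sum>v\<in>e'. \<Sum>w\<in>e'. G (H v w) (H v w))"
proof -
  let ?U = "span e"
  have U: "v \<in> ?U" if "v \<in> e \<or> v \<in> e'" for v using that sp by (metis span_base)
  have HV: "H v w \<in> V" if "v \<in> ?U" "w \<in> ?U" for v w using H that by (auto simp: bilinear_on_def)
  have H1: "H v (a + b) = H v a + H v b" "H v (r *\<^sub>R a) = r *\<^sub>R H v a"
      "H (a + b) v = H a v + H b v" "H (r *\<^sub>R a) v = r *\<^sub>R H a v"
    if "v \<in> ?U" "a \<in> ?U" "b \<in> ?U" for v a b r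
    using H that by (auto simp: bilinear_on_def linear_map_on_def)
  have "(\<Sum>v\<in>e. \<Sum>w\<in>e. G (H v w) (H v w)) = (\<Sum>v\<in>e. \<Sum>w\<in>e'. G (H v w) (H v w))"
  proof (rule sum.cong[OF refl])
    fix v assume "v \<in> e"
    then have v: "v \<in> ?U" by (rule span_base)
    show "(\<Sum>w\<in>e. G (H v w) (H v w)) = (\<Sum>w\<in>e'. G (H v w) (H v w))"
      by (rule trace_independent[OF e e' sp, of "\<lambda>w w'. G (H v w) (H v w')"])
        (use v HV H1 in \<open>auto simp: linear_map_on_def bilin\<close>)
  qed
  also have "\<dots> = (\<Sum>w\<in>e'. \<Sum>v\<in>e. G (H v w) (H v w))" by (rule sum.swap)
  also have "\<dots> = (\<Sum>w\<in>e'. \<Sum>v\<in>e'. G (H v w) (H v w))"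
  proof (rule sum.cong[OF refl])
    fix w assume "w \<in> e'"
    then have w: "w \<in> ?U" using U by auto
    show "(\<Sum>v\<in>e. G (H v w) (H v w)) = (\<Sum>v\<in>e'. G (H v w) (H v w))"
      by (rule trace_independent[OF e e' sp, of "\<lambda>v v'. G (H v w) (H v' w)"])
        (use w HV H1 in \<open>auto simp: linear_map_on_def bilin\<close>)
  qed
  also have "\<dots> = (\<Sum>v\<in>e'. \<Sum>w\<in>e'. G (H v w) (H v w))" by (rule sum.swap)
  finally show ?thesis .
qed

lemma tangential_part_eqI:
  assumes "subspace S" "S \<subseteq> V" "v \<in> V" "t \<in> S" "\<And>s. s \<in> S \<Longrightarrow> G (v - t) s = 0"
  shows "tangential_part g x S v = t"
  unfolding tangential_part_def
proof (rule the_equality)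
  fix t' assume t': "t' \<in> S \<and> (\<forall>s\<in>S. G (v - t') s = 0)"
  show "t' = t"
  proof (rule eqI[OF assms(2,1)])
    fix s assume s: "s \<in> S"
    have "s \<in> V" "t \<in> V" "t' \<in> V" using s t' assms by auto
    moreover have "G (v - t') s = 0" using t' s by blast
    ultimately show "G t' s = G t s" using assms(5)[OF s] assms(3) by (simp add: diff_left)
  qed (use t' assms in auto)
qed (use assms in auto)

lemma tangential_part:
  assumes "subspace S" "S \<subseteq> V" "v \<in> V"
  shows "tangential_part g x S v \<in> S" and "s \<in> S \<Longrightarrow> G (v - tangential_part g x S v) s = 0"
proof -
  obtain e where e: "orthonormal e" "span e = S" using exists_orthonormal[OF assms(1,2)] .
  have "tangential_part g x S v = (\<Sum>b\<in>e. G v b *\<^sub>R b)"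
    by (rule tangential_part_eqI[OF assms])
      (use fourier_orthogonal[OF e(1) assms(3)] fourier_in_span[of "\<lambda>b. G v b" e] e(2) in simp_all)
  then show "tangential_part g x S v \<in> S" "s \<in> S \<Longrightarrow> G (v - tangential_part g x S v) s = 0"
    using fourier_orthogonal[OF e(1) assms(3)] fourier_in_span[of "\<lambda>b. G v b" e] e(2) by simp_all
qed

lemma normal_part:
  assumes "subspace S" "S \<subseteq> V" "v \<in> V"
  shows "normal_part g x S v \<in> V" "s \<in> S \<Longrightarrow> G (normal_part g x S v) s = 0"
proof -
  have "tangential_part g x S v \<in> V" using tangential_part(1)[OF assms] assms(2) by blast
  then show "normal_part g x S v \<in> V" unfolding normal_part_def using assms(3) by (rule V_mem(3)[rotated])
  show "s \<in> S \<Longrightarrow> G (normal_part g x S v) s = 0"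
    unfolding normal_part_def by (rule tangential_part(2)[OF assms])
qed

lemma normal_part_eqI:
  assumes "subspace S" "S \<subseteq> V" "n \<in> V" "t \<in> S" "\<And>s. s \<in> S \<Longrightarrow> G n s = 0"
  shows "normal_part g x S (t + n) = n"
proof -
  have "tangential_part g x S (t + n) = t"
    by (rule tangential_part_eqI[OF assms(1,2) _ assms(4)]) (use assms in \<open>simp_all add: subset_iff\<close>)
  then show ?thesis by (simp add: normal_part_def)
qed

lemma normal_part_add:
  assumes "subspace S" "S \<subseteq> V" "v \<in> V" "w \<in> V"
  shows "normal_part g x S (v + w) = normal_part g x S v + normal_part g x S w"
proof -
  have S: "tangential_part g x S v + tangential_part g x S w \<in> S"
    using tangential_part(1)[OF assms(1,2)] assms by (simp add: subspace_add)
  have "normal_part g x S ((tangential_part g x S v + tangential_part g x S w)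
      + (normal_part g x S v + normal_part g x S w)) = normal_part g x S v + normal_part g x S w"
  proof (rule normal_part_eqI[OF assms(1,2) _ S])
    fix s assume s: "s \<in> S"
    then have "s \<in> V" using assms(2) by blast
    then show "G (normal_part g x S v + normal_part g x S w) s = 0"
      using normal_part[OF assms(1,2)] assms(3,4) s by (simp add: add_left)
  qed (use normal_part(1)[OF assms(1,2)] assms(3,4) in simp)
  then show ?thesis by (simp add: normal_part_def algebra_simps)
qed

lemma normal_part_scale:
  assumes "subspace S" "S \<subseteq> V" "v \<in> V"
  shows "normal_part g x S (r *\<^sub>R v) = r *\<^sub>R normal_part g x S v"
proof -
  have S: "r *\<^sub>R tangential_part g x S v \<in> S"
    using tangential_part(1)[OF assms] assms by (simp add: subspace_scale)
  have "normal_part g x S (r *\<^sub>R tangential_part g x S v + r *\<^sub>R normal_part g x S v) = r *\<^sub>R normal_part g x S v"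
  proof (rule normal_part_eqI[OF assms(1,2) _ S])
    fix s assume s: "s \<in> S"
    then have "s \<in> V" using assms(2) by blast
    then show "G (r *\<^sub>R normal_part g x S v) s = 0"
      using normal_part[OF assms] s by (simp add: scale_left)
  qed (use normal_part(1)[OF assms] in simp)
  then show ?thesis by (simp add: normal_part_def algebra_simps)
qed

lemma normal_part_tangent:
  assumes "subspace S" "S \<subseteq> V" "v \<in> S"
  shows "normal_part g x S v = 0"
  using normal_part_eqI[OF assms(1,2) _ assms(3), of 0] assms by (simp add: subset_iff)

lemma tangential_part_pythagoras:
  assumes "subspace S" "S \<subseteq> V" "v \<in> V"
  shows "G (v - tangential_part g x S v) (v - tangential_part g x S v)
     = G v v - G (tangential_part g x S v) (tangential_part g x S v)"
proof -
  let ?t = "tangential_part g x S v"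
  have t: "?t \<in> S" "?t \<in> V" using tangential_part(1)[OF assms] assms by auto
  have "G (v - ?t) ?t = 0" by (rule tangential_part(2)[OF assms t(1)])
  then show ?thesis using t assms sym[of ?t v] by (simp add: bilin)
qed

lemma bilinear_on_zero:
  assumes H: "bilinear_on T H" and e: "span e \<subseteq> T" "span f \<subseteq> T"
    and z: "\<And>v w. v \<in> e \<Longrightarrow> w \<in> f \<Longrightarrow> H v w = 0" and vw: "v \<in> span e" "w \<in> span f"
  shows "H v w = 0"
proof -
  have H1: "H v 0 = 0" "H 0 v = 0" "H v (a + b) = H v a + H v b" "H v (r *\<^sub>R a) = r *\<^sub>R H v a"
      "H (a + b) v = H a v + H b v" "H (r *\<^sub>R a) v = r *\<^sub>R H a v"
    if "v \<in> T" "a \<in> T" "b \<in> T" for v a b r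
  proof -
    have l: "linear_map_on T (H v)" "linear_map_on T (\<lambda>w. H w v)" using H that by (auto simp: bilinear_on_def)
    then have "H v (0 *\<^sub>R a) = 0 *\<^sub>R H v a" "H (0 *\<^sub>R a) v = 0 *\<^sub>R H a v"
      using that unfolding linear_map_on_def by blast+
    then show "H v 0 = 0" "H 0 v = 0" by simp_all
    show "H v (a + b) = H v a + H v b" "H v (r *\<^sub>R a) = r *\<^sub>R H v a"
      "H (a + b) v = H a v + H b v" "H (r *\<^sub>R a) v = r *\<^sub>R H a v"
      using l that unfolding linear_map_on_def by blast+
  qed
  have eT: "v \<in> T" if "v \<in> e" for v using e(1) that span_base[of v e] by blast
  have "subspace {w \<in> span f. \<forall>v\<in>e. H v w = 0}"
    unfolding subspace_def
    using H1 eT e(2) vw by (auto simp: span_zero span_add span_scale subset_iff)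
  then have "span f \<subseteq> {w \<in> span f. \<forall>v\<in>e. H v w = 0}"
    by (rule span_minimal[rotated]) (use z in \<open>auto simp: span_base\<close>)
  then have 1: "H v w = 0" if "v \<in> e" for v using vw(2) that by blast
  have "subspace {v \<in> span e. H v w = 0}"
    unfolding subspace_def using H1 e vw by (auto simp: span_zero span_add span_scale subset_iff)
  then have "span e \<subseteq> {v \<in> span e. H v w = 0}"
    by (rule span_minimal[rotated]) (use 1 in \<open>auto simp: span_base\<close>)
  then show ?thesis using vw(1) by blast
qed

definition block :: "('a tvec \<Rightarrow> 'a tvec \<Rightarrow> 'a tvec) \<Rightarrow> 'a tvec set \<Rightarrow> 'a tvec set \<Rightarrow> real" where
  "block H e f = (\<Sum>v\<in>e. \<Sum>w\<in>f. G (H v w) (H v w))"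

lemma block_nonneg:
  assumes "\<And>v w. v \<in> e \<Longrightarrow> w \<in> f \<Longrightarrow> H v w \<in> V"
  shows "block H e f \<ge> 0"
  unfolding block_def by (intro sum_nonneg nonneg assms)

lemma block_eq_0:
  assumes H: "bilinear_on T H" and e: "span e \<subseteq> T" "span f \<subseteq> T" "finite e" "finite f"
    and z: "block H e f = 0" and vw: "v \<in> span e" "w \<in> span f"
  shows "H v w = 0"
proof (rule bilinear_on_zero[OF H e(1,2) _ vw])
  fix v w assume v: "v \<in> e" "w \<in> f"
  have HV: "H v w \<in> V" if "v \<in> e" "w \<in> f" for v w
    using H e that span_base unfolding bilinear_on_def by blast
  have "(\<Sum>w\<in>f. G (H v w) (H v w)) = 0"
    using z v(1) unfolding block_def
    by (subst (asm) sum_nonneg_eq_0_iff) (auto intro!: e sum_nonneg nonneg HV)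
  then have "G (H v w) (H v w) = 0"
    using v by (subst (asm) sum_nonneg_eq_0_iff) (auto intro!: e nonneg HV)
  then show "H v w = 0" using eq_0_iff[OF HV[OF v]] by simp
qed

text \<open>The sum of squares may be computed in a basis adapted to an orthogonal decomposition, where the
  mixed blocks of a symmetric form occur twice.\<close>

lemma block_decomposition:
  assumes e1: "orthonormal e1" and e2: "orthonormal e2" and e3: "orthonormal e3"
    and o12: "\<And>v w. v \<in> e1 \<Longrightarrow> w \<in> e2 \<Longrightarrow> G v w = 0"
    and o13: "\<And>v w. v \<in> e1 \<Longrightarrow> w \<in> e3 \<Longrightarrow> G v w = 0"
    and o23: "\<And>v w. v \<in> e2 \<Longrightarrow> w \<in> e3 \<Longrightarrow> G v w = 0"
    and e: "orthonormal e" "span e = span (e1 \<union> e2 \<union> e3)"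
    and H: "bilinear_on (span e) H" and symH: "\<And>v w. v \<in> span e \<Longrightarrow> w \<in> span e \<Longrightarrow> H v w = H w v"
  shows "block H e e = block H e1 e1 + block H e2 e2 + block H e3 e3
    + 2 * block H e1 e2 + 2 * block H e1 e3 + 2 * block H e2 e3"
proof -
  have V: "e1 \<subseteq> V" "e2 \<subseteq> V" "e3 \<subseteq> V" and fin: "finite e1" "finite e2" "finite e3"
    using e1 e2 e3 by (simp_all add: orthonormal_def)
  have dis: "e1 \<inter> e2 = {}" "(e1 \<union> e2) \<inter> e3 = {}"
    using e1 e2 e3 o12 o13 o23 unfolding orthonormal_def by fastforce+
  have on: "orthonormal (e1 \<union> e2 \<union> e3)"
    unfolding orthonormal_def
  proof (intro conjI ballI)
    fix v w assume vw: "v \<in> e1 \<union> e2 \<union> e3" "w \<in> e1 \<union> e2 \<union> e3"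
    then have s: "G v w = G w v" using V by (intro sym) auto
    consider "v \<in> e1 \<and> w \<in> e1 \<or> v \<in> e2 \<and> w \<in> e2 \<or> v \<in> e3 \<and> w \<in> e3"
      | "v \<in> e1 \<and> w \<in> e2" | "v \<in> e2 \<and> w \<in> e1" | "v \<in> e1 \<and> w \<in> e3" | "v \<in> e3 \<and> w \<in> e1"
      | "v \<in> e2 \<and> w \<in> e3" | "v \<in> e3 \<and> w \<in> e2" using vw by blast
    then show "G v w = (if v = w then 1 else 0)"
    proof cases
      case 1
      then show ?thesis using e1 e2 e3 unfolding orthonormal_def by blast
    qed (use o12 o13 o23 s dis in auto)
  qed (use V fin in auto)
  have U: "v \<in> span e" if "v \<in> e1 \<union> e2 \<union> e3" for v
    unfolding e(2) using that by (rule span_base)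
  have "block H e e = block H (e1 \<union> e2 \<union> e3) (e1 \<union> e2 \<union> e3)"
    unfolding block_def by (rule sq_sum_independent[OF e(1) on e(2)[symmetric] H])
  also have "\<dots> = block H e1 e1 + block H e1 e2 + block H e1 e3 + (block H e2 e1 + block H e2 e2 + block H e2 e3)
     + (block H e3 e1 + block H e3 e2 + block H e3 e3)"
    using dis fin unfolding block_def by (simp add: sum.union_disjoint sum.distrib)
  also have "block H e2 e1 = block H e1 e2"
    unfolding block_def by (subst sum.swap) (intro sum.cong refl arg_cong2[where f = G] symH U; simp)
  also have "block H e3 e1 = block H e1 e3"
    unfolding block_def by (subst sum.swap) (intro sum.cong refl arg_cong2[where f = G] symH U; simp)
  also have "block H e3 e2 = block H e2 e3"
    unfolding block_def by (subst sum.swap) (intro sum.cong refl arg_cong2[where f = G] symH U; simp)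
  finally show ?thesis by simp
qed

end

section \<open>The estimate for one warped factor\<close>

text \<open>The situation at one point of the product, inside the ambient tangent space: \<open>T1\<close> is the invariant
  part, \<open>T2\<close> one of the other two parts, \<open>H\<close> the second fundamental form and \<open>\<gamma>\<close> the gradient of the
  logarithm of the warping function. An anti-invariant part is slant with \<open>C = 0\<close>, which allows both
  parts to be treated at once. The assumption \<open>H_phi\<close> carries the geometry. The length of \<open>\<gamma>\<close> is
  preserved by \<open>\<phi>\<close> because \<open>\<gamma>\<close> is orthogonal to the structure vector field.\<close>

locale warped_factor = inner_at g x V for g :: "'a metric" and x V +
  fixes \<phi> :: "'a tvec \<Rightarrow> 'a tvec" and T1 T2 :: "'a tvec set"
    and H :: "'a tvec \<Rightarrow> 'a tvec \<Rightarrow> 'a tvec" and \<gamma> :: "'a tvec" and C :: real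
  assumes T1: "subspace T1" "T1 \<subseteq> V" and T2: "subspace T2" "T2 \<subseteq> V"
    and phi_V: "v \<in> V \<Longrightarrow> \<phi> v \<in> V"
    and skew: "v \<in> V \<Longrightarrow> w \<in> V \<Longrightarrow> g x (\<phi> v) w = - g x v (\<phi> w)"
    and phi_T1: "u \<in> T1 \<Longrightarrow> \<phi> u \<in> T1"
    and gamma: "\<gamma> \<in> T1" "g x (\<phi> \<gamma>) (\<phi> \<gamma>) = g x \<gamma> \<gamma>"
    and iso: "a \<in> T2 \<Longrightarrow> g x (\<phi> a) (\<phi> a) = g x a a"
    and H_V: "u \<in> T1 \<Longrightarrow> a \<in> T2 \<Longrightarrow> H u a \<in> V"
    and H_normal: "u \<in> T1 \<Longrightarrow> a \<in> T2 \<Longrightarrow> b \<in> T2 \<Longrightarrow> g x (H u a) b = 0"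
    and H_phi: "u \<in> T1 \<Longrightarrow> a \<in> T2 \<Longrightarrow> b \<in> T2 \<Longrightarrow>
        g x (H u a) (\<phi> b) = - g x \<gamma> (\<phi> u) * g x a b + g x \<gamma> u * g x (\<phi> a) b"
    and slant: "a \<in> T2 \<Longrightarrow> g x (tangential_part g x T2 (\<phi> a)) (tangential_part g x T2 (\<phi> a)) = C * g x a a"
    and C: "C < 1"
begin

text \<open>The vector \<open>w\<close> below is chosen such that \<open>G (H u a) (\<phi> b) = G w b\<close> for all \<open>b\<close> in \<open>T2\<close>. Taking \<open>b = w\<close> and
  removing from \<open>\<phi> w\<close> its part in \<open>T2\<close>, to which \<open>H u a\<close> is orthogonal, makes the Cauchy-Schwarz
  inequality sharp enough.\<close>

lemma pointwise_bound:
  assumes u: "u \<in> T1" and a: "a \<in> T2" "G a a = 1"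
  shows "(G \<gamma> (\<phi> u))\<^sup>2 + C * (G \<gamma> u)\<^sup>2 \<le> (1 - C) * G (H u a) (H u a)"
proof -
  define P where "P = (\<lambda>b. tangential_part g x T2 (\<phi> b))"
  define w where "w = (- G \<gamma> (\<phi> u)) *\<^sub>R a + G \<gamma> u *\<^sub>R P a"
  have aV: "a \<in> V" using a T2 by auto
  have P: "P b \<in> T2" "P b \<in> V" "s \<in> T2 \<Longrightarrow> G (\<phi> b - P b) s = 0" if "b \<in> T2" for b s
  proof -
    have b: "\<phi> b \<in> V" using phi_V that T2 by blast
    show "P b \<in> T2" unfolding P_def by (rule tangential_part(1)[OF T2 b])
    then show "P b \<in> V" using T2 by blast
    show "s \<in> T2 \<Longrightarrow> G (\<phi> b - P b) s = 0" unfolding P_def by (rule tangential_part(2)[OF T2 b])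
  qed
  have w: "w \<in> T2"
    unfolding w_def using a(1) P(1)[OF a(1)]
    by (intro subspace_add[OF T2(1)] subspace_scale[OF T2(1)])
  then have wV: "w \<in> V" using T2 by blast
  note w = w wV
  have slantP: "G (P b) (P b) = C * G b b" if "b \<in> T2" for b using slant[OF that] by (simp add: P_def)
  have "G (\<phi> a) a = - G (\<phi> a) a" using skew[OF aV aV] sym[OF aV phi_V[OF aV]] by simp
  then have "G (P a) a = 0" using P(2)[OF a(1)] P(3)[OF a(1), of a] a aV phi_V[OF aV] by (simp add: bilin)
  then have ww: "G w w = (G \<gamma> (\<phi> u))\<^sup>2 + C * (G \<gamma> u)\<^sup>2"
    using P(2)[OF a(1)] aV a sym[of a "P a"]
    unfolding w_def by (simp add: bilin slantP power2_eq_square)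
  let ?n = "\<phi> w - P w"
  have n: "?n \<in> V" using phi_V[OF w(2)] P(2)[OF w(1)] by simp
  have H: "H u a \<in> V" by (rule H_V[OF u a(1)])
  have "G (\<phi> a) w = G (P a) w"
    using P(2)[OF a(1)] P(3)[OF a(1), of w] w phi_V[OF aV] by (simp add: bilin)
  then have "G (H u a) (\<phi> w) = G w w"
  proof -
    have "G w w = G (- G \<gamma> (\<phi> u) *\<^sub>R a + G \<gamma> u *\<^sub>R P a) w" unfolding w_def ..
    also have "\<dots> = - G \<gamma> (\<phi> u) * G a w + G \<gamma> u * G (\<phi> a) w"
      using P(2)[OF a(1)] aV w \<open>G (\<phi> a) w = G (P a) w\<close> by (simp only: bilin V_mem)
    finally show ?thesis using H_phi[OF u a(1) w(1)] by simp
  qed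
  then have Hn: "G (H u a) ?n = G w w"
    using H_normal[OF u a(1) P(1)[OF w(1)]] H phi_V[OF w(2)] P(2)[OF w(1)] by (simp add: bilin)
  have nn: "G ?n ?n = (1 - C) * G w w"
    using tangential_part_pythagoras[OF T2 phi_V[OF w(2)]] iso[OF w(1)] slant[OF w(1)]
    unfolding P_def by (simp add: algebra_simps)
  have "(G w w)\<^sup>2 \<le> G (H u a) (H u a) * ((1 - C) * G w w)"
    using cauchy_schwarz[OF H n] by (simp add: Hn nn)
  then have "G w w \<le> (1 - C) * G (H u a) (H u a)"
    using nonneg[OF w(2)] nonneg[OF H] C
    by (cases "G w w = 0") (auto simp: power2_eq_square mult.commute mult.left_commute)
  then show ?thesis by (simp add: ww)
qed

text \<open>Both \<open>\<gamma>\<close> and \<open>\<phi> \<gamma>\<close> lie in \<open>T1\<close> and have the same length, so each of the two sums of squares over \<open>e1\<close> is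
  \<open>G \<gamma> \<gamma>\<close> by Parseval's identity.\<close>

lemma block_bound:
  assumes e1: "orthonormal e1" "span e1 = T1" and e2: "orthonormal e2" "span e2 = T2"
  shows "real (card e2) * ((1 + C) / (1 - C)) * G \<gamma> \<gamma> \<le> (\<Sum>u\<in>e1. \<Sum>a\<in>e2. G (H u a) (H u a))"
proof -
  have in1: "u \<in> T1" if "u \<in> e1" for u using that e1 span_base by auto
  have in2: "a \<in> T2" if "a \<in> e2" for a using that e2 span_base by auto
  have pg: "\<phi> \<gamma> \<in> T1" by (rule phi_T1[OF gamma(1)])
  have "(\<Sum>u\<in>e1. (G \<gamma> (\<phi> u))\<^sup>2) = (\<Sum>u\<in>e1. (G (\<phi> \<gamma>) u)\<^sup>2)"
    using skew[of \<gamma>] gamma(1) T1(2) in1 by (intro sum.cong refl) (simp add: subset_iff)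
  also have "\<dots> = G \<gamma> \<gamma>" using parseval[OF e1(1), of "\<phi> \<gamma>"] pg e1(2) gamma(2) by simp
  finally have s1: "(\<Sum>u\<in>e1. (G \<gamma> (\<phi> u))\<^sup>2) = G \<gamma> \<gamma>" .
  have s2: "(\<Sum>u\<in>e1. (G \<gamma> u)\<^sup>2) = G \<gamma> \<gamma>" using parseval[OF e1(1), of \<gamma>] gamma(1) e1(2) by simp
  have "real (card e2) * ((1 + C) / (1 - C)) * G \<gamma> \<gamma> =
      (\<Sum>a\<in>e2. (\<Sum>u\<in>e1. (G \<gamma> (\<phi> u))\<^sup>2 + C * (G \<gamma> u)\<^sup>2) / (1 - C))"
    by (simp add: sum.distrib s1 s2 flip: sum_distrib_left) (simp add: field_simps)
  also have "\<dots> \<le> (\<Sum>a\<in>e2. \<Sum>u\<in>e1. G (H u a) (H u a))"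
    unfolding sum_divide_distrib
  proof (intro sum_mono)
    fix a u assume "a \<in> e2" "u \<in> e1"
    then have "(G \<gamma> (\<phi> u))\<^sup>2 + C * (G \<gamma> u)\<^sup>2 \<le> (1 - C) * G (H u a) (H u a)"
      using e2 by (intro pointwise_bound in1 in2) (auto simp: orthonormal_def)
    then show "((G \<gamma> (\<phi> u))\<^sup>2 + C * (G \<gamma> u)\<^sup>2) / (1 - C) \<le> G (H u a) (H u a)"
      using C by (simp add: pos_divide_le_eq mult.commute)
  qed
  also have "\<dots> = (\<Sum>u\<in>e1. \<Sum>a\<in>e2. G (H u a) (H u a))" by (rule sum.swap)
  finally show ?thesis .
qed

text \<open>With \<open>u = \<phi> \<gamma>\<close> and \<open>b = a\<close> the right-hand side of \<open>H_phi\<close> is \<open>G \<gamma> \<gamma> * G a a\<close>, because \<open>\<phi>\<close> is skew.\<close>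

lemma gamma_eq_0_if_mixed_zero:
  assumes z: "\<And>u a. u \<in> T1 \<Longrightarrow> a \<in> T2 \<Longrightarrow> H u a = 0" and a: "a \<in> T2" "a \<noteq> 0"
  shows "\<gamma> = 0"
proof -
  have V: "a \<in> V" "\<gamma> \<in> V" "\<phi> \<gamma> \<in> V" using a(1) gamma(1) T1 T2 phi_V by auto
  have "G (\<phi> a) a = - G (\<phi> a) a" using skew[OF V(1,1)] sym[OF V(1) phi_V[OF V(1)]] by simp
  moreover have "0 = - G \<gamma> (\<phi> (\<phi> \<gamma>)) * G a a + G \<gamma> (\<phi> \<gamma>) * G (\<phi> a) a"
    using H_phi[OF phi_T1[OF gamma(1)] a(1) a(1)] z[OF phi_T1[OF gamma(1)] a(1)] phi_V[OF V(1)] by simp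
  moreover have "G a a > 0" by (rule pos[OF V(1) a(2)])
  ultimately have "G \<gamma> (\<phi> (\<phi> \<gamma>)) = 0" by simp
  then have "G \<gamma> \<gamma> = 0" using skew[OF V(2,3)] gamma(2) by simp
  then show ?thesis using eq_0_iff[OF V(2)] by simp
qed

end

section \<open>Charts and smooth functions\<close>

abbreviation cinv :: "('a, 'e) chart \<Rightarrow> 'e \<Rightarrow> 'a" where
  "cinv k \<equiv> inv_into (fst k) (snd k)"

lemma chart_open:
  assumes "smooth_manifold A" "k \<in> A"
  shows "open (fst k)" "open (snd k ` fst k)"
  using assms unfolding smooth_manifold_def by (auto simp: split_beta)

lemma chart_homeomorphism:
  assumes "smooth_manifold A" "k \<in> A"
  shows "homeomorphism (fst k) (snd k ` fst k) (snd k) (cinv k)"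
  using assms unfolding smooth_manifold_def by (auto simp: split_beta)

lemma chart_cinv:
  assumes "smooth_manifold A" "k \<in> A"
  shows "x \<in> fst k \<Longrightarrow> cinv k (snd k x) = x"
    and "q \<in> snd k ` fst k \<Longrightarrow> cinv k q \<in> fst k"
    and "q \<in> snd k ` fst k \<Longrightarrow> snd k (cinv k q) = q"
  using chart_homeomorphism[OF assms] unfolding homeomorphism_def by (auto simp: f_inv_into_f inv_into_into)

lemma chart_transition:
  assumes "smooth_manifold A" "k \<in> A" "l \<in> A"
  shows "smooth_on (snd k ` (fst k \<inter> fst l)) (snd l \<circ> cinv k)"
  using assms unfolding smooth_manifold_def by (auto simp: split_beta)

lemma chart_exists:
  assumes "smooth_manifold A"
  obtains k where "k \<in> A" "x \<in> fst k"
proof -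
  have "x \<in> (\<Union>(U, c)\<in>A. U)" using assms unfolding smooth_manifold_def by simp
  then show ?thesis using that by (auto simp: split_beta)
qed

lemma chart_at:
  assumes "smooth_manifold A"
  shows "chart_at A x \<in> A" "x \<in> fst (chart_at A x)"
proof -
  have "\<exists>c. c \<in> A \<and> x \<in> fst c" using chart_exists[OF assms] by metis
  then show "chart_at A x \<in> A" "x \<in> fst (chart_at A x)" unfolding chart_at_def
    by (metis (mono_tags, lifting) someI_ex)+
qed

lemma chart_image_open:
  assumes "smooth_manifold A" "k \<in> A" "open W"
  shows "open (snd k ` (fst k \<inter> W))"
proof -
  have "openin (top_of_set (fst k)) (fst k \<inter> W)" using assms(3) by (rule openin_open_Int)
  then have "openin (top_of_set (snd k ` fst k)) (snd k ` (fst k \<inter> W))"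
    by (rule homeomorphism_imp_open_map[OF chart_homeomorphism[OF assms(1,2)]])
  then show ?thesis using chart_open(2)[OF assms(1,2)] by (simp add: openin_open_eq)
qed

lemma chart_image_iff:
  assumes "smooth_manifold A" "k \<in> A"
  shows "q \<in> snd k ` (fst k \<inter> W) \<longleftrightarrow> q \<in> snd k ` fst k \<and> cinv k q \<in> W"
  using chart_cinv[OF assms] by (auto simp: image_iff)

lemma chart_preimage_open:
  assumes "smooth_manifold A" "k \<in> A" "open T"
  shows "open (fst k \<inter> snd k -` T)"
  using chart_homeomorphism[OF assms(1,2)] chart_open(1)[OF assms(1,2)] assms(3)
  unfolding homeomorphism_def by (intro continuous_open_preimage) auto

lemma smooth_fun_on_iff: "smooth_fun_on A W f \<longleftrightarrow> (\<forall>k\<in>A. smooth_on (snd k ` (fst k \<inter> W)) (f \<circ> cinv k))"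
  unfolding smooth_fun_on_def by (auto simp: split_beta)

lemma smooth_fun_on_subset: "smooth_fun_on A W f \<Longrightarrow> T \<subseteq> W \<Longrightarrow> smooth_fun_on A T f"
  unfolding smooth_fun_on_iff by (meson Int_mono image_mono order_refl smooth_on_subset)

lemma smooth_fun_on_cong:
  assumes M: "smooth_manifold A" and W: "open W" "\<And>x. x \<in> W \<Longrightarrow> f x = g x" and f: "smooth_fun_on A W f"
  shows "smooth_fun_on A W g"
  unfolding smooth_fun_on_iff
proof
  fix k assume k: "k \<in> A"
  show "smooth_on (snd k ` (fst k \<inter> W)) (g \<circ> cinv k)"
  proof (rule smooth_on_cong[OF _ chart_image_open[OF M k W(1)]])
    show "smooth_on (snd k ` (fst k \<inter> W)) (f \<circ> cinv k)" using f k unfolding smooth_fun_on_iff by blast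
    fix q assume "q \<in> snd k ` (fst k \<inter> W)"
    then show "(f \<circ> cinv k) q = (g \<circ> cinv k) q" using W(2) chart_image_iff[OF M k] by auto
  qed
qed

lemma smooth_fun_on_local:
  assumes M: "smooth_manifold A" and W: "\<And>x. x \<in> W \<Longrightarrow> \<exists>T. open T \<and> x \<in> T \<and> smooth_fun_on A T f"
  shows "smooth_fun_on A W f"
  unfolding smooth_fun_on_iff
proof
  fix k assume k: "k \<in> A"
  show "smooth_on (snd k ` (fst k \<inter> W)) (f \<circ> cinv k)"
  proof (rule smooth_on_local)
    fix q assume "q \<in> snd k ` (fst k \<inter> W)"
    then have q: "q \<in> snd k ` fst k" "cinv k q \<in> W" using chart_image_iff[OF M k] by auto
    from W[OF q(2)] obtain T where T: "open T" "cinv k q \<in> T" "smooth_fun_on A T f" by blast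
    show "\<exists>T. open T \<and> q \<in> T \<and> smooth_on T (f \<circ> cinv k)"
      by (rule exI[of _ "snd k ` (fst k \<inter> T)"])
        (use chart_image_open[OF M k T(1)] T k q chart_image_iff[OF M k] in \<open>auto simp: smooth_fun_on_iff\<close>)
  qed
qed

text \<open>Any other chart differs from \<open>k\<close> by a smooth transition map.\<close>

lemma smooth_fun_on_chartI:
  assumes M: "smooth_manifold A" and k: "k \<in> A" and W: "open W" "W \<subseteq> fst k"
    and f: "smooth_on (snd k ` W) (f \<circ> cinv k)"
  shows "smooth_fun_on A W f"
  unfolding smooth_fun_on_iff
proof
  fix l assume l: "l \<in> A"
  let ?S = "snd l ` (fst l \<inter> W)"
  have S: "open ?S" by (rule chart_image_open[OF M l W(1)])
  have t: "smooth_on ?S (snd k \<circ> cinv l)"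
    by (rule smooth_on_subset[OF chart_transition[OF M l k]]) (use W(2) in auto)
  have i: "(snd k \<circ> cinv l) ` ?S \<subseteq> snd k ` W" using chart_image_iff[OF M l] by auto
  show "smooth_on ?S (f \<circ> cinv l)"
  proof (rule smooth_on_cong[OF smooth_on_comp[OF t f S i] S])
    fix q assume "q \<in> ?S"
    then have "cinv l q \<in> fst k" using chart_image_iff[OF M l] W(2) by auto
    then show "((f \<circ> cinv k) \<circ> (snd k \<circ> cinv l)) q = (f \<circ> cinv l) q"
      using chart_cinv(1)[OF M k] by simp
  qed
qed

lemma smooth_fun_on_coord:
  assumes M: "smooth_manifold A" and k: "k \<in> A"
  shows "smooth_fun_on A (fst k) (\<lambda>y. snd k y \<bullet> b)"
proof (rule smooth_fun_on_chartI[OF M k chart_open(1)[OF M k] order_refl])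
  have "smooth_on (snd k ` fst k) (\<lambda>q. q \<bullet> b)"
    by (rule smooth_on_bounded_linear[OF smooth_on_id chart_open(2)[OF M k] bounded_linear_inner_left])
  then show "smooth_on (snd k ` fst k) ((\<lambda>y. snd k y \<bullet> b) \<circ> cinv k)"
    by (rule smooth_on_cong[OF _ chart_open(2)[OF M k]]) (use chart_cinv[OF M k] in auto)
qed

lemma smooth_fun_on_real_comp:
  fixes h :: "real \<Rightarrow> real"
  assumes A: "smooth_manifold A" and W: "open W" and f: "smooth_fun_on A W f"
    and h: "smooth_on T h" and T: "\<And>x. x \<in> W \<Longrightarrow> f x \<in> T"
  shows "smooth_fun_on A W (h \<circ> f)"
  unfolding smooth_fun_on_iff
proof
  fix k assume k: "k \<in> A"
  have "smooth_on (snd k ` (fst k \<inter> W)) (h \<circ> (f \<circ> cinv k))"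
  proof (rule smooth_on_comp[OF _ h chart_image_open[OF A k W]])
    show "smooth_on (snd k ` (fst k \<inter> W)) (f \<circ> cinv k)" using f k unfolding smooth_fun_on_iff by blast
    show "(f \<circ> cinv k) ` snd k ` (fst k \<inter> W) \<subseteq> T" using T chart_cinv(1)[OF A k] by auto
  qed
  then show "smooth_on (snd k ` (fst k \<inter> W)) (h \<circ> f \<circ> cinv k)" by (simp add: comp_assoc)
qed

lemma smooth_near_cong:
  assumes M: "smooth_manifold A" and W: "open W" "x \<in> W" "\<And>y. y \<in> W \<Longrightarrow> f y = g y"
    and f: "smooth_near A x f"
  shows "smooth_near A x g"
proof -
  obtain T where T: "open T" "x \<in> T" "smooth_fun_on A T f" using f unfolding smooth_near_def by blast
  have "smooth_fun_on A (T \<inter> W) g"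
    by (rule smooth_fun_on_cong[OF M _ _ smooth_fun_on_subset[OF T(3), of "T \<inter> W"]]) (use T W in auto)
  then show ?thesis using T W unfolding smooth_near_def by (intro exI[of _ "T \<inter> W"]) auto
qed

lemma smooth_near_chartD:
  assumes M: "smooth_manifold A" and k: "k \<in> A" "x \<in> fst k" and f: "smooth_near A x f"
  obtains S where "open S" "snd k x \<in> S" "S \<subseteq> snd k ` fst k" "smooth_on S (f \<circ> cinv k)"
proof -
  obtain W where W: "open W" "x \<in> W" "smooth_fun_on A W f" using f unfolding smooth_near_def by blast
  show ?thesis
    by (rule that[OF chart_image_open[OF M k(1) W(1)]]) (use W k in \<open>auto simp: smooth_fun_on_iff\<close>)
qed

lemma smooth_near_differentiable:
  assumes M: "smooth_manifold A" and k: "k \<in> A" "x \<in> fst k" and f: "smooth_near A x f"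
  shows "(f \<circ> cinv k) differentiable (at (snd k x))"
  using smooth_on_differentiable by (rule smooth_near_chartD[OF assms])

lemma smooth_near_coord:
  "smooth_manifold A \<Longrightarrow> k \<in> A \<Longrightarrow> x \<in> fst k \<Longrightarrow> smooth_near A x (\<lambda>y. snd k y \<bullet> b)"
  unfolding smooth_near_def
  by (rule exI[of _ "fst k"]) (simp add: smooth_fun_on_coord chart_open(1))

section \<open>Tangent vectors\<close>

lemma act_tvec [simp]:
  "act 0 f = 0" "act (v + w) f = act v f + act w f" "act (r *\<^sub>R v) f = r * act v f"
  "act (v - w) f = act v f - act w f" "act (- v) f = - act v f"
  by (simp_all add: zero_tvec_def plus_tvec_def scaleR_tvec_def minus_tvec_def uminus_tvec_def Tvec_inverse)

lemma act_sum [simp]: "act (\<Sum>i\<in>I. v i) f = (\<Sum>i\<in>I. act (v i) f)"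
  by (induction I rule: infinite_finite_induct) auto

lemma tvec_eqI: "(\<And>f. act v f = act w f) \<Longrightarrow> v = w"
  using act_inject by blast

lemma act_chart_vec: "act (chart_vec A k x u) f =
    (if smooth_near A x f then frechet_derivative (f \<circ> cinv k) (at (snd k x)) u else 0)"
  by (simp add: chart_vec_def Tvec_inverse)

lemma linear_chart_vec:
  assumes M: "smooth_manifold A" and k: "k \<in> A" "x \<in> fst k"
  shows "linear (chart_vec A k x)"
proof
  have l: "linear (frechet_derivative (f \<circ> cinv k) (at (snd k x)))" if "smooth_near A x f" for f
    using smooth_near_differentiable[OF M k that] by (rule linear_frechet_derivative)
  show "chart_vec A k x (u + v) = chart_vec A k x u + chart_vec A k x v" for u v
    by (rule tvec_eqI) (use linear_add[OF l] in \<open>simp add: act_chart_vec\<close>)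
  show "chart_vec A k x (r *\<^sub>R v) = r *\<^sub>R chart_vec A k x v" for r v
    by (rule tvec_eqI) (use linear_cmul[OF l] in \<open>simp add: act_chart_vec\<close>)
qed

lemma act_chart_vec_coord:
  assumes M: "smooth_manifold A" and k: "k \<in> A" "x \<in> fst k"
  shows "act (chart_vec A k x u) (\<lambda>y. snd k y \<bullet> b) = u \<bullet> b"
proof -
  have "((\<lambda>q. q \<bullet> b) has_derivative (\<lambda>q. q \<bullet> b)) (at (snd k x))"
    by (auto intro!: derivative_eq_intros)
  then have "(((\<lambda>y. snd k y \<bullet> b) \<circ> cinv k) has_derivative (\<lambda>q. q \<bullet> b)) (at (snd k x))"
    by (rule has_derivative_transform_within_open[OF _ chart_open(2)[OF M k(1)]])
      (use k chart_cinv[OF M k(1)] in auto)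
  from frechet_derivative_at[OF this] show ?thesis
    using smooth_near_coord[OF M k] by (simp add: act_chart_vec) (metis)
qed

lemma inj_chart_vec:
  assumes M: "smooth_manifold A" and k: "k \<in> A" "x \<in> fst k"
  shows "inj (chart_vec A k x)"
proof (rule injI)
  fix u v assume eq: "chart_vec A k x u = chart_vec A k x v"
  show "u = v"
  proof (rule euclidean_eqI)
    show "u \<bullet> b = v \<bullet> b" for b
      using act_chart_vec_coord[OF M k, of u b] act_chart_vec_coord[OF M k, of v b] eq by simp
  qed
qed

lemma chart_vec_in_tangent_space: "k \<in> A \<Longrightarrow> x \<in> fst k \<Longrightarrow> chart_vec A k x u \<in> tangent_space A x"
  unfolding tangent_space_def by (intro CollectI exI[of _ k] exI[of _ u] conjI refl)

lemma tangent_spaceE: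
  assumes "v \<in> tangent_space A x"
  obtains k u where "k \<in> A" "x \<in> fst k" "v = chart_vec A k x u"
  using assms by (auto simp: tangent_space_def)

text \<open>On a ball inside the range of a chart the coordinate expression of \<open>f\<close> has vanishing derivative.\<close>

lemma locally_constant_if_act_zero:
  assumes A: "smooth_manifold A" and f: "smooth_fun_on A UNIV f"
    and z: "\<And>k x u. k \<in> A \<Longrightarrow> x \<in> fst k \<Longrightarrow> act (chart_vec A k x u) f = 0"
  shows "locally_constant f"
  unfolding locally_constant_def
proof
  fix x
  obtain k where k: "k \<in> A" "x \<in> fst k" using chart_exists[OF A] .
  have near: "smooth_near A y f" for y using f unfolding smooth_near_def by (intro exI[of _ UNIV]) simp
  have "snd k x \<in> snd k ` fst k" using k by simp
  with chart_open(2)[OF A k(1)] obtain r where r: "r > 0" "ball (snd k x) r \<subseteq> snd k ` fst k"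
    by (rule openE)
  have "((f \<circ> cinv k) has_derivative (\<lambda>_. 0)) (at q within ball (snd k x) r)" if q: "q \<in> ball (snd k x) r" for q
  proof -
    have qk: "q \<in> snd k ` fst k" using q r(2) by blast
    have y: "cinv k q \<in> fst k" "snd k (cinv k q) = q" by (rule chart_cinv(2,3)[OF A k(1) qk])+
    have "(f \<circ> cinv k has_derivative frechet_derivative (f \<circ> cinv k) (at q)) (at q)"
      using smooth_near_differentiable[OF A k(1) y(1) near] unfolding y(2) frechet_derivative_works .
    moreover have "frechet_derivative (f \<circ> cinv k) (at q) = (\<lambda>_. 0)"
      using z[OF k(1) y(1)] near by (simp add: act_chart_vec y(2) fun_eq_iff)
    ultimately show ?thesis by (simp add: has_derivative_at_withinI)
  qed
  from has_derivative_zero_constant[OF convex_ball this]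
  obtain d where d: "\<And>q. q \<in> ball (snd k x) r \<Longrightarrow> (f \<circ> cinv k) q = d" by blast
  have "f y = d" if "y \<in> fst k \<inter> snd k -` ball (snd k x) r" for y
    using d[of "snd k y"] that chart_cinv(1)[OF A k(1)] by simp
  then have "f constant_on (fst k \<inter> snd k -` ball (snd k x) r)" unfolding constant_on_def by blast
  moreover have "open (fst k \<inter> snd k -` ball (snd k x) r)" by (rule chart_preimage_open[OF A k(1) open_ball])
  ultimately show "\<exists>U. open U \<and> x \<in> U \<and> f constant_on U" using k(2) r(1) by fastforce
qed

section \<open>Smooth maps and differentials\<close>

lemma smooth_map_rep:
  assumes A: "smooth_manifold A" and B: "smooth_manifold B" and F: "smooth_map A B F"
    and k: "k \<in> A" and l: "l \<in> B"
  shows "smooth_on (snd k ` (fst k \<inter> F -` fst l)) (snd l \<circ> F \<circ> cinv k)"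
    and "open (snd k ` (fst k \<inter> F -` fst l))"
proof -
  show "smooth_on (snd k ` (fst k \<inter> F -` fst l)) (snd l \<circ> F \<circ> cinv k)"
    using F k l unfolding smooth_map_def by (auto simp: split_beta)
  have "open (F -` fst l)"
    using F chart_open(1)[OF B l] unfolding smooth_map_def by (auto intro: open_vimage)
  then show "open (snd k ` (fst k \<inter> F -` fst l))" by (rule chart_image_open[OF A k])
qed

text \<open>Smoothness is local, so the pullback can be computed through one chart of the target.\<close>

lemma smooth_fun_on_pullback:
  assumes A: "smooth_manifold A" and B: "smooth_manifold B" and F: "smooth_map A B F"
    and f: "smooth_fun_on B W f" "open W"
  shows "smooth_fun_on A (F -` W) (f \<circ> F)"
proof (rule smooth_fun_on_local[OF A])
  fix x assume x: "x \<in> F -` W"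
  obtain k where k: "k \<in> A" "x \<in> fst k" using chart_exists[OF A] .
  obtain l where l: "l \<in> B" "F x \<in> fst l" using chart_exists[OF B] .
  have cF: "continuous_on UNIV F" using F unfolding smooth_map_def by blast
  let ?T = "fst k \<inter> F -` (fst l \<inter> W)"
  have T: "open ?T"
    using chart_open(1)[OF A k(1)] chart_open(1)[OF B l(1)] f(2) cF by (intro open_Int open_vimage) auto
  have S: "open (snd k ` ?T)" using chart_image_open[OF A k(1) T] by (simp add: Int_absorb1)
  have s: "smooth_on (snd k ` ?T) (snd l \<circ> F \<circ> cinv k)"
    by (rule smooth_on_subset[OF smooth_map_rep(1)[OF A B F k(1) l(1)]]) auto
  have fl: "smooth_on (snd l ` (fst l \<inter> W)) (f \<circ> cinv l)"
    using f(1) l(1) unfolding smooth_fun_on_iff by blast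
  have i: "cinv k q \<in> F -` (fst l \<inter> W)" if "q \<in> snd k ` ?T" for q
    using that chart_cinv(1)[OF A k(1)] by auto
  have "smooth_on (snd k ` ?T) ((f \<circ> cinv l) \<circ> (snd l \<circ> F \<circ> cinv k))"
    by (rule smooth_on_comp[OF s fl S]) (use i in auto)
  then have "smooth_on (snd k ` ?T) ((f \<circ> F) \<circ> cinv k)"
    by (rule smooth_on_cong[OF _ S]) (use i chart_cinv(1)[OF B l(1)] in auto)
  then have "smooth_fun_on A ?T (f \<circ> F)" by (rule smooth_fun_on_chartI[OF A k(1) T, rotated]) auto
  then show "\<exists>T. open T \<and> x \<in> T \<and> smooth_fun_on A T (f \<circ> F)" using T x k l by blast
qed

lemma smooth_near_pullback:
  assumes A: "smooth_manifold A" and B: "smooth_manifold B" and F: "smooth_map A B F"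
    and f: "smooth_near B (F x) f"
  shows "smooth_near A x (f \<circ> F)"
proof -
  obtain W where W: "open W" "F x \<in> W" "smooth_fun_on B W f" using f unfolding smooth_near_def by blast
  have "open (F -` W)" using F W(1) unfolding smooth_map_def by (auto intro: open_vimage)
  then show ?thesis
    unfolding smooth_near_def using smooth_fun_on_pullback[OF A B F W(3,1)] W(2) by (intro exI[of _ "F -` W"]) auto
qed

lemma differential_chart_vec:
  assumes A: "smooth_manifold A" and B: "smooth_manifold B" and F: "smooth_map A B F"
    and k: "k \<in> A" "x \<in> fst k" and l: "l \<in> B" "F x \<in> fst l"
  shows "differential B F x (chart_vec A k x u) =
    chart_vec B l (F x) (frechet_derivative (snd l \<circ> F \<circ> cinv k) (at (snd k x)) u)"
proof (rule tvec_eqI)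
  fix f
  let ?\<Phi> = "snd l \<circ> F \<circ> cinv k"
  show "act (differential B F x (chart_vec A k x u)) f =
    act (chart_vec B l (F x) (frechet_derivative ?\<Phi> (at (snd k x)) u)) f"
  proof (cases "smooth_near B (F x) f")
    case True
    have ph: "?\<Phi> differentiable at (snd k x)"
      by (rule smooth_on_differentiable[OF smooth_map_rep(1)[OF A B F k(1) l(1)]]) (use k l in auto)
    have px: "?\<Phi> (snd k x) = snd l (F x)" using chart_cinv(1)[OF A k] by simp
    have fl: "(f \<circ> cinv l) differentiable at (?\<Phi> (snd k x))"
      unfolding px by (rule smooth_near_differentiable[OF B l True])
    have c: "((f \<circ> cinv l) \<circ> ?\<Phi> has_derivative
       frechet_derivative (f \<circ> cinv l) (at (snd l (F x))) \<circ> frechet_derivative ?\<Phi> (at (snd k x))) (at (snd k x))"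
      using diff_chain_at[OF ph[unfolded frechet_derivative_works] fl[unfolded frechet_derivative_works]]
      unfolding px .
    have "((f \<circ> F) \<circ> cinv k has_derivative
       frechet_derivative (f \<circ> cinv l) (at (snd l (F x))) \<circ> frechet_derivative ?\<Phi> (at (snd k x))) (at (snd k x))"
    proof (rule has_derivative_transform_within_open[OF c smooth_map_rep(2)[OF A B F k(1) l(1)]])
      show "snd k x \<in> snd k ` (fst k \<inter> F -` fst l)" using k l by auto
      fix q assume "q \<in> snd k ` (fst k \<inter> F -` fst l)"
      then have "F (cinv k q) \<in> fst l" using chart_image_iff[OF A k(1)] by auto
      then show "((f \<circ> cinv l) \<circ> ?\<Phi>) q = ((f \<circ> F) \<circ> cinv k) q" using chart_cinv(1)[OF B l(1)] by simp
    qed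
    from frechet_derivative_at[OF this] show ?thesis
      using True smooth_near_pullback[OF A B F True]
      by (simp add: differential_def Tvec_inverse act_chart_vec fun_eq_iff)
  qed (simp add: differential_def Tvec_inverse act_chart_vec)
qed

text \<open>Inclusions of leaves and projections to factors have affine coordinate expressions.\<close>

lemma differential_affine:
  assumes A: "smooth_manifold A" and B: "smooth_manifold B" and F: "smooth_map A B F"
    and k: "k \<in> A" "x \<in> fst k" and l: "l \<in> B" "F x \<in> fst l" and L: "bounded_linear L"
    and rep: "\<And>q. q \<in> snd k ` fst k \<Longrightarrow> snd l (F (cinv k q)) = c + L q"
  shows "differential B F x (chart_vec A k x u) = chart_vec B l (F x) (L u)"
proof -
  have "((\<lambda>q. c + L q) has_derivative L) (at (snd k x))"
    by (auto intro!: derivative_eq_intros bounded_linear_imp_has_derivative L)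
  then have "(snd l \<circ> F \<circ> cinv k has_derivative L) (at (snd k x))"
    by (rule has_derivative_transform_within_open[OF _ chart_open(2)[OF A k(1)]]) (use k rep in auto)
  from frechet_derivative_at[OF this] show ?thesis
    using differential_chart_vec[OF A B F k l, of u] by simp
qed

lemma smooth_map_id:
  assumes "smooth_manifold A"
  shows "smooth_map A A id"
  using assms unfolding smooth_map_def smooth_manifold_def by (auto simp: vimage_def)

lemma differential_id:
  assumes "v \<in> tangent_space A x"
  shows "differential A id x v = v"
  using assms by (intro tvec_eqI) (auto simp: differential_def Tvec_inverse tangent_space_def act_chart_vec)

text \<open>A change of charts is the differential of the identity, so one chart already gives all tangent
  vectors.\<close>

lemma tangent_space_chart:
  assumes A: "smooth_manifold A" and k: "k \<in> A" "x \<in> fst k"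
  shows "tangent_space A x = range (chart_vec A k x)"
proof
  show "tangent_space A x \<subseteq> range (chart_vec A k x)"
  proof
    fix v assume v: "v \<in> tangent_space A x"
    then obtain l u where l: "l \<in> A" "x \<in> fst l" "v = chart_vec A l x u" by (rule tangent_spaceE)
    show "v \<in> range (chart_vec A k x)"
      using differential_chart_vec[OF A A smooth_map_id[OF A] l(1,2), of k u] k differential_id[OF v] l(3)
      by (metis id_apply rangeI)
  qed
qed (use k in \<open>auto intro: chart_vec_in_tangent_space\<close>)

lemma subspace_tangent_space:
  assumes A: "smooth_manifold A"
  shows "subspace (tangent_space A x)"
proof -
  obtain k where k: "k \<in> A" "x \<in> fst k" using chart_exists[OF A] .
  show ?thesis unfolding tangent_space_chart[OF A k]
    by (rule linear_subspace_image[OF linear_chart_vec[OF A k] subspace_UNIV])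
qed

lemma tangent_space_span:
  fixes A :: "('a::{t2_space,second_countable_topology}, 'e::euclidean_space) atlas"
  assumes A: "smooth_manifold A" and k: "k \<in> A" "x \<in> fst k"
  shows "tangent_space A x = span (chart_vec A k x ` Basis)"
  by (simp add: tangent_space_chart[OF A k] linear_span_image[OF linear_chart_vec[OF A k]])

lemma chart_vec_component:
  assumes A: "smooth_manifold A" and k: "k \<in> A" "x \<in> fst k" and v: "v \<in> tangent_space A x"
  shows "v = chart_vec A k x (\<Sum>b\<in>Basis. act v (\<lambda>y. snd k y \<bullet> b) *\<^sub>R b)"
proof -
  obtain u where "v = chart_vec A k x u" using v tangent_space_chart[OF A k] by auto
  then show ?thesis using act_chart_vec_coord[OF A k, of u] by (simp add: euclidean_representation)
qed

lemma differential_in_tangent_space: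
  assumes A: "smooth_manifold A" and B: "smooth_manifold B" and F: "smooth_map A B F"
    and v: "v \<in> tangent_space A x"
  shows "differential B F x v \<in> tangent_space B (F x)"
proof -
  obtain k u where k: "k \<in> A" "x \<in> fst k" "v = chart_vec A k x u" by (rule tangent_spaceE[OF v])
  obtain l where l: "l \<in> B" "F x \<in> fst l" using chart_exists[OF B] .
  show ?thesis using differential_chart_vec[OF A B F k(1,2) l, of u] k(3) chart_vec_in_tangent_space[OF l] by simp
qed

lemma differential_linear:
  "differential B F x (v + w) = differential B F x v + differential B F x w"
  "differential B F x (r *\<^sub>R v) = r *\<^sub>R differential B F x v"
  by (rule tvec_eqI; simp add: differential_def Tvec_inverse)+

lemma differential_comp:
  assumes B: "smooth_manifold B" and C: "smooth_manifold C" and G: "smooth_map B C G"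
  shows "differential C (G \<circ> F) x v = differential C G (F x) (differential B F x v)"
proof (rule tvec_eqI)
  fix f
  show "act (differential C (G \<circ> F) x v) f = act (differential C G (F x) (differential B F x v)) f"
    using smooth_near_pullback[OF B C G, of "F x" f]
    by (auto simp: differential_def Tvec_inverse comp_assoc)
qed

text \<open>A map into a manifold is smooth if it is continuous and pulls back the coordinate functions to
  smooth functions; the latter property is preserved by pulling back twice.\<close>

lemma smooth_map_comp:
  assumes A: "smooth_manifold A" and B: "smooth_manifold B" and C: "smooth_manifold C"
    and F: "smooth_map A B F" and G: "smooth_map B C G"
  shows "smooth_map A C (G \<circ> F)"
  unfolding smooth_map_def
proof (intro conjI, goal_cases)
  case 1
  then show ?case using F G unfolding smooth_map_def by (auto intro: continuous_on_compose2)
next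
  case 2
  have "smooth_on (snd k ` (fst k \<inter> (G \<circ> F) -` fst l)) (snd l \<circ> (G \<circ> F) \<circ> cinv k)"
    if k: "k \<in> A" and l: "l \<in> C" for k l
  proof -
    let ?W = "(G \<circ> F) -` fst l"
    have o1: "open (G -` fst l)" using G chart_open(1)[OF C l] unfolding smooth_map_def by (auto intro: open_vimage)
    have o2: "open ?W" using F o1 unfolding smooth_map_def by (auto intro: open_vimage simp: vimage_comp[symmetric])
    have S: "open (snd k ` (fst k \<inter> ?W))" by (rule chart_image_open[OF A k o2])
    show ?thesis
    proof (rule smooth_on_componentwise[OF S])
      fix b :: 'f
      have "smooth_fun_on A (F -` (G -` fst l)) (((\<lambda>y. snd l y \<bullet> b) \<circ> G) \<circ> F)"
        by (rule smooth_fun_on_pullback[OF A B F smooth_fun_on_pullback[OF B C G smooth_fun_on_coord[OF C l] chart_open(1)[OF C l]] o1])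
      then show "smooth_on (snd k ` (fst k \<inter> ?W)) (\<lambda>x. (snd l \<circ> (G \<circ> F) \<circ> cinv k) x \<bullet> b)"
        using k unfolding smooth_fun_on_iff by (auto simp: o_def vimage_def)
    qed
  qed
  then show ?case by (auto simp: split_beta)
qed

section \<open>Coordinate vector fields\<close>

lemma smooth_vfield_chart_vec:
  assumes A: "smooth_manifold A" and k: "k \<in> A"
  shows "smooth_vfield_on A (fst k) (\<lambda>y. chart_vec A k y u)"
  unfolding smooth_vfield_on_def
proof (intro conjI ballI allI impI)
  show "chart_vec A k x u \<in> tangent_space A x" if "x \<in> fst k" for x
    by (rule chart_vec_in_tangent_space[OF k that])
  fix V f assume "open V \<and> V \<subseteq> fst k \<and> smooth_fun_on A V f"
  then have V: "open V" "V \<subseteq> fst k" "smooth_fun_on A V f" by auto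
  have S: "open (snd k ` V)" using chart_image_open[OF A k V(1)] V(2) by (simp add: Int_absorb1)
  have fk: "smooth_on (snd k ` V) (f \<circ> cinv k)"
    using V(2,3) k unfolding smooth_fun_on_iff by (metis Int_absorb1)
  have "smooth_on (snd k ` V) ((\<lambda>x. act (chart_vec A k x u) f) \<circ> cinv k)"
  proof (rule smooth_on_cong[OF smooth_on_frechet_derivative[OF fk, of u] S])
    fix q assume "q \<in> snd k ` V"
    then obtain y where y: "y \<in> V" "q = snd k y" by blast
    then have "cinv k q = y" using chart_cinv(1)[OF A k] V(2) by auto
    moreover have "smooth_near A y f" using V y unfolding smooth_near_def by blast
    ultimately show "frechet_derivative (f \<circ> cinv k) (at q) u = ((\<lambda>x. act (chart_vec A k x u) f) \<circ> cinv k) q"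
      using y by (simp add: act_chart_vec)
  qed
  then show "smooth_fun_on A V (\<lambda>x. act (chart_vec A k x u) f)"
    by (rule smooth_fun_on_chartI[OF A k V(1,2)])
qed

lemma smooth_vfield_near_chart_vec:
  assumes A: "smooth_manifold A" and k: "k \<in> A" "x \<in> fst k"
  shows "smooth_vfield_near A x (\<lambda>y. chart_vec A k y u)"
  unfolding smooth_vfield_near_def
  by (rule exI[of _ "fst k"]) (simp add: smooth_vfield_chart_vec[OF A k(1)] chart_open(1)[OF A k(1)] k(2))

lemma smooth_near_act:
  assumes "smooth_vfield_near A x X" "smooth_near A x f"
  shows "smooth_near A x (\<lambda>y. act (X y) f)"
proof -
  obtain W where W: "open W" "x \<in> W" "smooth_vfield_on A W X"
    using assms(1) unfolding smooth_vfield_near_def by blast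
  obtain T where T: "open T" "x \<in> T" "smooth_fun_on A T f"
    using assms(2) unfolding smooth_near_def by blast
  have "smooth_fun_on A (W \<inter> T) (\<lambda>y. act (X y) f)"
    using W T smooth_fun_on_subset[OF T(3), of "W \<inter> T"] unfolding smooth_vfield_on_def by (meson Int_lower1 Int_lower2 open_Int)
  then show ?thesis unfolding smooth_near_def using W T by (intro exI[of _ "W \<inter> T"]) auto
qed

lemma act_chart_vec_twice:
  assumes A: "smooth_manifold A" and k: "k \<in> A" "x \<in> fst k" and f: "smooth_near A x f"
  shows "act (chart_vec A k x u) (\<lambda>y. act (chart_vec A k y v) f) =
    frechet_derivative (\<lambda>q. frechet_derivative (f \<circ> cinv k) (at q) v) (at (snd k x)) u"
proof -
  obtain W where W: "open W" "x \<in> W" "smooth_fun_on A W f" using f unfolding smooth_near_def by blast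
  have s: "smooth_near A x (\<lambda>y. act (chart_vec A k y v) f)"
    by (rule smooth_near_act[OF smooth_vfield_near_chart_vec[OF A k] f])
  have "frechet_derivative ((\<lambda>y. act (chart_vec A k y v) f) \<circ> cinv k) (at (snd k x)) =
    frechet_derivative (\<lambda>q. frechet_derivative (f \<circ> cinv k) (at q) v) (at (snd k x))"
  proof (rule frechet_derivative_transform_within_open[OF smooth_near_differentiable[OF A k s]])
    show "open (snd k ` (fst k \<inter> W))" by (rule chart_image_open[OF A k(1) W(1)])
    show "snd k x \<in> snd k ` (fst k \<inter> W)" using k W by auto
    fix q assume "q \<in> snd k ` (fst k \<inter> W)"
    then obtain y where y: "y \<in> fst k" "y \<in> W" "q = snd k y" by blast
    then have "cinv k q = y" using chart_cinv(1)[OF A k(1)] by auto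
    moreover have "smooth_near A y f" using W y unfolding smooth_near_def by blast
    ultimately show "((\<lambda>y. act (chart_vec A k y v) f) \<circ> cinv k) q = frechet_derivative (f \<circ> cinv k) (at q) v"
      using y by (simp add: act_chart_vec)
  qed
  then show ?thesis using s by (simp add: act_chart_vec)
qed

text \<open>Second derivatives commute.\<close>

lemma lie_bracket_chart_vec:
  assumes A: "smooth_manifold A" and k: "k \<in> A" "x \<in> fst k"
  shows "lie_bracket A (\<lambda>y. chart_vec A k y u) (\<lambda>y. chart_vec A k y v) x = 0"
proof (rule tvec_eqI)
  fix f
  have "frechet_derivative (\<lambda>q. frechet_derivative (f \<circ> cinv k) (at q) v) (at (snd k x)) u =
    frechet_derivative (\<lambda>q. frechet_derivative (f \<circ> cinv k) (at q) u) (at (snd k x)) v"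
    if f: "smooth_near A x f"
  proof -
    obtain S where "open S" "snd k x \<in> S" "smooth_on S (f \<circ> cinv k)" using smooth_near_chartD[OF A k f] .
    then show ?thesis using second_derivative_symmetric by blast
  qed
  then show "act (lie_bracket A (\<lambda>y. chart_vec A k y u) (\<lambda>y. chart_vec A k y v) x) f = act 0 f"
    by (simp add: lie_bracket_def Tvec_inverse act_chart_vec_twice[OF A k])
qed

section \<open>The second fundamental form in coordinates\<close>

lemma linear_map_on_sum:
  assumes "subspace S" "linear_map_on S L" "\<And>i. i \<in> I \<Longrightarrow> f i \<in> S"
  shows "L (\<Sum>i\<in>I. c i *\<^sub>R f i) = (\<Sum>i\<in>I. c i *\<^sub>R L (f i))"
proof -
  have 0: "L 0 = 0"
  proof -
    have "L (0 *\<^sub>R 0) = 0 *\<^sub>R L 0"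
      using assms(2) subspace_0[OF assms(1)] unfolding linear_map_on_def by blast
    then show ?thesis by simp
  qed
  show ?thesis
    using assms(3)
  proof (induction I rule: infinite_finite_induct)
    case (insert i I)
    have f: "f i \<in> S" "c i *\<^sub>R f i \<in> S" "(\<Sum>i\<in>I. c i *\<^sub>R f i) \<in> S"
      using insert.prems by (auto intro!: subspace_scale[OF assms(1)] subspace_sum[OF assms(1)])
    have "L (c i *\<^sub>R f i + (\<Sum>i\<in>I. c i *\<^sub>R f i)) = L (c i *\<^sub>R f i) + L (\<Sum>i\<in>I. c i *\<^sub>R f i)"
      using assms(2) f unfolding linear_map_on_def by blast
    also have "L (c i *\<^sub>R f i) = c i *\<^sub>R L (f i)"
      using assms(2) f unfolding linear_map_on_def by blast
    finally show ?case using insert by simp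
  qed (simp_all add: 0)
qed

lemma inner_at_tangent_space:
  assumes R: "riemannian_manifold B g"
  shows "inner_at g y (tangent_space B y)"
proof
  have M: "smooth_manifold B" using R by (simp add: riemannian_manifold_def)
  obtain l where l: "l \<in> B" "y \<in> fst l" using chart_exists[OF M] .
  show "subspace (tangent_space B y)" by (rule subspace_tangent_space[OF M])
  show "\<exists>Ba. finite Ba \<and> span Ba = tangent_space B y"
    by (rule exI[of _ "chart_vec B l y ` Basis"]) (simp add: tangent_space_span[OF M l])
  show "v \<in> tangent_space B y \<Longrightarrow> linear_map_on (tangent_space B y) (g y v)"
    "v \<in> tangent_space B y \<Longrightarrow> w \<in> tangent_space B y \<Longrightarrow> g y v w = g y w v"
    "v \<in> tangent_space B y \<Longrightarrow> v \<noteq> 0 \<Longrightarrow> 0 < g y v v" for v w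
    using R by (simp_all add: riemannian_manifold_def)
qed

text \<open>The covariant derivative of the endomorphism field \<open>\<psi>\<close> vanishes. This is used for \<open>\<psi> = id\<close>, where
  it yields the compatibility with the metric, for \<open>\<psi> = \<phi>\<close> and for \<open>\<psi> = \<phi>\<^sup>2\<close>.\<close>

definition parallel_endo ::
  "('q::topological_space, 'm::euclidean_space) atlas \<Rightarrow> 'q connection \<Rightarrow> ('q \<Rightarrow> 'q tvec \<Rightarrow> 'q tvec) \<Rightarrow> bool" where
  "parallel_endo B D \<psi> \<longleftrightarrow>
     (\<forall>y. linear_map_on (tangent_space B y) (\<psi> y) \<and> \<psi> y ` tangent_space B y \<subseteq> tangent_space B y) \<and>
     (\<forall>W X. open W \<and> smooth_vfield_on B W X \<longrightarrow> smooth_vfield_on B W (\<lambda>y. \<psi> y (X y))) \<and>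
     (\<forall>y Y. \<forall>v\<in>tangent_space B y. smooth_vfield_near B y Y \<longrightarrow> D y v (\<lambda>z. \<psi> z (Y z)) = \<psi> y (D y v Y))"

lemma parallel_endo_id: "parallel_endo B D (\<lambda>y v. v)"
  by (simp add: parallel_endo_def linear_map_on_def)

lemma parallel_endo_vfield_near:
  assumes "parallel_endo B D \<psi>" "smooth_vfield_near B y Y"
  shows "smooth_vfield_near B y (\<lambda>z. \<psi> z (Y z))"
  using assms unfolding parallel_endo_def smooth_vfield_near_def by meson

lemma parallel_endo_comp:
  assumes p: "parallel_endo B D \<psi>"
  shows "parallel_endo B D (\<lambda>y v. \<psi> y (\<psi> y v))"
proof -
  have l: "linear_map_on (tangent_space B y) (\<psi> y)" "\<psi> y ` tangent_space B y \<subseteq> tangent_space B y" for y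
    using p unfolding parallel_endo_def by blast+
  have in_T: "\<psi> y v \<in> tangent_space B y" if "v \<in> tangent_space B y" for y v using l(2) that by blast
  have "linear_map_on (tangent_space B y) (\<lambda>v. \<psi> y (\<psi> y v))" for y
    using l(1)[of y] in_T[of _ y] unfolding linear_map_on_def by simp
  moreover have "D y v (\<lambda>z. \<psi> z (\<psi> z (Y z))) = \<psi> y (\<psi> y (D y v Y))"
    if "v \<in> tangent_space B y" "smooth_vfield_near B y Y" for y v Y
    using p that parallel_endo_vfield_near[OF p that(2)] unfolding parallel_endo_def by metis
  moreover have "smooth_vfield_on B W (\<lambda>y. \<psi> y (\<psi> y (X y)))" if "open W" "smooth_vfield_on B W X" for W X
  proof -
    have *: "\<And>W X. open W \<Longrightarrow> smooth_vfield_on B W X \<Longrightarrow> smooth_vfield_on B W (\<lambda>y. \<psi> y (X y))"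
      using p unfolding parallel_endo_def by blast
    show ?thesis by (rule *[OF that(1) *[OF that]])
  qed
  ultimately show ?thesis
    unfolding parallel_endo_def using in_T by (simp add: image_subset_iff)
qed

text \<open>A smooth map into a Riemannian manifold near \<open>x\<close>, in a chart \<open>k\<close> of the source and the chart \<open>l\<close> of
  the target that the covariant derivative along \<open>F\<close> refers to. \<open>E\<close> is the coordinate frame of \<open>l\<close>, and
  \<open>vec y v\<close> is the image under the differential of the coordinate field \<open>v\<close> of \<open>k\<close>.\<close>

locale map_chart =
  fixes A :: "('a::{t2_space,second_countable_topology}, 'e::euclidean_space) atlas"
    and B :: "('q::{t2_space,second_countable_topology}, 'm::euclidean_space) atlas"
    and g :: "'q metric" and D :: "'q connection" and F :: "'a \<Rightarrow> 'q"
    and k :: "('a, 'e) chart" and x :: 'a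
  assumes A: "smooth_manifold A" and R: "riemannian_manifold B g" and LC: "levi_civita B g D"
    and F: "smooth_map A B F" and k: "k \<in> A" "x \<in> fst k"
begin

definition l where "l = chart_at B (F x)"
definition \<Phi> where "\<Phi> = snd l \<circ> F \<circ> cinv k"
definition S where "S = snd k ` (fst k \<inter> F -` fst l)"
definition dPhi where "dPhi q v = frechet_derivative \<Phi> (at q) v"
definition ddPhi where "ddPhi u v = frechet_derivative (\<lambda>q. dPhi q v) (at (snd k x)) u"
definition E where "E b y = chart_vec B l y b"
definition vec where "vec y v = differential B F y (chart_vec A k y v)"
abbreviation T where "T \<equiv> tangent_space B (F x)"

text \<open>The ambient covariant derivative at \<open>x\<close> of the coordinate field \<open>v\<close> in the direction of
  the coordinate field \<open>u\<close>.\<close>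

definition nabla where
  "nabla u v = (\<Sum>b\<in>Basis. (ddPhi u v \<bullet> b) *\<^sub>R E b (F x) + (dPhi (snd k x) v \<bullet> b) *\<^sub>R D (F x) (vec x u) (E b))"

lemma B: "smooth_manifold B" using R by (simp add: riemannian_manifold_def)

sublocale inner_at g "F x" "tangent_space B (F x)" by (rule inner_at_tangent_space[OF R])

lemma l: "l \<in> B" "F x \<in> fst l" unfolding l_def by (rule chart_at[OF B])+

lemma S: "open S" "snd k x \<in> S"
  unfolding S_def using smooth_map_rep(2)[OF A B F k(1) l(1)] k l by auto

lemma S_iff: "q \<in> S \<longleftrightarrow> q \<in> snd k ` fst k \<and> F (cinv k q) \<in> fst l"
  unfolding S_def using chart_image_iff[OF A k(1)] by simp

lemma S_D:
  assumes "q \<in> S"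
  shows "cinv k q \<in> fst k" "F (cinv k q) \<in> fst l" "snd k (cinv k q) = q"
  using assms chart_cinv[OF A k(1)] by (simp_all add: S_iff)

lemma Phi_smooth: "smooth_on S \<Phi>"
  unfolding S_def \<Phi>_def by (rule smooth_map_rep(1)[OF A B F k(1) l(1)])

lemma dPhi_smooth: "smooth_on S (\<lambda>q. dPhi q v)"
  unfolding dPhi_def by (rule smooth_on_frechet_derivative[OF Phi_smooth])

lemma Phi_has_derivative: "q \<in> S \<Longrightarrow> (\<Phi> has_derivative dPhi q) (at q)"
  unfolding dPhi_def[abs_def] by (rule smooth_on_has_derivative[OF Phi_smooth])

lemma dPhi_has_derivative: "((\<lambda>q. dPhi q v) has_derivative (\<lambda>u. ddPhi u v)) (at (snd k x))"
  unfolding ddPhi_def by (rule smooth_on_has_derivative[OF dPhi_smooth S(2)])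

lemma linear_dPhi: "q \<in> S \<Longrightarrow> linear (dPhi q)"
  by (rule has_derivative_linear[OF Phi_has_derivative])

lemma ddPhi_sym: "ddPhi u v = ddPhi v u"
  unfolding ddPhi_def dPhi_def by (rule second_derivative_symmetric[OF Phi_smooth S])

lemma linear_ddPhi: "linear (\<lambda>u. ddPhi u v)"
  by (rule has_derivative_linear[OF dPhi_has_derivative])

lemma linear_ddPhi2: "linear (ddPhi u)"
  using linear_ddPhi[of u] by (simp add: ddPhi_sym[of _ u])

lemma linear_E: "y \<in> fst l \<Longrightarrow> linear (\<lambda>b. E b y)"
  unfolding E_def by (rule linear_chart_vec[OF B l(1)])

lemma E_expand: "y \<in> fst l \<Longrightarrow> E a y = (\<Sum>b\<in>Basis. (a \<bullet> b) *\<^sub>R E b y)"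
proof -
  assume y: "y \<in> fst l"
  have "E a y = E (\<Sum>b\<in>Basis. (a \<bullet> b) *\<^sub>R b) y" by (simp add: euclidean_representation)
  also have "\<dots> = (\<Sum>b\<in>Basis. (a \<bullet> b) *\<^sub>R E b y)"
    by (simp add: linear_sum[OF linear_E[OF y]] linear_cmul[OF linear_E[OF y]])
  finally show ?thesis .
qed

lemma E_in: "y \<in> fst l \<Longrightarrow> E b y \<in> tangent_space B y"
  unfolding E_def by (rule chart_vec_in_tangent_space[OF l(1)])

lemma E_vfield: "smooth_vfield_near B (F x) (E b)"
  unfolding E_def[abs_def] by (rule smooth_vfield_near_chart_vec[OF B l])

lemma vec_E: "y \<in> fst k \<Longrightarrow> F y \<in> fst l \<Longrightarrow> vec y v = E (dPhi (snd k y) v) (F y)"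
  unfolding vec_def E_def dPhi_def \<Phi>_def by (rule differential_chart_vec[OF A B F k(1) _ l(1)])

lemma vec_x: "vec x v = E (dPhi (snd k x) v) (F x)"
  by (rule vec_E[OF k(2) l(2)])

lemma linear_vec: "linear (vec x)"
  unfolding vec_x using linear_compose[OF linear_dPhi[OF S(2)] linear_E[OF l(2)]] by (simp add: o_def)

lemma vec_in [simp]: "vec y v \<in> tangent_space B (F y)" if "y \<in> fst k"
  unfolding vec_def
  by (rule differential_in_tangent_space[OF A B F chart_vec_in_tangent_space[OF k(1) that]])

lemma vec_expand: "vec x v = (\<Sum>b\<in>Basis. (dPhi (snd k x) v \<bullet> b) *\<^sub>R E b (F x))"
  unfolding vec_x by (rule E_expand[OF l(2)])

lemma affine: "affine_connection B D"
  using LC by (simp add: levi_civita_def)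

lemma D_in: "smooth_vfield_near B (F x) Y \<Longrightarrow> v \<in> T \<Longrightarrow> D (F x) v Y \<in> T"
  using affine by (simp add: affine_connection_def)

lemma D_linear: "smooth_vfield_near B (F x) Y \<Longrightarrow> linear_map_on T (\<lambda>v. D (F x) v Y)"
  using affine by (simp add: affine_connection_def)

lemma D_E_in: "v \<in> T \<Longrightarrow> D (F x) v (E b) \<in> T"
  by (rule D_in[OF E_vfield])

lemma nabla_in [simp]: "nabla u v \<in> T"
  unfolding nabla_def using D_E_in vec_in[OF k(2)] E_in[OF l(2)] by (intro V_sum V_mem) auto

lemma D_vec: "D (F x) (vec x u) (E b) = (\<Sum>c\<in>Basis. (dPhi (snd k x) u \<bullet> c) *\<^sub>R D (F x) (E c (F x)) (E b))"
  unfolding vec_expand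
  by (rule linear_map_on_sum[OF subspace_V D_linear[OF E_vfield]]) (rule E_in[OF l(2)])

lemma D_E_sym: "D (F x) (E c (F x)) (E b) = D (F x) (E b (F x)) (E c)"
proof -
  have "D (F x) (E c (F x)) (E b) - D (F x) (E b (F x)) (E c) = lie_bracket B (E c) (E b) (F x)"
    using LC E_vfield unfolding levi_civita_def by blast
  also have "\<dots> = 0" unfolding E_def[abs_def] by (rule lie_bracket_chart_vec[OF B l])
  finally show ?thesis by simp
qed

text \<open>The second derivatives of the coordinate expression commute, and so do, as the connection is torsion
  free, the derivatives of the ambient coordinate fields.\<close>

lemma nabla_sym: "nabla u v = nabla v u"
proof -
  have "(\<Sum>b\<in>Basis. (dPhi (snd k x) v \<bullet> b) *\<^sub>R D (F x) (vec x u) (E b)) =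
    (\<Sum>b\<in>Basis. \<Sum>c\<in>Basis. ((dPhi (snd k x) v \<bullet> b) * (dPhi (snd k x) u \<bullet> c)) *\<^sub>R D (F x) (E c (F x)) (E b))" for u v
    by (simp add: D_vec scaleR_sum_right)
  moreover have "(\<Sum>b\<in>Basis. \<Sum>c\<in>Basis. ((dPhi (snd k x) v \<bullet> b) * (dPhi (snd k x) u \<bullet> c)) *\<^sub>R D (F x) (E c (F x)) (E b))
     = (\<Sum>b\<in>Basis. \<Sum>c\<in>Basis. ((dPhi (snd k x) u \<bullet> b) * (dPhi (snd k x) v \<bullet> c)) *\<^sub>R D (F x) (E c (F x)) (E b))"
    by (subst sum.swap) (simp add: mult.commute D_E_sym)
  ultimately show ?thesis unfolding nabla_def sum.distrib by (simp add: ddPhi_sym[of u v])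
qed

lemma linear_nabla: "linear (nabla u)"
proof
  have d: "linear (dPhi (snd k x))" by (rule linear_dPhi[OF S(2)])
  show "nabla u (v + w) = nabla u v + nabla u w" for v w
    unfolding nabla_def
    by (simp add: linear_add[OF d] linear_add[OF linear_ddPhi2] inner_add_left scaleR_add_left flip: sum.distrib)
      (simp add: algebra_simps)
  show "nabla u (r *\<^sub>R v) = r *\<^sub>R nabla u v" for r v
    unfolding nabla_def
    by (simp add: linear_cmul[OF d] linear_cmul[OF linear_ddPhi2] scaleR_add_right scaleR_sum_right)
qed

text \<open>The coefficients of \<open>X\<close> with respect to the coordinate fields contribute only their own derivatives,
  which multiply tangent vectors.\<close>

lemma cov_deriv_along_vfield:
  assumes X: "smooth_vfield_near A x X" and Xx: "X x = chart_vec A k x v"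
  shows "\<exists>w. cov_deriv_along B D F x (chart_vec A k x u) (\<lambda>y. differential B F y (X y)) = nabla u v + vec x w"
proof -
  obtain W where W: "open W" "x \<in> W" "smooth_vfield_on A W X"
    using X unfolding smooth_vfield_near_def by blast
  let ?q = "snd k x"
  define c where "c = (\<lambda>b y. act (X y) (\<lambda>z. snd k z \<bullet> b))"
  define ch where "ch = (\<lambda>b. frechet_derivative (c b \<circ> cinv k) (at ?q))"
  define w where "w = (\<Sum>b\<in>Basis. ch b u *\<^sub>R b)"
  have c_near: "smooth_near A x (c b)" for b
    unfolding c_def by (rule smooth_near_act[OF X smooth_near_coord[OF A k]])
  have c_der: "(c b \<circ> cinv k has_derivative ch b) (at ?q)" for b
    using smooth_near_differentiable[OF A k c_near] unfolding ch_def frechet_derivative_works .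
  have cx: "c b x = v \<bullet> b" for b unfolding c_def Xx by (rule act_chart_vec_coord[OF A k])
  have X_vec: "differential B F y (X y) = vec y (\<Sum>b\<in>Basis. c b y *\<^sub>R b)" if "y \<in> W" "y \<in> fst k" for y
  proof -
    have "X y \<in> tangent_space A y" using W(3) that unfolding smooth_vfield_on_def by blast
    from chart_vec_component[OF A k(1) that(2) this] show ?thesis unfolding vec_def c_def by simp
  qed
  define comp where "comp = (\<lambda>b y. act (differential B F y (X y)) (\<lambda>z. snd l z \<bullet> b))"
  have comp_eq: "comp b y = (\<Sum>a\<in>Basis. c a y *\<^sub>R dPhi (snd k y) a) \<bullet> b"
    if y: "y \<in> W" "y \<in> fst k" "F y \<in> fst l" for y b
  proof -
    have "snd k y \<in> S" unfolding S_def using y by blast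
    from linear_dPhi[OF this] have "dPhi (snd k y) (\<Sum>a\<in>Basis. c a y *\<^sub>R a) = (\<Sum>a\<in>Basis. c a y *\<^sub>R dPhi (snd k y) a)"
      by (simp add: linear_sum linear_cmul)
    then show ?thesis
      unfolding comp_def X_vec[OF y(1,2)] vec_E[OF y(2,3)] E_def
      by (simp add: act_chart_vec_coord[OF B l(1) y(3)])
  qed
  \<comment> \<open>The operator \<open>act\<close> yields the derivative only for functions that are smooth near the point.\<close>
  have comp_near: "smooth_near A x (comp b)" for b
  proof (rule smooth_near_cong[OF A])
    show "smooth_near A x (\<lambda>y. act (X y) ((\<lambda>z. snd l z \<bullet> b) \<circ> F))"
      by (rule smooth_near_act[OF X smooth_near_pullback[OF A B F smooth_near_coord[OF B l]]])
    show "open (F -` fst l)"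
      using F chart_open(1)[OF B l(1)] unfolding smooth_map_def by (auto intro: open_vimage)
    show "x \<in> F -` fst l" using l by simp
    show "act (X y) ((\<lambda>z. snd l z \<bullet> b) \<circ> F) = comp b y" if "y \<in> F -` fst l" for y
      using smooth_near_coord[OF B l(1), of "F y" b] that
      by (simp add: comp_def differential_def Tvec_inverse)
  qed
  have act_comp: "act (chart_vec A k x u) (comp b) = (dPhi ?q w + ddPhi u v) \<bullet> b" for b
  proof -
    have "((\<lambda>q. (\<Sum>a\<in>Basis. (c a \<circ> cinv k) q *\<^sub>R dPhi q a) \<bullet> b) has_derivative
       (\<lambda>u. (\<Sum>a\<in>Basis. (c a \<circ> cinv k) ?q *\<^sub>R ddPhi u a + ch a u *\<^sub>R dPhi ?q a) \<bullet> b)) (at ?q)"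
      by (intro bounded_linear.has_derivative[OF bounded_linear_inner_left] has_derivative_sum
          has_derivative_scaleR c_der dPhi_has_derivative)
    moreover have "open (snd k ` (fst k \<inter> (W \<inter> F -` fst l)))"
      using F chart_open(1)[OF B l(1)] W(1) unfolding smooth_map_def
      by (intro chart_image_open[OF A k(1)] open_Int) (auto intro: open_vimage)
    moreover have "?q \<in> snd k ` (fst k \<inter> (W \<inter> F -` fst l))" using k l W by auto
    ultimately have "((comp b \<circ> cinv k) has_derivative
       (\<lambda>u. (\<Sum>a\<in>Basis. (c a \<circ> cinv k) ?q *\<^sub>R ddPhi u a + ch a u *\<^sub>R dPhi ?q a) \<bullet> b)) (at ?q)"
    proof (rule has_derivative_transform_within_open)
      fix q assume "q \<in> snd k ` (fst k \<inter> (W \<inter> F -` fst l))"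
      then obtain y where y: "y \<in> fst k" "y \<in> W" "F y \<in> fst l" "q = snd k y" by blast
      then show "(\<Sum>a\<in>Basis. (c a \<circ> cinv k) q *\<^sub>R dPhi q a) \<bullet> b = (comp b \<circ> cinv k) q"
        using comp_eq[OF y(2,1,3)] chart_cinv(1)[OF A k(1) y(1)] by simp
    qed
    from frechet_derivative_at[OF this] have "act (chart_vec A k x u) (comp b) =
       (\<Sum>a\<in>Basis. (c a \<circ> cinv k) ?q *\<^sub>R ddPhi u a + ch a u *\<^sub>R dPhi ?q a) \<bullet> b"
      using comp_near by (simp add: act_chart_vec fun_eq_iff)
    also have "(\<Sum>a\<in>Basis. (c a \<circ> cinv k) ?q *\<^sub>R ddPhi u a + ch a u *\<^sub>R dPhi ?q a)
      = ddPhi u (\<Sum>a\<in>Basis. (v \<bullet> a) *\<^sub>R a) + dPhi ?q w"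
      unfolding w_def sum.distrib using chart_cinv(1)[OF A k]
      by (simp add: linear_sum[OF linear_ddPhi2] linear_cmul[OF linear_ddPhi2] cx
          linear_sum[OF linear_dPhi[OF S(2)]] linear_cmul[OF linear_dPhi[OF S(2)]])
    finally show ?thesis by (simp add: euclidean_representation add.commute)
  qed
  have compx: "comp b x = dPhi ?q v \<bullet> b" for b
    unfolding comp_def Xx vec_def[symmetric] vec_x E_def by (rule act_chart_vec_coord[OF B l])
  have "cov_deriv_along B D F x (chart_vec A k x u) (\<lambda>y. differential B F y (X y)) =
      (\<Sum>b\<in>Basis. act (chart_vec A k x u) (comp b) *\<^sub>R E b (F x) + comp b x *\<^sub>R D (F x) (vec x u) (E b))"
    unfolding cov_deriv_along_def Let_def comp_def l_def[symmetric] E_def vec_def ..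
  also have "\<dots> = nabla u v + (\<Sum>b\<in>Basis. (dPhi ?q w \<bullet> b) *\<^sub>R E b (F x))"
    unfolding act_comp compx nabla_def
    by (simp add: inner_add_left scaleR_add_left add_ac flip: sum.distrib)
  also have "(\<Sum>b\<in>Basis. (dPhi ?q w \<bullet> b) *\<^sub>R E b (F x)) = vec x w" by (rule vec_expand[symmetric])
  finally show ?thesis ..
qed

lemma tangent_image_vec: "tangent_image A B F x = range (vec x)"
  unfolding tangent_image_def tangent_space_chart[OF A k] vec_def by auto

lemma subspace_tangent_image: "subspace (tangent_image A B F x)" "tangent_image A B F x \<subseteq> T"
  unfolding tangent_image_vec using linear_subspace_image[OF linear_vec subspace_UNIV] vec_in[OF k(2)] by auto

text \<open>The choice of an extension in the definition changes the derivative by a tangent vector only, which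
  the normal part ignores.\<close>

lemma second_fundamental_form_nabla:
  "second_fundamental_form A B g D F x (chart_vec A k x u) (chart_vec A k x v) =
    normal_part g (F x) (tangent_image A B F x) (nabla u v)"
proof -
  define X where "X = (SOME X. smooth_vfield_near A x X \<and> X x = chart_vec A k x v)"
  have "\<exists>X. smooth_vfield_near A x X \<and> X x = chart_vec A k x v"
    using smooth_vfield_near_chart_vec[OF A k, of v] by (intro exI[of _ "\<lambda>y. chart_vec A k y v"]) simp
  then have "smooth_vfield_near A x X" "X x = chart_vec A k x v"
    unfolding X_def by (metis (mono_tags, lifting) someI_ex)+
  from cov_deriv_along_vfield[OF this, of u] obtain w where
    w: "cov_deriv_along B D F x (chart_vec A k x u) (\<lambda>y. differential B F y (X y)) = nabla u v + vec x w" ..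
  have "vec x w \<in> tangent_image A B F x" by (simp add: tangent_image_vec)
  then have "normal_part g (F x) (tangent_image A B F x) (nabla u v + vec x w) =
    normal_part g (F x) (tangent_image A B F x) (nabla u v)"
    using normal_part_add[OF subspace_tangent_image nabla_in vec_in[OF k(2)]]
      normal_part_tangent[OF subspace_tangent_image] by simp
  then show ?thesis
    unfolding second_fundamental_form_def Let_def X_def[symmetric] w .
qed

text \<open>Both fields are expanded in the ambient coordinate frame. The coefficients \<open>\<beta> b c\<close> are differentiated
  by the compatibility of the connection with the metric and with \<open>\<psi>\<close>; the terms obtained are those of
  \<open>nabla\<close>.\<close>

lemma product_rule:
  assumes p: "parallel_endo B D \<psi>"
  shows "((\<lambda>q. g (F (cinv k q)) (\<psi> (F (cinv k q)) (vec (cinv k q) v)) (vec (cinv k q) w)) has_derivative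
    (\<lambda>u. g (F x) (\<psi> (F x) (nabla u v)) (vec x w) + g (F x) (\<psi> (F x) (vec x v)) (nabla u w))) (at (snd k x))"
proof -
  let ?q = "snd k x"
  have lp: "linear_map_on (tangent_space B y) (\<psi> y)" and pT: "a \<in> tangent_space B y \<Longrightarrow> \<psi> y a \<in> tangent_space B y" for y a
    using p unfolding parallel_endo_def by blast+
  have expand: "g y (\<psi> y (\<Sum>b\<in>Basis. r b *\<^sub>R X b)) (\<Sum>c\<in>Basis. s c *\<^sub>R Y c) =
      (\<Sum>b\<in>Basis. \<Sum>c\<in>Basis. r b * s c * g y (\<psi> y (X b)) (Y c))"
    if XY: "\<And>b. X b \<in> tangent_space B y" "\<And>b. Y b \<in> tangent_space B y"
    for y and r s :: "'m \<Rightarrow> real" and X Y :: "'m \<Rightarrow> 'q tvec"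
  proof -
    interpret y: inner_at g y "tangent_space B y" by (rule inner_at_tangent_space[OF R])
    have "\<psi> y (\<Sum>b\<in>Basis. r b *\<^sub>R X b) = (\<Sum>b\<in>Basis. r b *\<^sub>R \<psi> y (X b))"
      by (rule linear_map_on_sum[OF y.subspace_V lp XY(1)])
    then show ?thesis
      using XY pT by (simp add: y.sum_left y.sum_right y.scale_left y.scale_right sum_distrib_left mult.assoc)
        (subst sum.swap, simp add: mult.left_commute)
  qed
  define \<beta> where "\<beta> = (\<lambda>b c y. g y (\<psi> y (E b y)) (E c y))"
  have b_smooth: "smooth_fun_on B (fst l) (\<beta> b c)" for b c
  proof -
    have o: "open (fst l)" by (rule chart_open(1)[OF B l(1)])
    have e: "smooth_vfield_on B (fst l) (E b)" for b
      unfolding E_def[abs_def] by (rule smooth_vfield_chart_vec[OF B l(1)])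
    then have "smooth_vfield_on B (fst l) (\<lambda>y. \<psi> y (E b y))"
      using p o unfolding parallel_endo_def by blast
    then show ?thesis using e o R unfolding \<beta>_def riemannian_manifold_def by blast
  qed
  have near: "smooth_near B (F x) (\<beta> b c)" for b c
    unfolding smooth_near_def using b_smooth[of b c] l(2) chart_open(1)[OF B l(1)]
    by (intro exI[of _ "fst l"]) simp
  have q: "\<Phi> ?q = snd l (F x)" unfolding \<Phi>_def using chart_cinv(1)[OF A k] by simp
  have b_der: "(\<beta> b c \<circ> cinv l \<circ> \<Phi> has_derivative
     (\<lambda>u. g (F x) (\<psi> (F x) (D (F x) (vec x u) (E b))) (E c (F x)) +
          g (F x) (\<psi> (F x) (E b (F x))) (D (F x) (vec x u) (E c)))) (at ?q)" for b c
  proof -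
    have "(\<beta> b c \<circ> cinv l has_derivative frechet_derivative (\<beta> b c \<circ> cinv l) (at (\<Phi> ?q))) (at (\<Phi> ?q))"
      unfolding q using smooth_near_differentiable[OF B l near] frechet_derivative_works by blast
    from diff_chain_at[OF Phi_has_derivative[OF S(2)] this]
    have "(\<beta> b c \<circ> cinv l \<circ> \<Phi> has_derivative (\<lambda>u. frechet_derivative (\<beta> b c \<circ> cinv l) (at (snd l (F x))) (dPhi ?q u))) (at ?q)"
      by (simp add: o_def q)
    moreover have "frechet_derivative (\<beta> b c \<circ> cinv l) (at (snd l (F x))) (dPhi ?q u) = act (vec x u) (\<beta> b c)" for u
      unfolding vec_x E_def using near by (simp add: act_chart_vec)
    moreover have "act (vec x u) (\<beta> b c) =
       g (F x) (\<psi> (F x) (D (F x) (vec x u) (E b))) (E c (F x)) +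
       g (F x) (\<psi> (F x) (E b (F x))) (D (F x) (vec x u) (E c))" for u
    proof -
      have "act (vec x u) (\<beta> b c) = g (F x) (D (F x) (vec x u) (\<lambda>y. \<psi> y (E b y))) (E c (F x)) +
         g (F x) (\<psi> (F x) (E b (F x))) (D (F x) (vec x u) (E c))"
        using LC vec_in[OF k(2)] E_vfield parallel_endo_vfield_near[OF p E_vfield]
        unfolding levi_civita_def \<beta>_def by blast
      moreover have "D (F x) (vec x u) (\<lambda>y. \<psi> y (E b y)) = \<psi> (F x) (D (F x) (vec x u) (E b))"
        using p vec_in[OF k(2)] E_vfield unfolding parallel_endo_def by blast
      ultimately show ?thesis by simp
    qed
    ultimately show ?thesis by simp
  qed
  have "((\<lambda>q. \<Sum>b\<in>Basis. \<Sum>c\<in>Basis. (dPhi q v \<bullet> b) * (dPhi q w \<bullet> c) * (\<beta> b c \<circ> cinv l \<circ> \<Phi>) q) has_derivative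
     (\<lambda>u. \<Sum>b\<in>Basis. \<Sum>c\<in>Basis. (dPhi ?q v \<bullet> b) * (dPhi ?q w \<bullet> c) *
          (g (F x) (\<psi> (F x) (D (F x) (vec x u) (E b))) (E c (F x)) +
          g (F x) (\<psi> (F x) (E b (F x))) (D (F x) (vec x u) (E c)))
        + ((dPhi ?q v \<bullet> b) * (ddPhi u w \<bullet> c) + (ddPhi u v \<bullet> b) * (dPhi ?q w \<bullet> c)) * (\<beta> b c \<circ> cinv l \<circ> \<Phi>) ?q)) (at ?q)"
    by (intro has_derivative_sum has_derivative_mult b_der
        bounded_linear.has_derivative[OF bounded_linear_inner_left] dPhi_has_derivative)
  moreover have "(\<Sum>b\<in>Basis. \<Sum>c\<in>Basis. (dPhi q v \<bullet> b) * (dPhi q w \<bullet> c) * (\<beta> b c \<circ> cinv l \<circ> \<Phi>) q) =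
     g (F (cinv k q)) (\<psi> (F (cinv k q)) (vec (cinv k q) v)) (vec (cinv k q) w)" if "q \<in> S" for q
  proof -
    let ?y = "F (cinv k q)"
    have y: "?y \<in> fst l" "cinv k q \<in> fst k" "snd k (cinv k q) = q" using S_D[OF that] by auto
    have "vec (cinv k q) v = (\<Sum>b\<in>Basis. (dPhi q v \<bullet> b) *\<^sub>R E b ?y)" for v
      unfolding vec_E[OF y(2,1)] y(3) by (rule E_expand[OF y(1)])
    then show ?thesis
      using expand[OF E_in[OF y(1)] E_in[OF y(1)]] chart_cinv(1)[OF B l(1) y(1)]
      by (simp add: \<beta>_def \<Phi>_def)
  qed
  ultimately have "((\<lambda>q. g (F (cinv k q)) (\<psi> (F (cinv k q)) (vec (cinv k q) v)) (vec (cinv k q) w)) has_derivative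
     (\<lambda>u. \<Sum>b\<in>Basis. \<Sum>c\<in>Basis. (dPhi ?q v \<bullet> b) * (dPhi ?q w \<bullet> c) *
          (g (F x) (\<psi> (F x) (D (F x) (vec x u) (E b))) (E c (F x)) +
          g (F x) (\<psi> (F x) (E b (F x))) (D (F x) (vec x u) (E c)))
        + ((dPhi ?q v \<bullet> b) * (ddPhi u w \<bullet> c) + (ddPhi u v \<bullet> b) * (dPhi ?q w \<bullet> c)) * (\<beta> b c \<circ> cinv l \<circ> \<Phi>) ?q)) (at ?q)"
    by (rule has_derivative_transform_within_open[OF _ S])
  moreover have "(\<Sum>b\<in>Basis. \<Sum>c\<in>Basis. (dPhi ?q v \<bullet> b) * (dPhi ?q w \<bullet> c) *
          (g (F x) (\<psi> (F x) (D (F x) (vec x u) (E b))) (E c (F x)) +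
          g (F x) (\<psi> (F x) (E b (F x))) (D (F x) (vec x u) (E c)))
        + ((dPhi ?q v \<bullet> b) * (ddPhi u w \<bullet> c) + (ddPhi u v \<bullet> b) * (dPhi ?q w \<bullet> c)) * (\<beta> b c \<circ> cinv l \<circ> \<Phi>) ?q) =
     g (F x) (\<psi> (F x) (nabla u v)) (vec x w) + g (F x) (\<psi> (F x) (vec x v)) (nabla u w)" for u
  proof -
    have bx: "(\<beta> b c \<circ> cinv l \<circ> \<Phi>) ?q = g (F x) (\<psi> (F x) (E b (F x))) (E c (F x))" for b c
      using chart_cinv(1)[OF B l] by (simp add: \<beta>_def q)
    have Ein: "\<And>b. E b (F x) \<in> T" and Din: "\<And>b. D (F x) (vec x u) (E b) \<in> T"
      using E_in[OF l(2)] D_E_in[OF vec_in[OF k(2)]] by auto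
    have n: "nabla u v = (\<Sum>b\<in>Basis. (ddPhi u v \<bullet> b) *\<^sub>R E b (F x)) + (\<Sum>b\<in>Basis. (dPhi ?q v \<bullet> b) *\<^sub>R D (F x) (vec x u) (E b))" for v
      by (simp add: nabla_def sum.distrib)
    have in1: "(\<Sum>b\<in>Basis. (ddPhi u v \<bullet> b) *\<^sub>R E b (F x)) \<in> T" "(\<Sum>b\<in>Basis. (dPhi ?q v \<bullet> b) *\<^sub>R D (F x) (vec x u) (E b)) \<in> T" for v
      by (rule V_sum, rule V_mem(5), rule Ein) (rule V_sum, rule V_mem(5), rule Din)
    have add: "\<psi> (F x) (a + b) = \<psi> (F x) a + \<psi> (F x) b" if "a \<in> T" "b \<in> T" for a b
      using lp[of "F x"] that unfolding linear_map_on_def by blast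
    have "g (F x) (\<psi> (F x) (nabla u v)) (vec x w) =
       (\<Sum>b\<in>Basis. \<Sum>c\<in>Basis. (ddPhi u v \<bullet> b) * (dPhi ?q w \<bullet> c) * g (F x) (\<psi> (F x) (E b (F x))) (E c (F x)))
      + (\<Sum>b\<in>Basis. \<Sum>c\<in>Basis. (dPhi ?q v \<bullet> b) * (dPhi ?q w \<bullet> c) * g (F x) (\<psi> (F x) (D (F x) (vec x u) (E b))) (E c (F x)))"
      unfolding expand[OF Ein Ein, symmetric] expand[OF Din Ein, symmetric] vec_expand[symmetric]
      unfolding n using in1 pT add vec_in[OF k(2)] by (simp add: add_left)
    moreover have "g (F x) (\<psi> (F x) (vec x v)) (nabla u w) =
       (\<Sum>b\<in>Basis. \<Sum>c\<in>Basis. (dPhi ?q v \<bullet> b) * (ddPhi u w \<bullet> c) * g (F x) (\<psi> (F x) (E b (F x))) (E c (F x)))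
      + (\<Sum>b\<in>Basis. \<Sum>c\<in>Basis. (dPhi ?q v \<bullet> b) * (dPhi ?q w \<bullet> c) * g (F x) (\<psi> (F x) (E b (F x))) (D (F x) (vec x u) (E c)))"
      unfolding expand[OF Ein Ein, symmetric] expand[OF Ein Din, symmetric] vec_expand[symmetric]
      unfolding n using in1 pT vec_in[OF k(2)] by (simp add: add_right)
    ultimately show ?thesis
      unfolding bx by (simp add: algebra_simps sum.distrib)
  qed
  ultimately show ?thesis by simp
qed


text \<open>The second fundamental form, transported along the differential of an immersion to the tangent space
  of the image.\<close>

definition II where
  "II p q = normal_part g (F x) (tangent_image A B F x) (nabla (inv (vec x) p) (inv (vec x) q))"

lemma induced_metric_chart_vec:
  "induced_metric B g F x (chart_vec A k x u) (chart_vec A k x v) = g (F x) (vec x u) (vec x v)"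
  by (simp add: induced_metric_def vec_def)

context
  assumes inj: "inj (vec x)"
begin

lemma vec_eq_0_iff: "vec x v = 0 \<longleftrightarrow> v = 0"
  using inj linear_vec by (metis linear_0 injD)

lemma inner_at_induced: "inner_at (induced_metric B g F) x (tangent_space A x)"
proof
  have *: "differential B F x v \<in> T" if "v \<in> tangent_space A x" for v
    by (rule differential_in_tangent_space[OF A B F that])
  show "subspace (tangent_space A x)" by (rule subspace_tangent_space[OF A])
  show "\<exists>e. finite e \<and> span e = tangent_space A x"
    by (rule exI[of _ "chart_vec A k x ` Basis"]) (simp add: tangent_space_span[OF A k])
  fix v w assume v: "v \<in> tangent_space A x"
  show "linear_map_on (tangent_space A x) (induced_metric B g F x v)"
    unfolding linear_map_on_def induced_metric_def
    by (simp add: differential_linear add_right scale_right * v)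
  show "w \<in> tangent_space A x \<Longrightarrow> induced_metric B g F x v w = induced_metric B g F x w v"
    unfolding induced_metric_def by (rule sym[OF * *]) (use v in auto)
  assume "v \<noteq> 0"
  obtain u where u: "v = chart_vec A k x u" using v tangent_space_chart[OF A k] by auto
  then have "u \<noteq> 0" using \<open>v \<noteq> 0\<close> linear_0[OF linear_chart_vec[OF A k]] by auto
  then have "vec x u \<noteq> 0" by (simp add: vec_eq_0_iff)
  then show "0 < induced_metric B g F x v v"
    unfolding u induced_metric_chart_vec by (rule pos[OF vec_in[OF k(2)]])
qed

lemma II_vec: "II (vec x u) (vec x v) = normal_part g (F x) (tangent_image A B F x) (nabla u v)"
  unfolding II_def by (simp add: inv_f_f[OF inj])

lemma II_sff:
  "II (vec x u) (vec x v) = second_fundamental_form A B g D F x (chart_vec A k x u) (chart_vec A k x v)"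
  by (simp add: II_vec second_fundamental_form_nabla)

lemma II_sym:
  assumes "p \<in> tangent_image A B F x" "q \<in> tangent_image A B F x"
  shows "II p q = II q p"
  using assms unfolding tangent_image_vec by (auto simp: II_vec nabla_sym)

lemma II_normal:
  assumes "p \<in> tangent_image A B F x" "q \<in> tangent_image A B F x"
  shows "II p q \<in> T" "s \<in> tangent_image A B F x \<Longrightarrow> g (F x) (II p q) s = 0"
proof -
  obtain u v where uv: "p = vec x u" "q = vec x v" using assms unfolding tangent_image_vec by auto
  show "II p q \<in> T" "s \<in> tangent_image A B F x \<Longrightarrow> g (F x) (II p q) s = 0"
    unfolding uv II_vec by (rule normal_part[OF subspace_tangent_image nabla_in], assumption?)+
qed

lemma II_bilinear: "bilinear_on (tangent_image A B F x) II"
proof -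
  have 1: "linear_map_on (tangent_image A B F x) (II p)" if p: "p \<in> tangent_image A B F x" for p
  proof -
    obtain u where u: "p = vec x u" using p unfolding tangent_image_vec by auto
    have "II p (vec x v + vec x w) = II p (vec x v) + II p (vec x w)" for v w
      using linear_add[OF linear_vec, of v w]
      by (metis II_vec u linear_add[OF linear_nabla] normal_part_add[OF subspace_tangent_image nabla_in nabla_in])
    moreover have "II p (r *\<^sub>R vec x v) = r *\<^sub>R II p (vec x v)" for r v
      using linear_cmul[OF linear_vec, of r v]
      by (metis II_vec u linear_cmul[OF linear_nabla] normal_part_scale[OF subspace_tangent_image nabla_in])
    ultimately show ?thesis unfolding linear_map_on_def tangent_image_vec by auto
  qed
  have 2: "linear_map_on (tangent_image A B F x) (\<lambda>p. II p q)" if q: "q \<in> tangent_image A B F x" for q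
  proof -
    have "II (a + b) q = II a q + II b q" "II (r *\<^sub>R a) q = r *\<^sub>R II a q"
      if ab: "a \<in> tangent_image A B F x" "b \<in> tangent_image A B F x" for a b r
    proof -
      have "a + b \<in> tangent_image A B F x" "r *\<^sub>R a \<in> tangent_image A B F x"
        using subspace_tangent_image(1) ab by (auto simp: subspace_add subspace_scale)
      then show "II (a + b) q = II a q + II b q" "II (r *\<^sub>R a) q = r *\<^sub>R II a q"
        using 1[OF q] q ab by (simp_all add: II_sym[of _ q] linear_map_on_def)
    qed
    then show ?thesis unfolding linear_map_on_def by blast
  qed
  show ?thesis unfolding bilinear_on_def using 1 2 II_normal(1) by blast
qed

lemma orthonormal_basis_exists: "\<exists>e. orthonormal_basis A (induced_metric B g F) x e"
proof -
  interpret i: inner_at "induced_metric B g F" x "tangent_space A x" by (rule inner_at_induced)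
  obtain e where "i.orthonormal e" "span e = tangent_space A x"
    using i.exists_orthonormal[OF i.subspace_V order_refl] .
  then show ?thesis unfolding orthonormal_basis_def i.orthonormal_def by blast
qed

lemma orthonormal_basis_image:
  assumes "orthonormal_basis A (induced_metric B g F) x e"
  shows "orthonormal (differential B F x ` e)" "span (differential B F x ` e) = tangent_image A B F x"
    "inj_on (differential B F x) (tangent_space A x)" "e \<subseteq> tangent_space A x"
proof -
  have fin: "finite e" and sp: "span e = tangent_space A x"
    and on: "\<And>v w. v \<in> e \<Longrightarrow> w \<in> e \<Longrightarrow> induced_metric B g F x v w = (if v = w then 1 else 0)"
    using assms unfolding orthonormal_basis_def by blast+
  show eT: "e \<subseteq> tangent_space A x" unfolding sp[symmetric] by (rule span_superset)
  show inj: "inj_on (differential B F x) (tangent_space A x)"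
  proof (rule inj_onI)
    fix v w assume v: "v \<in> tangent_space A x" "w \<in> tangent_space A x" "differential B F x v = differential B F x w"
    obtain a b where "v = chart_vec A k x a" "w = chart_vec A k x b"
      using v(1,2) unfolding tangent_space_chart[OF A k] by auto
    then show "v = w" using v(3) inj by (simp add: vec_def[symmetric] inj_eq)
  qed
  have lin: "linear (differential B F x)" by (rule linearI) (rule differential_linear)+
  show "span (differential B F x ` e) = tangent_image A B F x"
    by (simp add: linear_span_image[OF lin] sp tangent_image_def)
  have "differential B F x ` e \<subseteq> T"
  proof (rule image_subsetI)
    fix v assume "v \<in> e"
    then have "v \<in> tangent_space A x" using eT by (rule subsetD[rotated])
    then show "differential B F x v \<in> T" by (rule differential_in_tangent_space[OF A B F])
  qed
  moreover have "\<And>v w. v \<in> e \<Longrightarrow> w \<in> e \<Longrightarrow> (differential B F x v = differential B F x w) = (v = w)"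
    using inj_on_eq_iff[OF inj_on_subset[OF inj eT]] .
  ultimately show "orthonormal (differential B F x ` e)"
    unfolding orthonormal_def using fin on by (simp add: induced_metric_def)
qed

text \<open>An orthonormal basis for the induced metric is mapped to an orthonormal basis of the tangent space of
  the image.\<close>

lemma sff_sq_norm_block:
  obtains e where "orthonormal e" "span e = tangent_image A B F x" "sff_sq_norm A B g D F x = block II e e"
proof -
  define e where "e = (SOME e. orthonormal_basis A (induced_metric B g F) x e)"
  have e: "orthonormal_basis A (induced_metric B g F) x e"
    unfolding e_def using orthonormal_basis_exists by (rule someI_ex)
  note im = orthonormal_basis_image[OF e]
  have sff: "second_fundamental_form A B g D F x v w = II (differential B F x v) (differential B F x w)"
    if vw: "v \<in> e" "w \<in> e" for v w
  proof -
    have "v \<in> tangent_space A x" "w \<in> tangent_space A x" using im(4) vw by blast+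
    then obtain a b where "v = chart_vec A k x a" "w = chart_vec A k x b"
      unfolding tangent_space_chart[OF A k] by auto
    then show ?thesis using II_sff[of a b] by (simp add: vec_def)
  qed
  have inj: "inj_on (differential B F x) e" using im(3,4) by (rule inj_on_subset)
  have "sff_sq_norm A B g D F x = block II (differential B F x ` e) (differential B F x ` e)"
    unfolding sff_sq_norm_def Let_def e_def[symmetric] block_def sum.reindex[OF inj] sq_norm_def
    by (intro sum.cong refl) (simp add: sff)
  then show ?thesis using that im(1,2) by blast
qed

lemma card_orthonormal:
  fixes L :: "'z::euclidean_space \<Rightarrow> 'q tvec"
  assumes "linear L" "inj L" "orthonormal e" "span e = range L"
  shows "card e = DIM('z)"
proof -
  have i: "independent (L ` Basis)"
    by (intro linear_independent_injective_image[OF assms(1) independent_Basis] inj_on_subset[OF assms(2)] subset_UNIV)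
  have "card (L ` Basis) = DIM('z)" by (intro card_image inj_on_subset[OF assms(2)] subset_UNIV)
  moreover have "span (L ` Basis) = range L" by (simp add: linear_span_image[OF assms(1)])
  ultimately show ?thesis
    using assms(4) dim_eq_card_independent[OF i] dim_eq_card_independent[OF orthonormal_independent[OF assms(3)]]
    by (metis dim_span)
qed

text \<open>The mean curvature is the average of \<open>Z\<close> over an orthonormal basis.\<close>

lemma mean_curvature_umbilical:
  assumes "\<And>u v. II (vec x u) (vec x v) = g (F x) (vec x u) (vec x v) *\<^sub>R Z"
  shows "mean_curvature A B g D F x = Z"
proof -
  define e where "e = (SOME e. orthonormal_basis A (induced_metric B g F) x e)"
  have e: "orthonormal_basis A (induced_metric B g F) x e"
    unfolding e_def using orthonormal_basis_exists by (rule someI_ex)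
  note im = orthonormal_basis_image[OF e]
  have "card (differential B F x ` e) = DIM('e)"
    by (rule card_orthonormal[OF linear_vec inj im(1)]) (simp add: im(2) tangent_image_vec)
  moreover have "inj_on (differential B F x) e" using im(3,4) by (rule inj_on_subset)
  ultimately have c: "card e = DIM('e)" by (simp add: card_image)
  have "second_fundamental_form A B g D F x v v = Z" if v: "v \<in> e" for v
  proof -
    have "v \<in> tangent_space A x" using im(4) v by blast
    then obtain a where a: "v = chart_vec A k x a" unfolding tangent_space_chart[OF A k] by auto
    have "induced_metric B g F x v v = 1" using e v unfolding orthonormal_basis_def by simp
    then show ?thesis using assms[of a a] II_sff[of a a] a by (simp add: induced_metric_chart_vec)
  qed
  then show ?thesis
    unfolding mean_curvature_def Let_def e_def[symmetric] by (simp add: c sum_constant_scaleR)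
qed

end

text \<open>The three brackets are derivatives of the induced metric by the product rule with \<open>\<psi> = id\<close>.\<close>

lemma Koszul_formula:
  "2 * g (F x) (nabla u v) (vec x w) =
     (g (F x) (nabla u v) (vec x w) + g (F x) (vec x v) (nabla u w))
   + (g (F x) (nabla v u) (vec x w) + g (F x) (vec x u) (nabla v w))
   - (g (F x) (nabla w u) (vec x v) + g (F x) (vec x u) (nabla w v))"
  using sym[OF vec_in[OF k(2)] nabla_in, of v u w] nabla_sym[of v u] nabla_sym[of w u] nabla_sym[of w v]
  by simp

end

section \<open>Composition with a map that is affine in charts\<close>

text \<open>For a map \<open>\<iota>\<close> with affine coordinate expression, such as the inclusion of a leaf, there are no second
  derivatives of \<open>\<iota>\<close> in the chain rule. Hence the ambient derivatives of the coordinate fields are the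
  same for \<open>F \<circ> \<iota>\<close> and for \<open>F\<close>.\<close>

locale chart_affine = m: map_chart A B g D F k "\<iota> x0" + A0: map_chart A0 B g D "F \<circ> \<iota>" k0 x0
  for A :: "('a::{t2_space,second_countable_topology}, 'e::euclidean_space) atlas"
    and B :: "('q::{t2_space,second_countable_topology}, 'm::euclidean_space) atlas"
    and g D F k
    and A0 :: "('b::{t2_space,second_countable_topology}, 'f::euclidean_space) atlas"
    and k0 x0 and \<iota> :: "'b \<Rightarrow> 'a" +
  fixes c :: 'e and L :: "'f \<Rightarrow> 'e" and N :: "'f set"
  assumes iota: "smooth_map A0 A \<iota>" and L: "bounded_linear L" and N: "open N" "snd k0 x0 \<in> N" "N \<subseteq> snd k0 ` fst k0"
    and affine: "\<And>q. q \<in> N \<Longrightarrow> \<iota> (cinv k0 q) \<in> fst k \<and> snd k (\<iota> (cinv k0 q)) = c + L q"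
begin

lemma vec_comp: "A0.vec x0 v = m.vec (\<iota> x0) (L v)"
proof -
  have "((\<lambda>q. c + L q) has_derivative L) (at (snd k0 x0))"
    by (auto intro!: derivative_eq_intros bounded_linear_imp_has_derivative L)
  then have "(snd k \<circ> \<iota> \<circ> cinv k0 has_derivative L) (at (snd k0 x0))"
    by (rule has_derivative_transform_within_open[OF _ N(1,2)]) (simp add: affine)
  from frechet_derivative_at[OF this]
  have "differential A \<iota> x0 (chart_vec A0 k0 x0 v) = chart_vec A k (\<iota> x0) (L v)"
    using differential_chart_vec[OF A0.A m.A iota A0.k m.k] by simp
  then show ?thesis
    unfolding A0.vec_def m.vec_def by (simp add: differential_comp[OF m.A m.B m.F])
qed

lemma nabla_comp: "A0.nabla u v = m.nabla (L u) (L v)"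
proof -
  let ?q = "snd k0 x0"
  have ll: "A0.l = m.l" unfolding A0.l_def m.l_def by simp
  have EE: "A0.E = m.E" unfolding A0.E_def[abs_def] m.E_def[abs_def] ll ..
  have contL: "continuous_on UNIV (\<lambda>q. c + L q)"
    using L by (intro continuous_intros linear_continuous_on)
  define O' where "O' = N \<inter> (\<lambda>q. c + L q) -` m.S"
  have O: "open O'" unfolding O'_def using N(1) m.S(1) contL by (intro open_Int open_vimage)
  have base: "c + L ?q = snd k (\<iota> x0)" using affine[OF N(2)] chart_cinv(1)[OF A0.A A0.k] by simp
  have q: "?q \<in> O'" unfolding O'_def using N(2) m.S(2) base by simp
  have Phi: "A0.\<Phi> q = m.\<Phi> (c + L q)" if "q \<in> N" for q
    using affine[OF that] chart_cinv(1)[OF m.A m.k(1)] unfolding A0.\<Phi>_def m.\<Phi>_def ll by simp (metis)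
  have d: "A0.dPhi p v = m.dPhi (c + L p) (L v)" if p: "p \<in> O'" for p v
  proof -
    have pS: "c + L p \<in> m.S" using p by (simp add: O'_def)
    have "((\<lambda>q. c + L q) has_derivative L) (at p)"
      by (auto intro!: derivative_eq_intros bounded_linear_imp_has_derivative L)
    from diff_chain_at[OF this m.Phi_has_derivative[OF pS]]
    have "(m.\<Phi> \<circ> (\<lambda>q. c + L q) has_derivative (m.dPhi (c + L p) \<circ> L)) (at p)" .
    then have "(A0.\<Phi> has_derivative (m.dPhi (c + L p) \<circ> L)) (at p)"
      by (rule has_derivative_transform_within_open[OF _ N(1)]) (use p Phi in \<open>auto simp: O'_def\<close>)
    from frechet_derivative_at[OF this] show ?thesis unfolding A0.dPhi_def by (metis comp_apply)
  qed
  have dd: "A0.ddPhi u v = m.ddPhi (L u) (L v)"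
  proof -
    have "((\<lambda>q. c + L q) has_derivative L) (at ?q)"
      by (auto intro!: derivative_eq_intros bounded_linear_imp_has_derivative L)
    moreover have "((\<lambda>q. m.dPhi q (L v)) has_derivative (\<lambda>u. m.ddPhi u (L v))) (at (c + L ?q))"
      unfolding base by (rule m.dPhi_has_derivative)
    ultimately have "((\<lambda>q. m.dPhi q (L v)) \<circ> (\<lambda>q. c + L q) has_derivative (\<lambda>u. m.ddPhi u (L v)) \<circ> L) (at ?q)"
      by (rule diff_chain_at)
    then have "((\<lambda>p. A0.dPhi p v) has_derivative (\<lambda>u. m.ddPhi u (L v)) \<circ> L) (at ?q)"
      by (rule has_derivative_transform_within_open[OF _ O q]) (simp add: d)
    from frechet_derivative_at[OF this] show ?thesis unfolding A0.ddPhi_def by (metis comp_apply)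
  qed
  show ?thesis
    unfolding A0.nabla_def m.nabla_def vec_comp dd d[OF q] base EE by simp
qed

end

section \<open>Product manifolds\<close>

definition prod_chart :: "('a, 'e) chart \<Rightarrow> ('b, 'f) chart \<Rightarrow> ('a \<times> 'b, 'e \<times> 'f) chart" where
  "prod_chart k l = (fst k \<times> fst l, map_prod (snd k) (snd l))"

lemma prod_chart_simps [simp]:
  "fst (prod_chart k l) = fst k \<times> fst l" "snd (prod_chart k l) (x, y) = (snd k x, snd l y)"
  by (simp_all add: prod_chart_def)

lemma prod_atlas_eq: "prod_atlas A B = {prod_chart k l | k l. k \<in> A \<and> l \<in> B}"
proof (intro equalityI subsetI)
  fix m assume "m \<in> prod_atlas A B"
  then obtain U c V d where m: "m = (U \<times> V, map_prod c d)" "(U, c) \<in> A" "(V, d) \<in> B"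
    unfolding prod_atlas_def by blast
  have "m = prod_chart (U, c) (V, d)" by (simp add: m prod_chart_def)
  then show "m \<in> {prod_chart k l | k l. k \<in> A \<and> l \<in> B}" using m(2,3) by blast
next
  fix m assume "m \<in> {prod_chart k l | k l. k \<in> A \<and> l \<in> B}"
  then obtain k l where m: "m = prod_chart k l" "k \<in> A" "l \<in> B" by blast
  then have "m = (fst k \<times> fst l, map_prod (snd k) (snd l))" "(fst k, snd k) \<in> A" "(fst l, snd l) \<in> B"
    by (simp_all add: prod_chart_def)
  then show "m \<in> prod_atlas A B" unfolding prod_atlas_def by blast
qed

lemma prod_chart_in: "k \<in> A \<Longrightarrow> l \<in> B \<Longrightarrow> prod_chart k l \<in> prod_atlas A B"
  unfolding prod_atlas_eq by blast

lemma prod_atlasE: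
  assumes "m \<in> prod_atlas A B"
  obtains k l where "k \<in> A" "l \<in> B" "m = prod_chart k l"
  using assms unfolding prod_atlas_eq by blast

lemma prod_chart_image: "snd (prod_chart k l) ` (S \<times> T) = (snd k ` S) \<times> (snd l ` T)"
  unfolding prod_chart_def by (auto simp: image_iff map_prod_def)

text \<open>The inverse of a product chart is the product of the inverses on the range of the chart only, as
  \<open>inv_into\<close> is arbitrary elsewhere.\<close>

lemma cinv_prod_chart:
  assumes A: "smooth_manifold A" and B: "smooth_manifold B" and k: "k \<in> A" and l: "l \<in> B"
    and p: "p \<in> snd k ` fst k" and q: "q \<in> snd l ` fst l"
  shows "inv_into (fst k \<times> fst l) (snd (prod_chart k l)) (p, q) = (cinv k p, cinv l q)"
  unfolding prod_chart_simps(1)[symmetric]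
proof (rule inv_into_f_eq)
  have ik: "inj_on (snd k) (fst k)" by (rule inj_on_inverseI) (rule chart_cinv(1)[OF A k])
  have il: "inj_on (snd l) (fst l)" by (rule inj_on_inverseI) (rule chart_cinv(1)[OF B l])
  show "inj_on (snd (prod_chart k l)) (fst (prod_chart k l))"
    unfolding prod_chart_def by (simp add: map_prod_inj_on[OF ik il])
qed (use chart_cinv[OF A k] chart_cinv[OF B l] p q in auto)

lemma smooth_on_fst:
  fixes S :: "('e::euclidean_space \<times> 'f::euclidean_space) set"
  assumes "open S"
  shows "smooth_on S fst"
  by (rule smooth_on_bounded_linear[OF smooth_on_id assms bounded_linear_fst])

lemma smooth_on_snd:
  fixes S :: "('e::euclidean_space \<times> 'f::euclidean_space) set"
  assumes "open S"
  shows "smooth_on S snd"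
  by (rule smooth_on_bounded_linear[OF smooth_on_id assms bounded_linear_snd])

lemma smooth_manifold_prod:
  assumes A: "smooth_manifold A" and B: "smooth_manifold B"
  shows "smooth_manifold (prod_atlas A B)"
  unfolding smooth_manifold_def
proof (intro conjI)
  show "(\<Union>(U, c)\<in>prod_atlas A B. U) = UNIV"
  proof (intro equalityI subsetI UNIV_I)
    fix z :: "'a \<times> 'c"
    obtain x y where z: "z = (x, y)" by force
    obtain k where k: "k \<in> A" "x \<in> fst k" using chart_exists[OF A] .
    obtain l where l: "l \<in> B" "y \<in> fst l" using chart_exists[OF B] .
    show "z \<in> (\<Union>(U, c)\<in>prod_atlas A B. U)"
      by (rule UN_I[OF prod_chart_in[OF k(1) l(1)]]) (use k l z in \<open>simp add: split_beta\<close>)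
  qed
  have "open (fst m) \<and> open (snd m ` fst m) \<and> homeomorphism (fst m) (snd m ` fst m) (snd m) (cinv m)"
    if m: "m \<in> prod_atlas A B" for m
  proof -
    obtain k l where k: "k \<in> A" and l: "l \<in> B" and m: "m = prod_chart k l" using prod_atlasE[OF m] .
    have hk: "continuous_on (fst k) (snd k)" "continuous_on (snd k ` fst k) (cinv k)"
      using chart_homeomorphism[OF A k] unfolding homeomorphism_def by auto
    have hl: "continuous_on (fst l) (snd l)" "continuous_on (snd l ` fst l) (cinv l)"
      using chart_homeomorphism[OF B l] unfolding homeomorphism_def by auto
    have im: "snd m ` fst m = snd k ` fst k \<times> snd l ` fst l" by (simp add: m prod_chart_image)
    have c1: "continuous_on (fst m) (snd m)"
    proof -
      have "continuous_on (fst k \<times> fst l) (\<lambda>z. (snd k (fst z), snd l (snd z)))"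
        by (intro continuous_on_Pair continuous_on_compose2[OF hk(1)] continuous_on_compose2[OF hl(1)]
            continuous_on_fst continuous_on_snd continuous_on_id) auto
      then show ?thesis unfolding m prod_chart_def by (simp add: map_prod_def split_beta)
    qed
    have c2: "continuous_on (snd m ` fst m) (cinv m)"
    proof -
      have "continuous_on (snd m ` fst m) (\<lambda>z. (cinv k (fst z), cinv l (snd z)))"
        unfolding im
        by (intro continuous_on_Pair continuous_on_compose2[OF hk(2)] continuous_on_compose2[OF hl(2)]
            continuous_on_fst continuous_on_snd continuous_on_id) auto
      then show ?thesis
        by (rule continuous_on_eq) (auto simp: im m cinv_prod_chart[OF A B k l])
    qed
    have "inj_on (snd m) (fst m)"
    proof -
      have ik: "inj_on (snd k) (fst k)" by (rule inj_on_inverseI) (rule chart_cinv(1)[OF A k])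
      have il: "inj_on (snd l) (fst l)" by (rule inj_on_inverseI) (rule chart_cinv(1)[OF B l])
      show ?thesis unfolding m prod_chart_def by (simp add: map_prod_inj_on[OF ik il])
    qed
    then have "homeomorphism (fst m) (snd m ` fst m) (snd m) (cinv m)"
      unfolding homeomorphism_def using c1 c2
      by (simp add: inv_into_image_cancel f_inv_into_f)
    moreover have "open (fst m)" "open (snd m ` fst m)"
      using chart_open[OF A k] chart_open[OF B l] unfolding im by (auto simp: m intro: open_Times)
    ultimately show ?thesis by blast
  qed
  then show "\<forall>(U, c)\<in>prod_atlas A B. open U \<and> open (c ` U) \<and> homeomorphism U (c ` U) c (inv_into U c)"
    by (simp add: split_beta)
  have "smooth_on (snd m ` (fst m \<inter> fst m')) (snd m' \<circ> cinv m)"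
    if m: "m \<in> prod_atlas A B" and m': "m' \<in> prod_atlas A B" for m m'
  proof -
    obtain k l where k: "k \<in> A" and l: "l \<in> B" and m: "m = prod_chart k l" using prod_atlasE[OF m] .
    obtain k' l' where k': "k' \<in> A" and l': "l' \<in> B" and m': "m' = prod_chart k' l'" using prod_atlasE[OF m'] .
    have im: "snd m ` (fst m \<inter> fst m') = snd k ` (fst k \<inter> fst k') \<times> snd l ` (fst l \<inter> fst l')"
      by (simp add: m m' Times_Int_Times prod_chart_image)
    have o: "open (snd m ` (fst m \<inter> fst m'))"
      unfolding im using chart_image_open[OF A k chart_open(1)[OF A k']] chart_image_open[OF B l chart_open(1)[OF B l']]
      by (rule open_Times)
    have s: "smooth_on (snd m ` (fst m \<inter> fst m')) (\<lambda>z. (((snd k' \<circ> cinv k) \<circ> fst) z, ((snd l' \<circ> cinv l) \<circ> snd) z))"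
      by (intro smooth_on_Pair smooth_on_comp[OF smooth_on_fst[OF o] chart_transition[OF A k k']]
          smooth_on_comp[OF smooth_on_snd[OF o] chart_transition[OF B l l']] o) (auto simp: im)
    show ?thesis
    proof (rule smooth_on_cong[OF s o])
      fix z assume "z \<in> snd m ` (fst m \<inter> fst m')"
      then obtain p q where z: "z = (p, q)" "p \<in> snd k ` fst k" "q \<in> snd l ` fst l" unfolding im by blast
      show "(((snd k' \<circ> cinv k) \<circ> fst) z, ((snd l' \<circ> cinv l) \<circ> snd) z) = (snd m' \<circ> cinv m) z"
        unfolding z(1) m m' by (simp add: cinv_prod_chart[OF A B k l z(2,3)])
    qed
  qed
  then show "\<forall>(U, c)\<in>prod_atlas A B. \<forall>(V, d)\<in>prod_atlas A B. smooth_on (c ` (U \<inter> V)) (d \<circ> inv_into U c)"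
    by (simp add: split_beta)
qed

text \<open>In charts the projection is the first component of a transition map of the product atlas.\<close>

lemma smooth_map_fst:
  assumes A: "smooth_manifold A" and B: "smooth_manifold B"
  shows "smooth_map (prod_atlas A B) A fst"
proof -
  have "smooth_on (snd m ` (fst m \<inter> fst -` fst k')) (snd k' \<circ> fst \<circ> cinv m)"
    if mA: "m \<in> prod_atlas A B" and k': "k' \<in> A" for m k'
  proof -
    obtain k l where l: "l \<in> B" and m: "m = prod_chart k l" using prod_atlasE[OF mA] .
    note t = prod_chart_in[OF k' l]
    have "smooth_on (snd m ` (fst m \<inter> fst (prod_chart k' l))) (\<lambda>z. fst ((snd (prod_chart k' l) \<circ> cinv m) z))"
      by (rule smooth_on_bounded_linear[OF chart_transition[OF smooth_manifold_prod[OF A B] mA t]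
            chart_image_open[OF smooth_manifold_prod[OF A B] mA chart_open(1)[OF smooth_manifold_prod[OF A B] t]]
            bounded_linear_fst])
    moreover have "fst m \<inter> fst (prod_chart k' l) = fst m \<inter> fst -` fst k'" by (auto simp: m)
    ultimately show ?thesis by (simp add: o_def prod_chart_def)
  qed
  then show ?thesis unfolding smooth_map_def by (auto simp: split_beta intro: continuous_on_fst continuous_on_id)
qed

lemma smooth_map_snd:
  assumes A: "smooth_manifold A" and B: "smooth_manifold B"
  shows "smooth_map (prod_atlas A B) B snd"
proof -
  have "smooth_on (snd m ` (fst m \<inter> snd -` fst l')) (snd l' \<circ> snd \<circ> cinv m)"
    if mA: "m \<in> prod_atlas A B" and l': "l' \<in> B" for m l'
  proof -
    obtain k l where k: "k \<in> A" and m: "m = prod_chart k l" using prod_atlasE[OF mA] .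
    note t = prod_chart_in[OF k l']
    have "smooth_on (snd m ` (fst m \<inter> fst (prod_chart k l'))) (\<lambda>z. snd ((snd (prod_chart k l') \<circ> cinv m) z))"
      by (rule smooth_on_bounded_linear[OF chart_transition[OF smooth_manifold_prod[OF A B] mA t]
            chart_image_open[OF smooth_manifold_prod[OF A B] mA chart_open(1)[OF smooth_manifold_prod[OF A B] t]]
            bounded_linear_snd])
    moreover have "fst m \<inter> fst (prod_chart k l') = fst m \<inter> snd -` fst l'" by (auto simp: m)
    ultimately show ?thesis by (simp add: o_def prod_chart_def)
  qed
  then show ?thesis unfolding smooth_map_def by (auto simp: split_beta intro: continuous_on_snd continuous_on_id)
qed

lemma smooth_map_Pair:
  assumes A: "smooth_manifold A" and B: "smooth_manifold B" and C: "smooth_manifold C"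
    and F: "smooth_map C A F" and G: "smooth_map C B G"
  shows "smooth_map C (prod_atlas A B) (\<lambda>x. (F x, G x))"
proof -
  have cont: "continuous_on UNIV F" "continuous_on UNIV G"
    using F G unfolding smooth_map_def by blast+
  have "smooth_on (snd j ` (fst j \<inter> (\<lambda>x. (F x, G x)) -` fst m)) (snd m \<circ> (\<lambda>x. (F x, G x)) \<circ> cinv j)"
    if m: "m \<in> prod_atlas A B" and j: "j \<in> C" for m j
  proof -
    obtain k l where k: "k \<in> A" and l: "l \<in> B" and m: "m = prod_chart k l" using prod_atlasE[OF m] .
    let ?W = "F -` fst k \<inter> G -` fst l"
    have W: "(\<lambda>x. (F x, G x)) -` fst m = ?W" by (auto simp: m)
    have "open ?W" using cont chart_open(1)[OF A k] chart_open(1)[OF B l] by (intro open_Int open_vimage)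
    then have o: "open (snd j ` (fst j \<inter> ?W))" by (rule chart_image_open[OF C j])
    have "smooth_on (snd j ` (fst j \<inter> ?W)) (\<lambda>q. ((snd k \<circ> F \<circ> cinv j) q, (snd l \<circ> G \<circ> cinv j) q))"
      by (intro smooth_on_Pair o smooth_on_subset[OF smooth_map_rep(1)[OF C A F j k]]
          smooth_on_subset[OF smooth_map_rep(1)[OF C B G j l]]) auto
    then show ?thesis unfolding W by (simp add: m o_def)
  qed
  then show ?thesis
    unfolding smooth_map_def using cont by (auto simp: split_beta intro: continuous_on_Pair)
qed

lemma smooth_map_const:
  assumes A: "smooth_manifold A" and B: "smooth_manifold B"
  shows "smooth_map A B (\<lambda>x. y)"
  unfolding smooth_map_def by (auto simp: o_def smooth_on_const)

section \<open>CRS bi-warped products\<close>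

locale crs =
  fixes B :: "('q::{t2_space,second_countable_topology}, 'm::euclidean_space) atlas"
    and g :: "'q metric" and D :: "'q connection"
    and \<phi> :: "'q \<Rightarrow> 'q tvec \<Rightarrow> 'q tvec" and \<xi> :: "'q vfield" and \<eta> :: "'q \<Rightarrow> 'q tvec \<Rightarrow> real"
    and AT :: "('a::{t2_space,second_countable_topology}, 'e::euclidean_space) atlas" and gT :: "'a metric"
    and Ap :: "('b::{t2_space,second_countable_topology}, 'f::euclidean_space) atlas" and gp :: "'b metric"
    and As :: "('c::{t2_space,second_countable_topology}, 'k::euclidean_space) atlas" and gs :: "'c metric"
    and f1 f2 :: "'a \<Rightarrow> real"
    and F :: "'a \<times> 'b \<times> 'c \<Rightarrow> 'q" and \<theta> :: "'a \<times> 'b \<times> 'c \<Rightarrow> real"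
  assumes cosym: "cosymplectic B g \<phi> \<xi> \<eta> D"
    and crs: "CRS_biwarped AT gT Ap gp As gs f1 f2 B g \<phi> \<xi> F \<theta>"
    and proper: "\<forall>x y. proper_pointwise_slant As B g \<phi> (F \<circ> leaf3 x y) (\<theta> \<circ> leaf3 x y)"
begin

definition M where "M = triple_atlas AT Ap As"

lemma biwarped: "biwarped_submanifold AT gT Ap gp As gs f1 f2 B g F"
  using crs by (simp add: CRS_biwarped_def)

lemma RT: "riemannian_manifold AT gT" and Rp: "riemannian_manifold Ap gp" and Rs: "riemannian_manifold As gs"
  using biwarped by (simp_all add: biwarped_submanifold_def)

lemma MT: "smooth_manifold AT" and Mp: "smooth_manifold Ap" and Ms: "smooth_manifold As"
  using RT Rp Rs by (simp_all add: riemannian_manifold_def)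

lemma Mps: "smooth_manifold (prod_atlas Ap As)"
  by (rule smooth_manifold_prod[OF Mp Ms])

lemma M: "smooth_manifold M"
  unfolding M_def by (rule smooth_manifold_prod[OF MT Mps])

lemma acm: "almost_contact_metric B g \<phi> \<xi> \<eta>" and LC: "levi_civita B g D"
  using cosym by (simp_all add: cosymplectic_def)

lemma RB: "riemannian_manifold B g"
  using acm by (simp add: almost_contact_metric_def)

lemma MB: "smooth_manifold B"
  using RB by (simp add: riemannian_manifold_def)

lemma immersion: "smooth_map M B F" "inj_on (differential B F x) (tangent_space M x)"
  using biwarped unfolding biwarped_submanifold_def immersion_def M_def by blast+

lemma phi_parallel: "parallel_endo B D \<phi>"
  using cosym unfolding parallel_endo_def cosymplectic_def almost_contact_metric_def
  by (simp add: image_subset_iff)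

lemma phi_in: "v \<in> tangent_space B y \<Longrightarrow> \<phi> y v \<in> tangent_space B y"
  using acm unfolding almost_contact_metric_def by (simp add: image_subset_iff)

lemma phi_phi: "v \<in> tangent_space B y \<Longrightarrow> \<phi> y (\<phi> y v) = - v + \<eta> y v *\<^sub>R \<xi> y"
  and phi_xi: "\<phi> y (\<xi> y) = 0"
  and eta_phi: "v \<in> tangent_space B y \<Longrightarrow> \<eta> y (\<phi> y v) = 0"
  and phi_metric: "v \<in> tangent_space B y \<Longrightarrow> w \<in> tangent_space B y \<Longrightarrow>
    g y (\<phi> y v) (\<phi> y w) = g y v w - \<eta> y v * \<eta> y w"
  and eta_g: "v \<in> tangent_space B y \<Longrightarrow> \<eta> y v = g y v (\<xi> y)"
  using acm by (simp_all add: almost_contact_metric_def)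

lemma xi_in: "\<xi> y \<in> tangent_space B y"
proof -
  have "smooth_vfield_on B UNIV \<xi>" using acm by (simp add: almost_contact_metric_def)
  then show ?thesis unfolding smooth_vfield_on_def by blast
qed

text \<open>Apply the metric identity to \<open>v\<close> and \<open>\<phi> w\<close> and use the formula for \<open>\<phi>\<^sup>2\<close>.\<close>

lemma phi_skew:
  assumes v: "v \<in> tangent_space B y" and w: "w \<in> tangent_space B y"
  shows "g y (\<phi> y v) w = - g y v (\<phi> y w)"
proof -
  interpret y: inner_at g y "tangent_space B y" by (rule inner_at_tangent_space[OF RB])
  have "g y (\<phi> y v) (\<phi> y (\<phi> y w)) = g y v (\<phi> y w)"
    using phi_metric[OF v phi_in[OF w]] eta_phi[OF w] by simp
  moreover have "g y (\<phi> y v) (\<phi> y (\<phi> y w)) = - g y (\<phi> y v) w"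
    using phi_phi[OF w] v w phi_in[OF v] xi_in eta_phi[OF v] eta_g[OF phi_in[OF v]]
    by (simp add: y.bilin)
  ultimately show ?thesis by simp
qed

text \<open>Both warping functions are treated alike, as elements of \<open>{f1, f2}\<close>.\<close>

lemma warping: "f \<in> {f1, f2} \<Longrightarrow> smooth_fun_on AT UNIV f" "f \<in> {f1, f2} \<Longrightarrow> f y > 0"
  using biwarped unfolding biwarped_submanifold_def by auto

lemma smooth_ln_warping: "f \<in> {f1, f2} \<Longrightarrow> smooth_fun_on AT UNIV (ln \<circ> f)"
  by (rule smooth_fun_on_real_comp[OF MT open_UNIV warping(1) smooth_on_ln]) (use warping(2) in auto)

lemma leaf_smooth:
  "smooth_map AT M (leaf1 b c)" "smooth_map Ap M (leaf2 a c)" "smooth_map As M (leaf3 a b)"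
proof -
  have i: "smooth_map AT AT (\<lambda>x. x)" "smooth_map Ap Ap (\<lambda>x. x)" "smooth_map As As (\<lambda>x. x)"
    using smooth_map_id[OF MT] smooth_map_id[OF Mp] smooth_map_id[OF Ms] by (simp_all add: id_def)
  show "smooth_map AT M (leaf1 b c)" unfolding leaf1_def M_def
    by (intro smooth_map_Pair MT Mps i smooth_map_const)
  show "smooth_map Ap M (leaf2 a c)" unfolding leaf2_def M_def
    by (intro smooth_map_Pair MT Mp Ms Mps i smooth_map_const)
  show "smooth_map As M (leaf3 a b)" unfolding leaf3_def M_def
    by (intro smooth_map_Pair MT Mp Ms Mps i smooth_map_const)
qed

end

text \<open>The charts are fixed together with the point: for another point in their domains the same charts
  are used, so that relations between coordinate fields can be differentiated. Coordinate vectors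
  \<open>(u, 0, 0)\<close> are called horizontal, those of the form \<open>(0, v, w)\<close> vertical.\<close>

locale crs_point = crs B g D \<phi> \<xi> \<eta> AT gT Ap gp As gs f1 f2 F \<theta>
  for B :: "('q::{t2_space,second_countable_topology}, 'm::euclidean_space) atlas"
    and g D \<phi> \<xi> \<eta>
    and AT :: "('a::{t2_space,second_countable_topology}, 'e::euclidean_space) atlas" and gT
    and Ap :: "('b::{t2_space,second_countable_topology}, 'f::euclidean_space) atlas" and gp
    and As :: "('c::{t2_space,second_countable_topology}, 'k::euclidean_space) atlas" and gs
    and f1 f2 F \<theta> +
  fixes kT :: "('a, 'e) chart" and kp :: "('b, 'f) chart" and ks :: "('c, 'k) chart"
    and a :: 'a and b :: 'b and c :: 'c
  assumes kT: "kT \<in> AT" "a \<in> fst kT" and kp: "kp \<in> Ap" "b \<in> fst kp" and ks: "ks \<in> As" "c \<in> fst ks"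
begin

definition k where "k = prod_chart kT (prod_chart kp ks)"
abbreviation x where "x \<equiv> (a, b, c)"

lemma k: "k \<in> M" "x \<in> fst k"
  unfolding k_def M_def using kT kp ks by (simp_all add: prod_chart_in)

lemma fst_k: "fst k = fst kT \<times> fst kp \<times> fst ks"
  by (simp add: k_def)

lemma snd_k: "snd k y = (snd kT (fst y), snd kp (fst (snd y)), snd ks (snd (snd y)))"
  by (cases y) (simp add: k_def)

lemma k_image: "snd k ` fst k = snd kT ` fst kT \<times> snd kp ` fst kp \<times> snd ks ` fst ks"
  by (simp add: k_def prod_chart_image)

lemma cinv_k:
  assumes "p \<in> snd kT ` fst kT" "q \<in> snd kp ` fst kp" "r \<in> snd ks ` fst ks"
  shows "cinv k (p, q, r) = (cinv kT p, cinv kp q, cinv ks r)"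
  using cinv_prod_chart[OF MT Mps kT(1) prod_chart_in[OF kp(1) ks(1)], of p "(q, r)"]
    cinv_prod_chart[OF Mp Ms kp(1) ks(1) assms(2,3)] assms
  by (simp add: k_def prod_chart_image)

sublocale m: map_chart M B g D F k x
  by unfold_locales (fact M RB LC immersion(1) k)+

abbreviation G where "G \<equiv> g (F x)"
abbreviation vec where "vec \<equiv> m.vec x"
abbreviation nab where "nab \<equiv> m.nabla"
abbreviation J where "J \<equiv> \<phi> (F x)"

lemma inj_vec: "inj vec"
proof (rule injI)
  fix u v assume "vec u = vec v"
  then have "chart_vec M k x u = chart_vec M k x v"
    using immersion(2)[of x] chart_vec_in_tangent_space[OF k] unfolding m.vec_def by (meson inj_onD)
  then show "u = v" using inj_chart_vec[OF M k] by (simp add: inj_eq)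
qed

lemma linear_vec: "linear vec" by (rule m.linear_vec)

lemma vec_T [simp]: "vec u \<in> m.T" by (rule m.vec_in[OF k(2)])

lemma proj_chart_vec:
  "differential AT fst x (chart_vec M k x (u, v, w)) = chart_vec AT kT a u"
  "differential Ap (fst \<circ> snd) x (chart_vec M k x (u, v, w)) = chart_vec Ap kp b v"
  "differential As (snd \<circ> snd) x (chart_vec M k x (u, v, w)) = chart_vec As ks c w"
proof -
  have s: "smooth_map M AT fst" "smooth_map M (prod_atlas Ap As) snd"
    unfolding M_def using smooth_map_fst[OF MT Mps] smooth_map_snd[OF MT Mps] by auto
  have s2: "smooth_map M Ap (fst \<circ> snd)" "smooth_map M As (snd \<circ> snd)"
    using smooth_map_comp[OF M Mps Mp s(2) smooth_map_fst[OF Mp Ms]]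
      smooth_map_comp[OF M Mps Ms s(2) smooth_map_snd[OF Mp Ms]] by auto
  have b: "bounded_linear (\<lambda>q::'e \<times> 'f \<times> 'k. fst (snd q))" "bounded_linear (\<lambda>q::'e \<times> 'f \<times> 'k. snd (snd q))"
    by (auto intro: bounded_linear_fst_comp bounded_linear_snd_comp bounded_linear_snd)
  show "differential AT fst x (chart_vec M k x (u, v, w)) = chart_vec AT kT a u"
    using differential_affine[OF M MT s(1) k kT(1) _ bounded_linear_fst, of 0 "(u, v, w)"] kT chart_cinv(3)[OF MT kT(1)]
    by (auto simp: k_image cinv_k)
  show "differential Ap (fst \<circ> snd) x (chart_vec M k x (u, v, w)) = chart_vec Ap kp b v"
    using differential_affine[OF M Mp s2(1) k kp(1) _ b(1), of 0 "(u, v, w)"] kp chart_cinv(3)[OF Mp kp(1)]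
    by (auto simp: k_image cinv_k)
  show "differential As (snd \<circ> snd) x (chart_vec M k x (u, v, w)) = chart_vec As ks c w"
    using differential_affine[OF M Ms s2(2) k ks(1) _ b(2), of 0 "(u, v, w)"] ks chart_cinv(3)[OF Ms ks(1)]
    by (auto simp: k_image cinv_k)
qed

lemma gram:
  "G (vec (u, v, w)) (vec (u', v', w')) =
     gT a (chart_vec AT kT a u) (chart_vec AT kT a u')
     + (f1 a)\<^sup>2 * gp b (chart_vec Ap kp b v) (chart_vec Ap kp b v')
     + (f2 a)\<^sup>2 * gs c (chart_vec As ks c w) (chart_vec As ks c w')"
proof -
  have "induced_metric B g F x (chart_vec M k x (u, v, w)) (chart_vec M k x (u', v', w'))
     = biwarped_metric AT gT Ap gp As gs f1 f2 x (chart_vec M k x (u, v, w)) (chart_vec M k x (u', v', w'))"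
    using biwarped chart_vec_in_tangent_space[OF k] unfolding biwarped_submanifold_def M_def[symmetric] by blast
  then show ?thesis
    by (simp add: m.induced_metric_chart_vec biwarped_metric_def proj_chart_vec)
qed

lemma zero_metric [simp]:
  "gT a 0 (chart_vec AT kT a u) = 0" "gT a (chart_vec AT kT a u) 0 = 0"
  "gp b 0 (chart_vec Ap kp b v) = 0" "gp b (chart_vec Ap kp b v) 0 = 0"
  "gs c 0 (chart_vec As ks c w) = 0" "gs c (chart_vec As ks c w) 0 = 0"
  "gT a 0 0 = 0" "gp b 0 0 = 0" "gs c 0 0 = 0"
  "chart_vec AT kT a 0 = 0" "chart_vec Ap kp b 0 = 0" "chart_vec As ks c 0 = 0"
proof -
  interpret T: inner_at gT a "tangent_space AT a" by (rule inner_at_tangent_space[OF RT])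
  interpret p: inner_at gp b "tangent_space Ap b" by (rule inner_at_tangent_space[OF Rp])
  interpret s: inner_at gs c "tangent_space As c" by (rule inner_at_tangent_space[OF Rs])
  note [simp] = chart_vec_in_tangent_space[OF kT] chart_vec_in_tangent_space[OF kp] chart_vec_in_tangent_space[OF ks]
  show
    "gT a 0 (chart_vec AT kT a u) = 0" "gT a (chart_vec AT kT a u) 0 = 0"
    "gp b 0 (chart_vec Ap kp b v) = 0" "gp b (chart_vec Ap kp b v) 0 = 0"
    "gs c 0 (chart_vec As ks c w) = 0" "gs c (chart_vec As ks c w) 0 = 0"
    "gT a 0 0 = 0" "gp b 0 0 = 0" "gs c 0 0 = 0"
    by simp_all
  show "chart_vec AT kT a 0 = 0" "chart_vec Ap kp b 0 = 0" "chart_vec As ks c 0 = 0"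
    using linear_0[OF linear_chart_vec[OF MT kT]] linear_0[OF linear_chart_vec[OF Mp kp]]
      linear_0[OF linear_chart_vec[OF Ms ks]] by auto
qed

lemma gram_orthogonal:
  "G (vec (u, 0, 0)) (vec (0, v, w)) = 0" "G (vec (0, v, w)) (vec (u, 0, 0)) = 0"
  "G (vec (0, v, 0)) (vec (0, 0, w)) = 0" "G (vec (0, 0, w)) (vec (0, v, 0)) = 0"
  by (simp_all add: gram)

text \<open>The tangent spaces of the three leaves through the point, inside the ambient tangent space.\<close>

definition T1 where "T1 = range (\<lambda>u. vec (u, 0, 0))"
definition T2 where "T2 = range (\<lambda>v. vec (0, v, 0))"
definition T3 where "T3 = range (\<lambda>w. vec (0, 0, w))"

lemma bounded_linear_inclusions:
  "bounded_linear (\<lambda>u::'e. (u, 0::'f, 0::'k))" "bounded_linear (\<lambda>v::'f. (0::'e, v, 0::'k))"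
  "bounded_linear (\<lambda>w::'k. (0::'e, 0::'f, w))"
  by (auto intro!: bounded_linear_Pair bounded_linear_ident bounded_linear_zero)

lemma linear_parts:
  "linear (\<lambda>u. vec (u, 0, 0))" "linear (\<lambda>v. vec (0, v, 0))" "linear (\<lambda>w. vec (0, 0, w))"
  using linear_compose[OF bounded_linear.linear linear_vec] bounded_linear_inclusions
  by (auto simp: o_def)

lemma inj_parts:
  "inj (\<lambda>u. vec (u, 0, 0))" "inj (\<lambda>v. vec (0, v, 0))" "inj (\<lambda>w. vec (0, 0, w))"
  using inj_vec by (auto simp: inj_def)

lemma T_subspace: "subspace T1" "T1 \<subseteq> m.T" "subspace T2" "T2 \<subseteq> m.T" "subspace T3" "T3 \<subseteq> m.T"
  unfolding T1_def T2_def T3_def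
  using linear_subspace_image[OF linear_parts(1) subspace_UNIV]
    linear_subspace_image[OF linear_parts(2) subspace_UNIV]
    linear_subspace_image[OF linear_parts(3) subspace_UNIV] by auto

lemma vec_split: "vec (u, v, w) = vec (u, 0, 0) + vec (0, v, 0) + vec (0, 0, w)"
  by (simp flip: linear_add[OF linear_vec])

lemma leaf_vec:
  "chart_affine M B g D F k AT kT a (leaf1 b c) (0, snd kp b, snd ks c) (\<lambda>u. (u, 0, 0)) (snd kT ` fst kT)"
  "chart_affine M B g D F k Ap kp b (leaf2 a c) (snd kT a, 0, snd ks c) (\<lambda>u. (0, u, 0)) (snd kp ` fst kp)"
  "chart_affine M B g D F k As ks c (leaf3 a b) (snd kT a, snd kp b, 0) (\<lambda>u. (0, 0, u)) (snd ks ` fst ks)"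
proof -
  have c1: "map_chart M B g D F k (leaf1 b c a)" "map_chart M B g D F k (leaf2 a c b)" "map_chart M B g D F k (leaf3 a b c)"
    using m.map_chart_axioms by (simp_all add: leaf1_def leaf2_def leaf3_def)
  have s: "smooth_map AT B (F \<circ> leaf1 b c)" "smooth_map Ap B (F \<circ> leaf2 a c)" "smooth_map As B (F \<circ> leaf3 a b)"
    by (rule smooth_map_comp[OF _ M MB leaf_smooth(1) immersion(1)], rule MT,
        rule smooth_map_comp[OF _ M MB leaf_smooth(2) immersion(1)], rule Mp,
        rule smooth_map_comp[OF _ M MB leaf_smooth(3) immersion(1)], rule Ms)
  have c2: "map_chart AT B g D (F \<circ> leaf1 b c) kT a" "map_chart Ap B g D (F \<circ> leaf2 a c) kp b"
      "map_chart As B g D (F \<circ> leaf3 a b) ks c"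
    by (unfold_locales; fact MT Mp Ms RB LC s kT kp ks)+
  show "chart_affine M B g D F k AT kT a (leaf1 b c) (0, snd kp b, snd ks c) (\<lambda>u. (u, 0, 0)) (snd kT ` fst kT)"
    by (intro chart_affine.intro c1 c2 chart_affine_axioms.intro leaf_smooth bounded_linear_inclusions chart_open(2)[OF MT kT(1)])
      (use kT kp ks chart_cinv[OF MT kT(1)] in \<open>auto simp: leaf1_def fst_k snd_k\<close>)
  show "chart_affine M B g D F k Ap kp b (leaf2 a c) (snd kT a, 0, snd ks c) (\<lambda>u. (0, u, 0)) (snd kp ` fst kp)"
    by (intro chart_affine.intro c1 c2 chart_affine_axioms.intro leaf_smooth bounded_linear_inclusions chart_open(2)[OF Mp kp(1)])
      (use kT kp ks chart_cinv[OF Mp kp(1)] in \<open>auto simp: leaf2_def fst_k snd_k\<close>)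
  show "chart_affine M B g D F k As ks c (leaf3 a b) (snd kT a, snd kp b, 0) (\<lambda>u. (0, 0, u)) (snd ks ` fst ks)"
    by (intro chart_affine.intro c1 c2 chart_affine_axioms.intro leaf_smooth bounded_linear_inclusions chart_open(2)[OF Ms ks(1)])
      (use kT kp ks chart_cinv[OF Ms ks(1)] in \<open>auto simp: leaf3_def fst_k snd_k\<close>)
qed

sublocale L1: chart_affine M B g D F k AT kT a "leaf1 b c" "(0, snd kp b, snd ks c)" "\<lambda>u. (u, 0, 0)" "snd kT ` fst kT"
  rewrites "leaf1 b c a = x"
  by (rule leaf_vec) (simp add: leaf1_def)

sublocale L2: chart_affine M B g D F k Ap kp b "leaf2 a c" "(snd kT a, 0, snd ks c)" "\<lambda>u. (0, u, 0)" "snd kp ` fst kp"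
  rewrites "leaf2 a c b = x"
  by (rule leaf_vec) (simp add: leaf2_def)

sublocale L3: chart_affine M B g D F k As ks c "leaf3 a b" "(snd kT a, snd kp b, 0)" "\<lambda>u. (0, 0, u)" "snd ks ` fst ks"
  rewrites "leaf3 a b c = x"
  by (rule leaf_vec) (simp add: leaf3_def)

lemma T_tangent_image:
  "tangent_image AT B (F \<circ> leaf1 b c) a = T1"
  "tangent_image Ap B (F \<circ> leaf2 a c) b = T2"
  "tangent_image As B (F \<circ> leaf3 a b) c = T3"
  unfolding L1.A0.tangent_image_vec L2.A0.tangent_image_vec L3.A0.tangent_image_vec T1_def T2_def T3_def
  by (simp_all add: L1.vec_comp L2.vec_comp L3.vec_comp)

lemma J_T1: "p \<in> T1 \<Longrightarrow> J p \<in> T1" and xi_T1: "\<xi> (F x) \<in> T1"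
proof -
  have "invariant_submanifold AT B \<phi> \<xi> (F \<circ> leaf1 b c)" using crs by (simp add: CRS_biwarped_def)
  then have "\<xi> ((F \<circ> leaf1 b c) a) \<in> T1 \<and> \<phi> ((F \<circ> leaf1 b c) a) ` T1 \<subseteq> T1"
    unfolding invariant_submanifold_def T_tangent_image[symmetric] by blast
  then show "\<xi> (F x) \<in> T1" "p \<in> T1 \<Longrightarrow> J p \<in> T1" by (auto simp: leaf1_def)
qed

text \<open>The invariance of \<open>N\<^sub>T\<close> in the form that is differentiated below, for \<open>\<phi>\<close> and for \<open>\<phi>\<^sup>2\<close>.\<close>

lemma J_orthogonal:
  "G (J (vec (u, 0, 0))) (vec (0, v, w)) = 0" "G (J (J (vec (u, 0, 0)))) (vec (0, v, w)) = 0"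
proof -
  have *: "G p (vec (0, v, w)) = 0" if "p \<in> T1" for p
    using that unfolding T1_def by (auto simp: gram_orthogonal)
  show "G (J (vec (u, 0, 0))) (vec (0, v, w)) = 0" "G (J (J (vec (u, 0, 0)))) (vec (0, v, w)) = 0"
    by (intro * J_T1; simp add: T1_def)+
qed


section \<open>Derivatives of the induced metric\<close>

text \<open>The derivative at the point, in the direction \<open>W\<close>, of the inner product of the coordinate fields \<open>U\<close>
  and \<open>U'\<close>, by the product rule.\<close>

definition dG where "dG W U U' = G (nab W U) (vec U') + G (vec U) (nab W U')"

lemma dG_sym: "dG W U U' = dG W U' U"
  unfolding dG_def using m.sym[OF m.nabla_in vec_T] m.sym[OF vec_T m.nabla_in] by simp

lemma dG_add: "dG W U (U' + U'') = dG W U U' + dG W U U''"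
  unfolding dG_def by (simp add: linear_add[OF linear_vec] linear_add[OF m.linear_nabla] m.add_right)

lemma crs_point_near:
  assumes "(a', b', c') \<in> fst k"
  shows "crs_point B g D \<phi> \<xi> \<eta> AT gT Ap gp As gs f1 f2 F \<theta> kT kp ks a' b' c'"
  by unfold_locales (use assms kT kp ks in \<open>auto simp: fst_k\<close>)

text \<open>This turns a formula for the inner product of two coordinate fields in the whole chart domain
  into a relation between their covariant derivatives at the point.\<close>

lemma derivative_of_product:
  assumes p: "parallel_endo B D \<psi>"
    and H: "\<And>y. y \<in> fst k \<Longrightarrow> g (F y) (\<psi> (F y) (m.vec y U)) (m.vec y U') = H (snd k y)"
    and d: "((\<lambda>t. H (snd k x + t *\<^sub>R W)) has_real_derivative d) (at 0)"
  shows "G (\<psi> (F x) (nab W U)) (vec U') + G (\<psi> (F x) (vec U)) (nab W U') = d"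
proof (rule derivative_along_line[OF m.product_rule[OF p] chart_open(2)[OF M k(1)] _ _ d])
  show "snd k x \<in> snd k ` fst k" using k by simp
  fix q assume "q \<in> snd k ` fst k"
  then obtain y where y: "y \<in> fst k" "q = snd k y" by auto
  then show "g (F (cinv k q)) (\<psi> (F (cinv k q)) (m.vec (cinv k q) U)) (m.vec (cinv k q) U') = H q"
    using H[OF y(1)] chart_cinv(1)[OF M k(1)] by simp
qed

lemmas dG_eqI = derivative_of_product[OF parallel_endo_id, folded dG_def]

definition dlog where "dlog f u = act (chart_vec AT kT a u) (ln \<circ> f)"

lemma smooth_near_ln: "f \<in> {f1, f2} \<Longrightarrow> smooth_near AT a (ln \<circ> f)"
  unfolding smooth_near_def using smooth_ln_warping[of f] by (intro exI[of _ UNIV]) simp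

lemma dlog_has_derivative:
  assumes "f \<in> {f1, f2}"
  shows "(ln \<circ> f \<circ> cinv kT has_derivative dlog f) (at (snd kT a))"
  using smooth_near_differentiable[OF MT kT smooth_near_ln[OF assms]] smooth_near_ln[OF assms]
  unfolding frechet_derivative_works dlog_def[abs_def] by (simp add: act_chart_vec)

lemma linear_dlog: "f \<in> {f1, f2} \<Longrightarrow> linear (dlog f)"
  by (rule has_derivative_linear[OF dlog_has_derivative])

lemma gram_near:
  assumes y: "y \<in> fst k"
  shows "g (F y) (m.vec y (u, 0, 0)) (m.vec y (u', 0, 0)) = gT (fst y) (chart_vec AT kT (fst y) u) (chart_vec AT kT (fst y) u')"
    and "g (F y) (m.vec y (u, 0, 0)) (m.vec y (0, v, w)) = 0"
    and "g (F y) (m.vec y (0, v, 0)) (m.vec y (0, v', 0)) =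
      (f1 (fst y))\<^sup>2 * gp (fst (snd y)) (chart_vec Ap kp (fst (snd y)) v) (chart_vec Ap kp (fst (snd y)) v')"
    and "g (F y) (m.vec y (0, 0, w)) (m.vec y (0, 0, w')) =
      (f2 (fst y))\<^sup>2 * gs (snd (snd y)) (chart_vec As ks (snd (snd y)) w) (chart_vec As ks (snd (snd y)) w')"
    and "g (F y) (m.vec y (0, v, 0)) (m.vec y (0, 0, w)) = 0"
    and "g (F y) (\<phi> (F y) (m.vec y (u, 0, 0))) (m.vec y (0, v, w)) = 0"
    and "g (F y) (\<phi> (F y) (\<phi> (F y) (m.vec y (u, 0, 0)))) (m.vec y (0, v, w)) = 0"
proof -
  obtain a' b' c' where y': "y = (a', b', c')" by (cases y)
  interpret y: crs_point B g D \<phi> \<xi> \<eta> AT gT Ap gp As gs f1 f2 F \<theta> kT kp ks a' b' c'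
    by (rule crs_point_near[OF y[unfolded y']])
  show "g (F y) (m.vec y (u, 0, 0)) (m.vec y (u', 0, 0)) = gT (fst y) (chart_vec AT kT (fst y) u) (chart_vec AT kT (fst y) u')"
    "g (F y) (m.vec y (u, 0, 0)) (m.vec y (0, v, w)) = 0"
    "g (F y) (m.vec y (0, v, 0)) (m.vec y (0, v', 0)) =
      (f1 (fst y))\<^sup>2 * gp (fst (snd y)) (chart_vec Ap kp (fst (snd y)) v) (chart_vec Ap kp (fst (snd y)) v')"
    "g (F y) (m.vec y (0, 0, w)) (m.vec y (0, 0, w')) =
      (f2 (fst y))\<^sup>2 * gs (snd (snd y)) (chart_vec As ks (snd (snd y)) w) (chart_vec As ks (snd (snd y)) w')"
    "g (F y) (m.vec y (0, v, 0)) (m.vec y (0, 0, w)) = 0"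
    unfolding y' by (simp_all add: y.gram)
  show "g (F y) (\<phi> (F y) (m.vec y (u, 0, 0))) (m.vec y (0, v, w)) = 0"
    "g (F y) (\<phi> (F y) (\<phi> (F y) (m.vec y (u, 0, 0)))) (m.vec y (0, v, w)) = 0"
    unfolding y' by (rule y.J_orthogonal)+
qed

lemma dG_horizontal: "dG (0, v, w) (u, 0, 0) (u', 0, 0) = 0"
proof (rule dG_eqI)
  let ?H = "\<lambda>z :: 'e \<times> 'f \<times> 'k. gT (cinv kT (fst z)) (chart_vec AT kT (cinv kT (fst z)) u) (chart_vec AT kT (cinv kT (fst z)) u')"
  show "g (F y) (m.vec y (u, 0, 0)) (m.vec y (u', 0, 0)) = ?H (snd k y)" if "y \<in> fst k" for y
    using gram_near(1)[OF that] that chart_cinv(1)[OF MT kT(1)] by (auto simp: fst_k snd_k)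
  show "((\<lambda>t. ?H (snd k x + t *\<^sub>R (0, v, w))) has_real_derivative 0) (at 0)" by (simp add: snd_k)
qed

lemma dG_mixed: "dG W (u, 0, 0) (0, v, w) = 0" "dG W (0, v, w) (u, 0, 0) = 0"
proof -
  show "dG W (u, 0, 0) (0, v, w) = 0"
    by (rule dG_eqI[where H = "\<lambda>_. 0"]) (simp_all add: gram_near(2))
  then show "dG W (0, v, w) (u, 0, 0) = 0" by (simp add: dG_sym)
qed

lemma dG_mixed23: "dG W (0, v, 0) (0, 0, w) = 0" "dG W (0, 0, w) (0, v, 0) = 0"
proof -
  show "dG W (0, v, 0) (0, 0, w) = 0"
    by (rule dG_eqI[where H = "\<lambda>_. 0"]) (simp_all add: gram_near(5))
  then show "dG W (0, 0, w) (0, v, 0) = 0" by (simp add: dG_sym)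
qed

text \<open>Writing the factor \<open>f\<^sup>2\<close> as \<open>exp (2 ln f)\<close> makes its logarithmic derivative visible.\<close>

lemma dG_warped:
  assumes f: "f \<in> {f1, f2}"
    and H: "\<And>y. y \<in> fst k \<Longrightarrow> g (F y) (m.vec y U) (m.vec y U') = (f (fst y))\<^sup>2 * h (snd (snd k y))"
  shows "dG (u, 0, 0) U U' = 2 * dlog f u * G (vec U) (vec U')"
    and "(\<And>t. h (snd (snd k x) + t *\<^sub>R (v, w)) = h (snd (snd k x))) \<Longrightarrow> dG (0, v, w) U U' = 0"
proof -
  let ?l = "ln \<circ> f \<circ> cinv kT"
  let ?H = "\<lambda>z :: 'e \<times> 'f \<times> 'k. exp (2 * ?l (fst z)) * h (snd z)"
  have e: "(f y)\<^sup>2 = exp (2 * ln (f y))" for y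
    using warping(2)[OF f, of y] exp_double[of "ln (f y)"] by simp
  have H': "g (F y) (m.vec y U) (m.vec y U') = ?H (snd k y)" if "y \<in> fst k" for y
    using H[OF that] that chart_cinv(1)[OF MT kT(1)] by (auto simp: fst_k snd_k e)
  have "(?l has_derivative dlog f) (at (snd kT a + 0 *\<^sub>R u))" using dlog_has_derivative[OF f] by simp
  moreover have "((\<lambda>t. snd kT a + t *\<^sub>R u) has_derivative (\<lambda>t. t *\<^sub>R u)) (at (0::real))"
    by (auto intro!: derivative_eq_intros)
  ultimately have "(?l \<circ> (\<lambda>t. snd kT a + t *\<^sub>R u) has_derivative dlog f \<circ> (\<lambda>t. t *\<^sub>R u)) (at 0)"
    by (rule diff_chain_at[rotated])
  moreover have "dlog f \<circ> (\<lambda>t. t *\<^sub>R u) = (*) (dlog f u)"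
    using linear_cmul[OF linear_dlog[OF f]] by (auto simp: fun_eq_iff)
  ultimately have "((\<lambda>t. ?l (snd kT a + t *\<^sub>R u)) has_real_derivative dlog f u) (at 0)"
    by (simp add: has_field_derivative_def o_def)
  then have "((\<lambda>t. exp (2 * ?l (snd kT a + t *\<^sub>R u)) * h (snd (snd k x))) has_real_derivative
      exp (2 * ?l (snd kT a + 0 *\<^sub>R u)) * (2 * dlog f u) * h (snd (snd k x))) (at 0)"
    by (intro DERIV_cmult_right DERIV_fun_exp DERIV_cmult)
  then show "dG (u, 0, 0) U U' = 2 * dlog f u * G (vec U) (vec U')"
    using H[OF k(2)] chart_cinv(1)[OF MT kT] by (intro dG_eqI[OF H']) (simp_all add: snd_k e mult_ac)
  assume "\<And>t. h (snd (snd k x) + t *\<^sub>R (v, w)) = h (snd (snd k x))"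
  then show "dG (0, v, w) U U' = 0" by (intro dG_eqI[OF H']) (simp_all add: snd_k)
qed

lemma dG_warped2:
  "dG (u, 0, 0) (0, v, 0) (0, v', 0) = 2 * dlog f1 u * G (vec (0, v, 0)) (vec (0, v', 0))"
  "dG (0, 0, w) (0, v, 0) (0, v', 0) = 0"
proof -
  let ?h = "\<lambda>z :: 'f \<times> 'k. gp (cinv kp (fst z)) (chart_vec Ap kp (cinv kp (fst z)) v) (chart_vec Ap kp (cinv kp (fst z)) v')"
  have H: "g (F y) (m.vec y (0, v, 0)) (m.vec y (0, v', 0)) = (f1 (fst y))\<^sup>2 * ?h (snd (snd k y))" if "y \<in> fst k" for y
    using gram_near(3)[OF that] that chart_cinv(1)[OF Mp kp(1)] by (auto simp: fst_k snd_k)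
  show "dG (u, 0, 0) (0, v, 0) (0, v', 0) = 2 * dlog f1 u * G (vec (0, v, 0)) (vec (0, v', 0))"
    by (rule dG_warped(1)[OF _ H]) simp_all
  show "dG (0, 0, w) (0, v, 0) (0, v', 0) = 0" by (rule dG_warped(2)[OF _ H]) simp_all
qed

lemma dG_warped3:
  "dG (u, 0, 0) (0, 0, w) (0, 0, w') = 2 * dlog f2 u * G (vec (0, 0, w)) (vec (0, 0, w'))"
  "dG (0, v, 0) (0, 0, w) (0, 0, w') = 0"
proof -
  let ?h = "\<lambda>z :: 'f \<times> 'k. gs (cinv ks (snd z)) (chart_vec As ks (cinv ks (snd z)) w) (chart_vec As ks (cinv ks (snd z)) w')"
  have H: "g (F y) (m.vec y (0, 0, w)) (m.vec y (0, 0, w')) = (f2 (fst y))\<^sup>2 * ?h (snd (snd k y))" if "y \<in> fst k" for y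
    using gram_near(4)[OF that] that chart_cinv(1)[OF Ms ks(1)] by (auto simp: fst_k snd_k)
  show "dG (u, 0, 0) (0, 0, w) (0, 0, w') = 2 * dlog f2 u * G (vec (0, 0, w)) (vec (0, 0, w'))"
    by (rule dG_warped(1)[OF _ H]) simp_all
  show "dG (0, v, 0) (0, 0, w) (0, 0, w') = 0" by (rule dG_warped(2)[OF _ H]) simp_all
qed

text \<open>A vertical vector \<open>n\<close> on which only \<open>f\<close> acts: in horizontal directions its inner products with vertical
  vectors grow like \<open>f\<^sup>2\<close>. Both kinds of vertical coordinate vectors are adapted, each to its own
  warping function.\<close>

definition adapted where
  "adapted f n \<longleftrightarrow> (\<exists>v w. n = (0, v, w)) \<and>
     (\<forall>u v w. dG (u, 0, 0) n (0, v, w) = 2 * dlog f u * G (vec n) (vec (0, v, w)))"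

lemma adapted: "adapted f1 (0, v, 0)" "adapted f2 (0, 0, w)"
proof -
  have s: "(0 :: 'e, v, w) = (0, v, 0) + (0, 0, w)" for v :: 'f and w :: 'k by simp
  have "dG (u, 0, 0) (0, v, 0) (0, v', w') = 2 * dlog f1 u * G (vec (0, v, 0)) (vec (0, v', w'))" for u v' w'
    unfolding s[of v' w'] dG_add linear_add[OF linear_vec]
    by (simp add: m.add_right dG_warped2 dG_mixed23 gram_orthogonal distrib_left)
  then show "adapted f1 (0, v, 0)" unfolding adapted_def by blast
  have "dG (u, 0, 0) (0, 0, w) (0, v', w') = 2 * dlog f2 u * G (vec (0, 0, w)) (vec (0, v', w'))" for u v' w'
    unfolding s[of v' w'] dG_add linear_add[OF linear_vec]
    by (simp add: m.add_right dG_warped3 dG_mixed23 gram_orthogonal distrib_left)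
  then show "adapted f2 (0, 0, w)" unfolding adapted_def by blast
qed

lemma Koszul: "2 * G (nab U V) (vec W) = dG U V W + dG V U W - dG W U V"
  unfolding dG_def by (rule m.Koszul_formula)

lemma nab_horizontal: "G (nab (u, 0, 0) (u', 0, 0)) (vec (0, v, w)) = 0"
  using Koszul[of "(u, 0, 0)" "(u', 0, 0)" "(0, v, w)"] by (simp add: dG_mixed dG_horizontal)

lemma nab_vertical: "G (nab (0, v, w) (0, v', w')) (vec (u, 0, 0)) = - dG (u, 0, 0) (0, v, w) (0, v', w') / 2"
  using Koszul[of "(0, v, w)" "(0, v', w')" "(u, 0, 0)"] by (simp add: dG_mixed)

text \<open>The tangential part of \<open>nab (u, 0, 0) n\<close> is \<open>dlog f u\<close> times \<open>n\<close>: its horizontal components vanish because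
  the metric of \<open>N\<^sub>T\<close> does not depend on the other factors.\<close>

lemma nab_mixed:
  assumes n: "adapted f n"
  shows "G (nab (u, 0, 0) n) (vec (u', v', w')) = dlog f u * G (vec n) (vec (u', v', w'))"
proof -
  obtain v w where nvw: "n = (0, v, w)" using n unfolding adapted_def by blast
  have s: "vec (u', v', w') = vec (u', 0, 0) + vec (0, v', w')"
    by (simp flip: linear_add[OF linear_vec])
  have 1: "G (nab (u, 0, 0) n) (vec (u', 0, 0)) = 0"
    using Koszul[of "(u, 0, 0)" n "(u', 0, 0)"] unfolding nvw by (simp add: dG_mixed dG_horizontal)
  have 2: "G (nab (u, 0, 0) n) (vec (0, v', w')) = dlog f u * G (vec n) (vec (0, v', w'))"
    using Koszul[of "(u, 0, 0)" n "(0, v', w')"] n unfolding adapted_def nvw by (simp add: dG_mixed)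
  show ?thesis
    unfolding s using 1 2 by (simp add: m.add_right) (simp add: nvw gram_orthogonal)
qed

lemma tangent_image_vec: "tangent_image M B F x = range vec"
  by (rule m.tangent_image_vec)

lemma II_mixed:
  assumes n: "adapted f n"
  shows "m.II (vec (u, 0, 0)) (vec n) = nab (u, 0, 0) n - dlog f u *\<^sub>R vec n"
proof -
  have "normal_part g (F x) (tangent_image M B F x) (dlog f u *\<^sub>R vec n + (nab (u, 0, 0) n - dlog f u *\<^sub>R vec n))
     = nab (u, 0, 0) n - dlog f u *\<^sub>R vec n"
  proof (rule m.normal_part_eqI[OF m.subspace_tangent_image])
    show "dlog f u *\<^sub>R vec n \<in> tangent_image M B F x"
      by (rule subspace_scale[OF m.subspace_tangent_image(1)]) (simp add: tangent_image_vec)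
    fix s assume "s \<in> tangent_image M B F x"
    then obtain u' v' w' where "s = vec (u', v', w')" unfolding tangent_image_vec by auto
    then show "G (nab (u, 0, 0) n - dlog f u *\<^sub>R vec n) s = 0"
      using nab_mixed[OF n] by (simp add: m.bilin)
  qed simp
  then show ?thesis by (simp add: m.II_vec[OF inj_vec])
qed

text \<open>The form \<open>g(\<phi> _, _)\<close> vanishes on a horizontal and a vertical field near the point. Its derivative in
  the vertical direction \<open>(0, v, w)\<close> relates \<open>nab\<close> of mixed arguments to \<open>nab\<close> of vertical ones, whose
  horizontal part is known from lemma \<open>nab_vertical\<close>.\<close>

lemma parallel_mixed:
  assumes u: "vec (u', 0, 0) = J (vec (u, 0, 0))"
  shows "G (nab (u, 0, 0) (0, v, w)) (J (vec (0, v', w'))) = - dG (u', 0, 0) (0, v, w) (0, v', w') / 2"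
proof -
  have "G (J (nab (0, v, w) (u, 0, 0))) (vec (0, v', w')) + G (J (vec (u, 0, 0))) (nab (0, v, w) (0, v', w')) = 0"
    by (rule derivative_of_product[OF phi_parallel, where H = "\<lambda>_. 0"]) (simp_all add: gram_near(6))
  moreover have "G (J (nab (0, v, w) (u, 0, 0))) (vec (0, v', w')) = - G (nab (u, 0, 0) (0, v, w)) (J (vec (0, v', w')))"
    using phi_skew[OF m.nabla_in vec_T] by (simp add: m.nabla_sym[of "(0, v, w)" "(u, 0, 0)"])
  moreover have "G (J (vec (u, 0, 0))) (nab (0, v, w) (0, v', w')) = - dG (u', 0, 0) (0, v, w) (0, v', w') / 2"
    unfolding u[symmetric] m.sym[OF vec_T m.nabla_in] by (rule nab_vertical)
  ultimately show ?thesis by simp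
qed

lemma II_phi:
  assumes n: "adapted f n" and n': "n' = (0, v', w')" and u: "vec (u', 0, 0) = J (vec (u, 0, 0))"
  shows "G (m.II (vec (u, 0, 0)) (vec n)) (J (vec n')) =
    - dlog f u' * G (vec n) (vec n') + dlog f u * G (J (vec n)) (vec n')"
proof -
  obtain v w where nvw: "n = (0, v, w)" using n unfolding adapted_def by blast
  have "G (nab (u, 0, 0) n) (J (vec n')) = - dlog f u' * G (vec n) (vec n')"
    using parallel_mixed[OF u, of v w v' w'] n unfolding adapted_def nvw n' by simp
  then show ?thesis
    unfolding II_mixed[OF n] using phi_in[OF vec_T] phi_skew[OF vec_T vec_T, of n n'] by (simp add: m.bilin)
qed

text \<open>The argument of \<open>parallel_mixed\<close> for \<open>\<phi>\<^sup>2\<close>: as \<open>\<phi>\<^sup>2\<close> annihilates \<open>\<xi>\<close> and is \<open>-1\<close> on vertical vectors, the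
  derivative of the relation in the direction \<open>n\<close> leaves \<open>g(nab n \<xi>, n) = 0\<close>, which is \<open>dlog\<close> of \<open>\<xi>\<close> up to a
  nonzero factor.\<close>

lemma dlog_xi:
  assumes n: "adapted f n" "n \<noteq> 0" and u: "vec (u, 0, 0) = \<xi> (F x)"
  shows "dlog f u = 0"
proof -
  obtain v w where nvw: "n = (0, v, w)" using n unfolding adapted_def by blast
  have J0: "J 0 = 0"
  proof -
    have "linear_map_on m.T J" using phi_parallel unfolding parallel_endo_def by blast
    then have "J (0 *\<^sub>R 0) = 0 *\<^sub>R J 0" unfolding linear_map_on_def using m.V_mem(1) by blast
    then show ?thesis by simp
  qed
  have "G (J (J (nab n (u, 0, 0)))) (vec n) + G (J (J (vec (u, 0, 0)))) (nab n n) = 0"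
    by (rule derivative_of_product[OF parallel_endo_comp[OF phi_parallel], where H = "\<lambda>_. 0"])
      (simp_all add: gram_near(7) nvw)
  then have "G (J (J (nab n (u, 0, 0)))) (vec n) = 0" by (simp add: u phi_xi J0)
  moreover have "G (\<xi> (F x)) (vec n) = 0" unfolding u[symmetric] nvw by (rule gram_orthogonal)
  ultimately have "G (nab (u, 0, 0) n) (vec n) = 0"
    using phi_phi[OF m.nabla_in] xi_in by (simp add: m.bilin m.nabla_sym[of n])
  then have "dlog f u * G (vec n) (vec n) = 0" using nab_mixed[OF n(1), of u 0 v w] by (simp add: nvw)
  moreover have "G (vec n) (vec n) \<noteq> 0"
    using m.pos[OF vec_T, of n] m.vec_eq_0_iff[OF inj_vec, of n] n(2) by simp
  ultimately show ?thesis by simp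
qed

section \<open>Gradients of the warping functions\<close>

text \<open>The gradients are transported to the ambient tangent space, where they lie in \<open>T1\<close>.\<close>

definition grad where "grad f = gradient M (induced_metric B g F) (\<lambda>(b, _). ln (f b)) x"
definition grad_image where "grad_image f = differential B F x (grad f)"

lemma act_ln_warping:
  assumes "f \<in> {f1, f2}"
  shows "act (chart_vec M k x (u, v, w)) (\<lambda>(b, _). ln (f b)) = dlog f u"
proof -
  have "dlog f u = act (differential AT fst x (chart_vec M k x (u, v, w))) (ln \<circ> f)"
    by (simp add: dlog_def proj_chart_vec)
  also have "\<dots> = act (chart_vec M k x (u, v, w)) ((ln \<circ> f) \<circ> fst)"
    using smooth_near_ln[OF assms] by (simp add: differential_def Tvec_inverse)
  also have "(ln \<circ> f) \<circ> fst = (\<lambda>(b, _ :: 'b \<times> 'c). ln (f b))" by (auto simp: fun_eq_iff)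
  finally show ?thesis ..
qed

text \<open>The gradient is defined by a definite description; existence is the Riesz representation in an
  orthonormal basis.\<close>

lemma gradient_spec:
  "grad f \<in> tangent_space M x \<and> (\<forall>v\<in>tangent_space M x. induced_metric B g F x (grad f) v = act v (\<lambda>(b, _). ln (f b)))"
proof -
  interpret i: inner_at "induced_metric B g F" x "tangent_space M x" by (rule m.inner_at_induced[OF inj_vec])
  let ?f = "\<lambda>(b, _). ln (f b)"
  let ?P = "\<lambda>w. w \<in> tangent_space M x \<and> (\<forall>v\<in>tangent_space M x. induced_metric B g F x w v = act v ?f)"
  obtain e where e: "i.orthonormal e" "span e = tangent_space M x"
    using i.exists_orthonormal[OF i.subspace_V order_refl] .
  have eT: "b \<in> tangent_space M x" if "b \<in> e" for b unfolding e(2)[symmetric] using that by (rule span_base)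
  define w where "w = (\<Sum>b\<in>e. act b ?f *\<^sub>R b)"
  have "w \<in> tangent_space M x" unfolding w_def using eT by (intro i.V_sum i.V_mem(5))
  moreover have "induced_metric B g F x w v = act v ?f" if v: "v \<in> tangent_space M x" for v
  proof -
    have "induced_metric B g F x w v = (\<Sum>b\<in>e. act b ?f * induced_metric B g F x v b)"
      unfolding w_def using v eT by (subst i.sum_left) (auto simp: i.scale_left i.sym[of v])
    also have "\<dots> = act (\<Sum>b\<in>e. induced_metric B g F x v b *\<^sub>R b) ?f" by (simp add: mult.commute)
    also have "(\<Sum>b\<in>e. induced_metric B g F x v b *\<^sub>R b) = v" using i.fourier[OF e(1), of v] v e(2) by simp
    finally show ?thesis .
  qed
  ultimately have ex: "?P w" by blast
  have "w' = w''" if "?P w'" "?P w''" for w' w''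
    by (rule i.eqI[OF order_refl i.subspace_V]) (use that in auto)
  with ex have "\<exists>!w. ?P w" by blast
  from theI'[OF this] show ?thesis unfolding grad_def gradient_def .
qed

lemma grad_image:
  assumes f: "f \<in> {f1, f2}"
  shows "G (grad_image f) (vec (u, v, w)) = dlog f u" "grad_image f \<in> T1"
    "sq_norm (induced_metric B g F) x (grad f) = G (grad_image f) (grad_image f)"
proof -
  have g: "G (grad_image f) (vec (u, v, w)) = dlog f u" for u v w
    using gradient_spec[of f] chart_vec_in_tangent_space[OF k, of "(u, v, w)"] act_ln_warping[OF f]
    by (auto simp: grad_image_def induced_metric_def m.vec_def)
  then show "G (grad_image f) (vec (u, v, w)) = dlog f u" .
  show "sq_norm (induced_metric B g F) x (grad f) = G (grad_image f) (grad_image f)"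
    by (simp add: sq_norm_def induced_metric_def grad_image_def)
  have "grad_image f \<in> tangent_image M B F x" unfolding grad_image_def tangent_image_def using gradient_spec by blast
  then obtain u v w where uvw: "grad_image f = vec (u, v, w)" unfolding tangent_image_vec by auto
  have s: "vec (u, v, w) = vec (u, 0, 0) + vec (0, v, w)" by (simp flip: linear_add[OF linear_vec])
  have "G (vec (0, v, w)) (vec (0, v, w)) = G (grad_image f) (vec (0, v, w))"
    unfolding uvw s by (simp add: m.add_left gram_orthogonal)
  also have "\<dots> = 0" using g linear_0[OF linear_dlog[OF f]] by simp
  finally have "vec (0, v, w) = 0" by (simp add: m.eq_0_iff)
  then show "grad_image f \<in> T1" unfolding uvw s by (simp add: T1_def)
qed

lemma warped_factor:
  fixes j :: "'n \<Rightarrow> 'e \<times> 'f \<times> 'k"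
  assumes f: "f \<in> {f1, f2}" and T': "T' = range (\<lambda>n. vec (j n))" "subspace T'"
    and j: "\<And>n. adapted f (j n)" and nz: "j n0 \<noteq> 0" and C: "C < 1"
    and slant: "\<And>p. p \<in> T' \<Longrightarrow> G (tangential_part g (F x) T' (J p)) (tangential_part g (F x) T' (J p)) = C * G p p"
  shows "warped_factor g (F x) m.T J T1 T' m.II (grad_image f) C"
proof
  have jv: "\<exists>v w. j n = (0, v, w)" for n using j[of n] unfolding adapted_def by blast
  show "subspace T1" "T1 \<subseteq> m.T" by (rule T_subspace)+
  show "subspace T'" by fact
  show T'T: "T' \<subseteq> m.T" unfolding T'(1) by auto
  show "v \<in> m.T \<Longrightarrow> J v \<in> m.T" for v by (rule phi_in)
  show "v \<in> m.T \<Longrightarrow> w \<in> m.T \<Longrightarrow> G (J v) w = - G v (J w)" for v w by (rule phi_skew)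
  show "u \<in> T1 \<Longrightarrow> J u \<in> T1" for u by (rule J_T1)
  show gT1: "grad_image f \<in> T1" by (rule grad_image(2)[OF f])
  obtain ux where ux: "vec (ux, 0, 0) = \<xi> (F x)" using xi_T1 unfolding T1_def by auto
  have "G (grad_image f) (\<xi> (F x)) = 0"
    unfolding ux[symmetric] grad_image(1)[OF f] by (rule dlog_xi[OF j nz ux])
  then show "G (J (grad_image f)) (J (grad_image f)) = G (grad_image f) (grad_image f)"
    using phi_metric[of "grad_image f" "F x" "grad_image f"] eta_g[of "grad_image f" "F x"] gT1 T_subspace(2) by auto
  show "G (J p) (J p) = G p p" if p: "p \<in> T'" for p
  proof -
    obtain n where n: "p = vec (j n)" using p unfolding T'(1) by blast
    have "G p (\<xi> (F x)) = 0" unfolding n ux[symmetric] using jv[of n] gram_orthogonal by auto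
    then show ?thesis using phi_metric[of p "F x" p] eta_g[of p "F x"] p T'T by auto
  qed
  have tan: "p \<in> tangent_image M B F x" if "p \<in> T1 \<or> p \<in> T'" for p
    using that unfolding tangent_image_vec T1_def T'(1) by auto
  show "u \<in> T1 \<Longrightarrow> p \<in> T' \<Longrightarrow> m.II u p \<in> m.T" for u p by (rule m.II_normal(1)[OF inj_vec tan tan]) auto
  show "u \<in> T1 \<Longrightarrow> p \<in> T' \<Longrightarrow> q \<in> T' \<Longrightarrow> G (m.II u p) q = 0" for u p q
    by (rule m.II_normal(2)[OF inj_vec tan tan tan]) auto
  show "G (m.II p q) (J r) = - G (grad_image f) (J p) * G q r + G (grad_image f) p * G (J q) r"
    if p: "p \<in> T1" and q: "q \<in> T'" and r: "r \<in> T'" for p q r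
  proof -
    obtain u where u: "p = vec (u, 0, 0)" using p unfolding T1_def by blast
    obtain u' where u': "vec (u', 0, 0) = J (vec (u, 0, 0))" using J_T1[OF p] unfolding T1_def u by auto
    obtain n where n: "q = vec (j n)" using q unfolding T'(1) by blast
    obtain n' where n': "r = vec (j n')" using r unfolding T'(1) by blast
    obtain v' w' where vw: "j n' = (0, v', w')" using jv by blast
    show ?thesis
      unfolding n n' u II_phi[OF j vw u'] u'[symmetric] grad_image(1)[OF f] ..
  qed
  show "p \<in> T' \<Longrightarrow> G (tangential_part g (F x) T' (J p)) (tangential_part g (F x) T' (J p)) = C * G p p" for p
    by (rule slant)
  show "C < 1" by fact
qed

lemma factor2: "warped_factor g (F x) m.T J T1 T2 m.II (grad_image f1) 0"
proof (rule warped_factor[where j = "\<lambda>v. (0, v, 0)"])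
  show "(0, One, 0) \<noteq> (0 :: 'e \<times> 'f \<times> 'k)" by (simp add: zero_prod_def One_non_0)
  fix p assume p: "p \<in> T2"
  have "anti_invariant_submanifold Ap B g \<phi> (F \<circ> leaf2 a c)" using crs by (simp add: CRS_biwarped_def)
  then have "g ((F \<circ> leaf2 a c) b) (\<phi> ((F \<circ> leaf2 a c) b) p) q = 0" if "q \<in> T2" for q
    using p that unfolding anti_invariant_submanifold_def T_tangent_image[symmetric] by blast
  then have a: "G (J p) q = 0" if "q \<in> T2" for q using that by (simp add: leaf2_def)
  have "tangential_part g (F x) T2 (J p) = 0"
    by (rule m.tangential_part_eqI[OF T_subspace(3,4)])
      (use p a phi_in T_subspace(3,4) in \<open>auto simp: subspace_0\<close>)
  then show "G (tangential_part g (F x) T2 (J p)) (tangential_part g (F x) T2 (J p)) = 0 * G p p" by simp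
qed (simp_all add: T2_def[symmetric] T_subspace adapted)

lemma theta: "0 < \<theta> x" "\<theta> x < pi / 2"
  using proper[rule_format, of a b] unfolding proper_pointwise_slant_def by (auto simp: leaf3_def)

lemma cos_theta: "(cos (\<theta> x))\<^sup>2 < 1"
proof -
  have "0 < sin (\<theta> x)" using theta by (intro sin_gt_zero) auto
  then have "0 < (sin (\<theta> x))\<^sup>2" by simp
  then show ?thesis using sin_cos_squared_add[of "\<theta> x"] by linarith
qed

text \<open>The angle in the definition of slant is an arc cosine; its argument is at most \<open>1\<close> because a projection
  does not increase lengths, and therefore it is the cosine of the angle.\<close>

lemma factor3: "warped_factor g (F x) m.T J T1 T3 m.II (grad_image f2) ((cos (\<theta> x))\<^sup>2)"
proof (rule warped_factor[where j = "\<lambda>w. (0, 0, w)"])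
  show "(0, 0, One) \<noteq> (0 :: 'e \<times> 'f \<times> 'k)" by (simp add: zero_prod_def One_non_0)
  fix p assume p: "p \<in> T3"
  let ?t = "tangential_part g (F x) T3 (J p)"
  have pT: "p \<in> m.T" "J p \<in> m.T" using p T_subspace(6) phi_in by auto
  have t: "?t \<in> T3" by (rule m.tangential_part(1)[OF T_subspace(5,6) pT(2)])
  then have tT: "?t \<in> m.T" using T_subspace(6) by blast
  obtain w where w: "p = vec (0, 0, w)" using p unfolding T3_def by blast
  obtain ux where ux: "vec (ux, 0, 0) = \<xi> (F x)" using xi_T1 unfolding T1_def by auto
  have "G p (\<xi> (F x)) = 0" unfolding w ux[symmetric] by (rule gram_orthogonal)
  then have iso: "G (J p) (J p) = G p p" using phi_metric[OF pT(1) pT(1)] eta_g[OF pT(1)] by simp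
  show "G ?t ?t = (cos (\<theta> x))\<^sup>2 * G p p"
  proof (cases "p = 0")
    case True
    have "linear_map_on m.T J" using phi_parallel unfolding parallel_endo_def by blast
    then have "J (0 *\<^sub>R 0) = 0 *\<^sub>R J 0" unfolding linear_map_on_def using m.V_mem(1) by blast
    then have J0: "J p = 0" by (simp add: True)
    have "?t = 0"
      unfolding J0
      by (rule m.tangential_part_eqI[OF T_subspace(5,6)])
        (use T_subspace(5,6) in \<open>auto simp: subspace_0\<close>)
    then show ?thesis using True by simp
  next
    case False
    have pp: "G p p > 0" by (rule m.pos[OF pT(1) False])
    have "pointwise_slant As B g \<phi> (F \<circ> leaf3 a b) (\<theta> \<circ> leaf3 a b)" using crs by (simp add: CRS_biwarped_def)
    then have "angle_to_subspace g ((F \<circ> leaf3 a b) c) T3 (\<phi> ((F \<circ> leaf3 a b) c) p) = (\<theta> \<circ> leaf3 a b) c"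
      using p False unfolding pointwise_slant_def T_tangent_image[symmetric] by blast
    then have ang: "arccos (sqrt (G ?t ?t) / sqrt (G p p)) = \<theta> x"
      by (simp add: leaf3_def angle_to_subspace_def sq_norm_def iso)
    have "0 \<le> G (J p - ?t) (J p - ?t)" using pT tT by (intro m.nonneg) simp
    then have le: "G ?t ?t \<le> G p p" using m.tangential_part_pythagoras[OF T_subspace(5,6) pT(2)] iso by simp
    have nn: "0 \<le> G ?t ?t" by (rule m.nonneg[OF tT])
    have "cos (\<theta> x) = sqrt (G ?t ?t) / sqrt (G p p)"
      unfolding ang[symmetric]
    proof (rule cos_arccos)
      show "- 1 \<le> sqrt (G ?t ?t) / sqrt (G p p)" using nn pp
        by (meson divide_nonneg_nonneg less_eq_real_def order_trans neg_le_0_iff_le real_sqrt_ge_zero zero_le_one)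
      show "sqrt (G ?t ?t) / sqrt (G p p) \<le> 1" using le pp by (simp add: divide_le_eq_1)
    qed
    then show ?thesis using nn pp by (simp add: power_divide)
  qed
qed (simp_all add: T3_def[symmetric] T_subspace adapted cos_theta)

section \<open>The inequality and its equality case at a point\<close>

definition local_bound where
  "local_bound = 2 * real DIM('f) * G (grad_image f1) (grad_image f1) + 2 * real DIM('k) * (1 + 2 * (cot (\<theta> x))\<^sup>2) * G (grad_image f2) (grad_image f2)"

lemma T_in_tangent: "p \<in> T1 \<or> p \<in> T2 \<or> p \<in> T3 \<Longrightarrow> p \<in> tangent_image M B F x"
  unfolding tangent_image_vec T1_def T2_def T3_def by auto

lemma main_estimate:
  shows "local_bound \<le> sff_sq_norm M B g D F x"
    and "sff_sq_norm M B g D F x = local_bound \<Longrightarrow>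
      (p \<in> T1 \<and> q \<in> T1) \<or> (p \<in> T2 \<and> q \<in> T2) \<or> (p \<in> T3 \<and> q \<in> T3) \<or> (p \<in> T2 \<and> q \<in> T3) \<Longrightarrow> m.II p q = 0"
proof -
  obtain e1 where e1: "m.orthonormal e1" "span e1 = T1" using m.exists_orthonormal[OF T_subspace(1,2)] .
  obtain e2 where e2: "m.orthonormal e2" "span e2 = T2" using m.exists_orthonormal[OF T_subspace(3,4)] .
  obtain e3 where e3: "m.orthonormal e3" "span e3 = T3" using m.exists_orthonormal[OF T_subspace(5,6)] .
  obtain e where e: "m.orthonormal e" "span e = tangent_image M B F x"
    and sff: "sff_sq_norm M B g D F x = m.block m.II e e"
    using m.sff_sq_norm_block[OF inj_vec] .
  have in1: "p \<in> T1" if "p \<in> e1" for p unfolding e1(2)[symmetric] using that by (rule span_base)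
  have in2: "p \<in> T2" if "p \<in> e2" for p unfolding e2(2)[symmetric] using that by (rule span_base)
  have in3: "p \<in> T3" if "p \<in> e3" for p unfolding e3(2)[symmetric] using that by (rule span_base)
  have o: "G p q = 0" if "(p \<in> T1 \<and> q \<in> T2) \<or> (p \<in> T1 \<and> q \<in> T3) \<or> (p \<in> T2 \<and> q \<in> T3)" for p q
    using that unfolding T1_def T2_def T3_def by (auto simp: gram_orthogonal)
  have sp: "span e = span (e1 \<union> e2 \<union> e3)"
  proof
    have sub: "T1 \<subseteq> span (e1 \<union> e2 \<union> e3)" "T2 \<subseteq> span (e1 \<union> e2 \<union> e3)" "T3 \<subseteq> span (e1 \<union> e2 \<union> e3)"
      unfolding e1(2)[symmetric] e2(2)[symmetric] e3(2)[symmetric] by (rule span_mono; auto)+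
    show "span e \<subseteq> span (e1 \<union> e2 \<union> e3)"
    proof
      fix p assume "p \<in> span e"
      then obtain u v w where p: "p = vec (u, v, w)" unfolding e(2) tangent_image_vec by auto
      have "vec (u, 0, 0) \<in> T1" "vec (0, v, 0) \<in> T2" "vec (0, 0, w) \<in> T3" by (simp_all add: T1_def T2_def T3_def)
      then have "vec (u, 0, 0) \<in> span (e1 \<union> e2 \<union> e3)" "vec (0, v, 0) \<in> span (e1 \<union> e2 \<union> e3)" "vec (0, 0, w) \<in> span (e1 \<union> e2 \<union> e3)"
        using sub by (meson subsetD)+
      then show "p \<in> span (e1 \<union> e2 \<union> e3)" unfolding p vec_split[of u v w] by (intro span_add)
    qed
    show "span (e1 \<union> e2 \<union> e3) \<subseteq> span e"
      by (rule span_minimal[OF _ subspace_span]) (use in1 in2 in3 T_in_tangent e(2) in auto)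
  qed
  have bil: "m.bilinear_on (span e) m.II" unfolding e(2) by (rule m.II_bilinear[OF inj_vec])
  have dec: "m.block m.II e e = m.block m.II e1 e1 + m.block m.II e2 e2 + m.block m.II e3 e3
    + 2 * m.block m.II e1 e2 + 2 * m.block m.II e1 e3 + 2 * m.block m.II e2 e3"
    by (rule m.block_decomposition[OF e1(1) e2(1) e3(1) _ _ _ e(1) sp bil])
      (use o in1 in2 in3 m.II_sym[OF inj_vec] e(2) in auto)
  have card: "card e2 = DIM('f)" "card e3 = DIM('k)"
    using m.card_orthonormal[OF inj_vec linear_parts(2) inj_parts(2) e2(1)] e2(2)
      m.card_orthonormal[OF inj_vec linear_parts(3) inj_parts(3) e3(1)] e3(2) by (simp_all add: T2_def T3_def)
  have b2: "real DIM('f) * G (grad_image f1) (grad_image f1) \<le> m.block m.II e1 e2"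
    using warped_factor.block_bound[OF factor2 e1 e2] unfolding m.block_def card by simp
  have trig: "(1 + (cos (\<theta> x))\<^sup>2) / (1 - (cos (\<theta> x))\<^sup>2) = 1 + 2 * (cot (\<theta> x))\<^sup>2"
  proof -
    have s: "1 - (cos (\<theta> x))\<^sup>2 = (sin (\<theta> x))\<^sup>2" "(sin (\<theta> x))\<^sup>2 \<noteq> 0"
      using sin_cos_squared_add[of "\<theta> x"] cos_theta by linarith+
    have "1 + (cos (\<theta> x))\<^sup>2 = (sin (\<theta> x))\<^sup>2 + 2 * (cos (\<theta> x))\<^sup>2" using s(1) by simp
    then have "(1 + (cos (\<theta> x))\<^sup>2) / (1 - (cos (\<theta> x))\<^sup>2) = ((sin (\<theta> x))\<^sup>2 + 2 * (cos (\<theta> x))\<^sup>2) / (sin (\<theta> x))\<^sup>2"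
      by (simp only: s(1))
    also have "\<dots> = 1 + 2 * (cot (\<theta> x))\<^sup>2"
      using s(2) by (simp add: cot_def power_divide add_divide_distrib)
    finally show ?thesis .
  qed
  have b3: "real DIM('k) * (1 + 2 * (cot (\<theta> x))\<^sup>2) * G (grad_image f2) (grad_image f2) \<le> m.block m.II e1 e3"
    using warped_factor.block_bound[OF factor3 e1 e3] unfolding m.block_def card trig .
  have T: "m.II p q \<in> m.T" if "p \<in> T1 \<or> p \<in> T2 \<or> p \<in> T3" "q \<in> T1 \<or> q \<in> T2 \<or> q \<in> T3" for p q
    by (rule m.II_normal(1)[OF inj_vec T_in_tangent[OF that(1)] T_in_tangent[OF that(2)]])
  have nn: "m.block m.II e1 e1 \<ge> 0" "m.block m.II e2 e2 \<ge> 0" "m.block m.II e3 e3 \<ge> 0" "m.block m.II e2 e3 \<ge> 0"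
    using in1 in2 in3 T by (auto intro!: m.block_nonneg)
  show "local_bound \<le> sff_sq_norm M B g D F x" unfolding sff dec local_bound_def using b2 b3 nn by simp
  assume "sff_sq_norm M B g D F x = local_bound"
  then have z: "m.block m.II e1 e1 = 0" "m.block m.II e2 e2 = 0" "m.block m.II e3 e3 = 0" "m.block m.II e2 e3 = 0"
    unfolding sff dec local_bound_def using b2 b3 nn by linarith+
  have sub: "span e1 \<subseteq> span e" "span e2 \<subseteq> span e" "span e3 \<subseteq> span e"
    unfolding sp by (rule span_mono; auto)+
  have fin: "finite e1" "finite e2" "finite e3" using e1 e2 e3 by (simp_all add: m.orthonormal_def)
  assume "(p \<in> T1 \<and> q \<in> T1) \<or> (p \<in> T2 \<and> q \<in> T2) \<or> (p \<in> T3 \<and> q \<in> T3) \<or> (p \<in> T2 \<and> q \<in> T3)"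
  then consider "p \<in> span e1 \<and> q \<in> span e1" | "p \<in> span e2 \<and> q \<in> span e2" | "p \<in> span e3 \<and> q \<in> span e3"
    | "p \<in> span e2 \<and> q \<in> span e3" unfolding e1(2) e2(2) e3(2) by blast
  then show "m.II p q = 0"
  proof cases
    case 1
    then show ?thesis using m.block_eq_0[OF bil sub(1,1) fin(1,1) z(1)] by blast
  next
    case 2
    then show ?thesis using m.block_eq_0[OF bil sub(2,2) fin(2,2) z(2)] by blast
  next
    case 3
    then show ?thesis using m.block_eq_0[OF bil sub(3,3) fin(3,3) z(3)] by blast
  next
    case 4
    then show ?thesis using m.block_eq_0[OF bil sub(2,3) fin(2,3) z(4)] by blast
  qed
qed


lemma vec_orthogonal_vertical:
  assumes p: "p \<in> range vec" and o: "\<And>v w. G p (vec (0, v, w)) = 0"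
  shows "p \<in> T1"
proof -
  obtain u v w where uvw: "p = vec (u, v, w)" using p by auto
  have s: "vec (u, v, w) = vec (u, 0, 0) + vec (0, v, w)" by (simp flip: linear_add[OF linear_vec])
  have "G (vec (0, v, w)) (vec (0, v, w)) = G p (vec (0, v, w))"
    unfolding uvw s by (simp add: m.add_left gram_orthogonal)
  then have "vec (0, v, w) = 0" using o by (simp add: m.eq_0_iff)
  then show ?thesis unfolding uvw s by (simp add: T1_def)
qed

lemma nab_tangent:
  assumes "m.II (vec U) (vec V) = 0"
  shows "nab U V \<in> range vec"
proof -
  have "nab U V = tangential_part g (F x) (tangent_image M B F x) (nab U V)"
    using assms by (simp add: m.II_vec[OF inj_vec] normal_part_def)
  then show ?thesis
    using m.tangential_part(1)[OF m.subspace_tangent_image m.nabla_in[of U V]] tangent_image_vec by simp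
qed

lemma range_vec_add:
  assumes "p \<in> range vec" "f \<in> {f1, f2}"
  shows "p + r *\<^sub>R grad_image f \<in> range vec"
proof -
  have "grad_image f \<in> range vec" using T_in_tangent[of "grad_image f"] grad_image(2)[OF assms(2)] tangent_image_vec by simp
  then show ?thesis
    using assms linear_subspace_image[OF linear_vec subspace_UNIV] by (simp add: subspace_add subspace_scale)
qed

text \<open>The coordinate vectors \<open>j n\<close> span one vertical factor, with warping function \<open>f\<close>, and the vectors \<open>i r\<close> the
  other one. This lets both factors be treated by the same proof.\<close>

definition vertical where
  "vertical f j i \<longleftrightarrow> f \<in> {f1, f2} \<and> (\<forall>n. adapted f (j n)) \<and> (\<forall>r. \<exists>v w. i r = (0, v, w)) \<and>
     (\<forall>u v w. \<exists>n r. (u, v, w) = j n + ((u, 0, 0) + i r)) \<and>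
     (\<forall>n n' r. dG (i r) (j n) (j n') = 0) \<and> (\<forall>W n r. dG W (j n) (i r) = 0) \<and>
     (\<forall>n r. G (vec (j n)) (vec (i r)) = 0)"

lemma vertical:
  "vertical f1 (\<lambda>v. (0, v, 0)) (\<lambda>w. (0, 0, w))"
  "vertical f2 (\<lambda>w. (0, 0, w)) (\<lambda>v. (0, v, 0))"
  by (simp_all add: vertical_def adapted dG_warped2 dG_warped3 dG_mixed23 gram_orthogonal)

context
  assumes eq: "sff_sq_norm M B g D F x = local_bound"
begin

lemma leaf1_geodesic:
  assumes "p \<in> tangent_space AT a" "q \<in> tangent_space AT a"
  shows "second_fundamental_form AT B g D (F \<circ> leaf1 b c) a p q = 0"
proof -
  obtain u u' where p: "p = chart_vec AT kT a u" "q = chart_vec AT kT a u'"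
    using assms unfolding tangent_space_chart[OF MT kT] by auto
  have "nab (u, 0, 0) (u', 0, 0) \<in> T1"
    by (rule vec_orthogonal_vertical[OF nab_tangent nab_horizontal])
      (rule main_estimate(2)[OF eq], simp add: T1_def)
  then have "normal_part g (F x) T1 (nab (u, 0, 0) (u', 0, 0)) = 0"
    by (rule m.normal_part_tangent[OF T_subspace(1,2)])
  then show ?thesis
    unfolding p L1.A0.second_fundamental_form_nabla T_tangent_image L1.nabla_comp by (simp add: leaf1_def)
qed

text \<open>By the assumption \<open>z\<close> the vector \<open>nab (j n) (j n')\<close> is tangent to the product. Its horizontal part is a
  multiple of the gradient by \<open>nab_vertical\<close>, and its part in the other vertical factor vanishes by the
  Koszul formula.\<close>

lemma normal_part_vertical:
  assumes v: "vertical f j i" and T': "T' = range (\<lambda>n. vec (j n))" "subspace T'"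
    and z: "m.II (vec (j n)) (vec (j n')) = 0"
  shows "normal_part g (F x) T' (nab (j n) (j n')) = - (G (vec (j n)) (vec (j n')) *\<^sub>R grad_image f)"
proof -
  let ?r = "G (vec (j n)) (vec (j n'))" and ?N = "nab (j n) (j n')"
  have f: "f \<in> {f1, f2}" and ad: "\<And>n. adapted f (j n)" and i: "\<And>r. \<exists>v w. i r = (0, v, w)"
    and dec: "\<And>u v w. \<exists>n r. (u, v, w) = j n + ((u, 0, 0) + i r)"
    and d: "\<And>n n' r. dG (i r) (j n) (j n') = 0" "\<And>W n r. dG W (j n) (i r) = 0"
    and o: "\<And>n r. G (vec (j n)) (vec (i r)) = 0"
    using v unfolding vertical_def by blast+
  have j: "\<exists>v w. j n = (0, v, w)" for n using ad[of n] unfolding adapted_def by blast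
  have g: "grad_image f \<in> m.T" using grad_image(2)[OF f] T_subspace(2) by auto
  have g0: "G (grad_image f) (vec (0, v, w)) = 0" for v w using grad_image(1)[OF f] linear_0[OF linear_dlog[OF f]] by simp
  define p where "p = ?N + ?r *\<^sub>R grad_image f"
  have pT: "p \<in> m.T" using g by (simp add: p_def)
  have p1: "G p (vec (u, 0, 0)) = 0" for u
  proof -
    obtain v w where n: "j n = (0, v, w)" using j by blast
    obtain v' w' where n': "j n' = (0, v', w')" using j by blast
    have "dG (u, 0, 0) (j n) (j n') = 2 * dlog f u * ?r" using ad[of n] unfolding adapted_def n' by blast
    then have "G ?N (vec (u, 0, 0)) = - dlog f u * ?r"
      using nab_vertical[of v w v' w' u] unfolding n n' by simp
    then show ?thesis using g grad_image(1)[OF f, of u 0 0] by (simp add: p_def m.bilin)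
  qed
  have p2: "G p (vec (i r)) = 0" for r
  proof -
    have "G ?N (vec (i r)) = 0" using Koszul[of "j n" "j n'" "i r"] d by simp
    moreover have "G (grad_image f) (vec (i r)) = 0" using i[of r] g0 by auto
    ultimately show ?thesis using g by (simp add: p_def m.bilin)
  qed
  have "p \<in> T'"
  proof -
    have "p \<in> range vec" unfolding p_def by (rule range_vec_add[OF nab_tangent[OF z] f])
    then obtain u v w where "p = vec (u, v, w)" by auto
    moreover obtain n0 r where "(u, v, w) = j n0 + ((u, 0, 0) + i r)" using dec by blast
    ultimately have p: "p = vec (j n0) + vec ((u, 0, 0) + i r)" by (metis linear_add[OF linear_vec])
    let ?z = "vec ((u, 0, 0) + i r)"
    have zz: "?z = vec (u, 0, 0) + vec (i r)" by (rule linear_add[OF linear_vec])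
    have "G (vec (j n0)) (vec (u, 0, 0)) = 0" using j[of n0] gram_orthogonal by auto
    then have "G ?z ?z = G p ?z" unfolding p zz by (simp add: m.add_left m.add_right o)
    also have "\<dots> = 0" unfolding zz using p1 p2 pT by (simp add: m.add_right)
    finally have "?z = 0" by (simp add: m.eq_0_iff)
    then show ?thesis unfolding p T'(1) by simp
  qed
  moreover have "G (- (?r *\<^sub>R grad_image f)) s = 0" if sT: "s \<in> T'" for s
  proof -
    obtain n where s: "s = vec (j n)" using sT unfolding T'(1) by blast
    have "G (grad_image f) s = 0" unfolding s using j[of n] g0 by auto
    then show ?thesis using g s by (simp add: m.bilin)
  qed
  moreover have "T' \<subseteq> m.T" unfolding T'(1) by auto
  ultimately have "normal_part g (F x) T' (p + - (?r *\<^sub>R grad_image f)) = - (?r *\<^sub>R grad_image f)"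
    using g by (intro m.normal_part_eqI[OF T'(2)]) auto
  then show ?thesis by (simp add: p_def)
qed

lemma normal_part_leaves:
  "normal_part g (F x) T2 (nab (0, v, 0) (0, v', 0)) = - (G (vec (0, v, 0)) (vec (0, v', 0)) *\<^sub>R grad_image f1)"
  "normal_part g (F x) T3 (nab (0, 0, w) (0, 0, w')) = - (G (vec (0, 0, w)) (vec (0, 0, w')) *\<^sub>R grad_image f2)"
  by (rule normal_part_vertical[OF vertical(1) T2_def T_subspace(3) main_estimate(2)[OF eq]], simp add: T2_def,
      rule normal_part_vertical[OF vertical(2) T3_def T_subspace(5) main_estimate(2)[OF eq]], simp add: T3_def)

lemma leaf2_umbilical:
  assumes "p \<in> tangent_space Ap b" "q \<in> tangent_space Ap b"
  shows "second_fundamental_form Ap B g D (F \<circ> leaf2 a c) b p q =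
    induced_metric B g (F \<circ> leaf2 a c) b p q *\<^sub>R mean_curvature Ap B g D (F \<circ> leaf2 a c) b"
proof -
  have "L2.A0.vec b = (\<lambda>v. vec (0, v, 0))" by (rule ext) (rule L2.vec_comp)
  then have inj: "inj (L2.A0.vec b)" using inj_parts(2) by simp
  have F: "(F \<circ> leaf2 a c) b = F x" by (simp add: leaf2_def)
  have sff: "second_fundamental_form Ap B g D (F \<circ> leaf2 a c) b (chart_vec Ap kp b v) (chart_vec Ap kp b v') =
     g ((F \<circ> leaf2 a c) b) (L2.A0.vec b v) (L2.A0.vec b v') *\<^sub>R - grad_image f1" for v v'
    unfolding L2.A0.second_fundamental_form_nabla T_tangent_image L2.nabla_comp L2.vec_comp F normal_part_leaves by simp
  have mc: "mean_curvature Ap B g D (F \<circ> leaf2 a c) b = - grad_image f1"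
    by (rule L2.A0.mean_curvature_umbilical[OF inj]) (simp only: L2.A0.II_sff[OF inj] sff)
  obtain v v' where p: "p = chart_vec Ap kp b v" "q = chart_vec Ap kp b v'"
    using assms unfolding tangent_space_chart[OF Mp kp] by auto
  show ?thesis unfolding mc p sff L2.A0.induced_metric_chart_vec ..
qed

lemma leaf3_umbilical:
  assumes "p \<in> tangent_space As c" "q \<in> tangent_space As c"
  shows "second_fundamental_form As B g D (F \<circ> leaf3 a b) c p q =
    induced_metric B g (F \<circ> leaf3 a b) c p q *\<^sub>R mean_curvature As B g D (F \<circ> leaf3 a b) c"
proof -
  have "L3.A0.vec c = (\<lambda>w. vec (0, 0, w))" by (rule ext) (rule L3.vec_comp)
  then have inj: "inj (L3.A0.vec c)" using inj_parts(3) by simp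
  have F: "(F \<circ> leaf3 a b) c = F x" by (simp add: leaf3_def)
  have sff: "second_fundamental_form As B g D (F \<circ> leaf3 a b) c (chart_vec As ks c v) (chart_vec As ks c v') =
     g ((F \<circ> leaf3 a b) c) (L3.A0.vec c v) (L3.A0.vec c v') *\<^sub>R - grad_image f2" for v v'
    unfolding L3.A0.second_fundamental_form_nabla T_tangent_image L3.nabla_comp L3.vec_comp F normal_part_leaves by simp
  have mc: "mean_curvature As B g D (F \<circ> leaf3 a b) c = - grad_image f2"
    by (rule L3.A0.mean_curvature_umbilical[OF inj]) (simp only: L3.A0.II_sff[OF inj] sff)
  obtain v v' where p: "p = chart_vec As ks c v" "q = chart_vec As ks c v'"
    using assms unfolding tangent_space_chart[OF Ms ks] by auto
  show ?thesis unfolding mc p sff L3.A0.induced_metric_chart_vec ..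
qed

end

lemma factor_dist_chart:
  "factor_dist1 AT Ap As x = range (\<lambda>u. chart_vec M k x (u, 0, 0))"
  "factor_dist2 AT Ap As x = range (\<lambda>v. chart_vec M k x (0, v, 0))"
  "factor_dist3 AT Ap As x = range (\<lambda>w. chart_vec M k x (0, 0, w))"
proof -
  have 1: "differential M (leaf1 b c) a (chart_vec AT kT a u) = chart_vec M k x (u, 0, 0)" for u
    using differential_affine[OF MT M leaf_smooth(1) kT k(1) _ bounded_linear_inclusions(1), of b c "(0, snd kp b, snd ks c)" u]
      k chart_cinv[OF MT kT(1)] by (simp add: leaf1_def snd_k)
  have 2: "differential M (leaf2 a c) b (chart_vec Ap kp b v) = chart_vec M k x (0, v, 0)" for v
    using differential_affine[OF Mp M leaf_smooth(2) kp k(1) _ bounded_linear_inclusions(2), of a c "(snd kT a, 0, snd ks c)" v]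
      k chart_cinv[OF Mp kp(1)] by (simp add: leaf2_def snd_k)
  have 3: "differential M (leaf3 a b) c (chart_vec As ks c w) = chart_vec M k x (0, 0, w)" for w
    using differential_affine[OF Ms M leaf_smooth(3) ks k(1) _ bounded_linear_inclusions(3), of a b "(snd kT a, snd kp b, 0)" w]
      k chart_cinv[OF Ms ks(1)] by (simp add: leaf3_def snd_k)
  show "factor_dist1 AT Ap As x = range (\<lambda>u. chart_vec M k x (u, 0, 0))"
    "factor_dist2 AT Ap As x = range (\<lambda>v. chart_vec M k x (0, v, 0))"
    "factor_dist3 AT Ap As x = range (\<lambda>w. chart_vec M k x (0, 0, w))"
    by (simp_all add: factor_dist1_def factor_dist2_def factor_dist3_def tangent_image_def
        tangent_space_chart[OF MT kT] tangent_space_chart[OF Mp kp] tangent_space_chart[OF Ms ks]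
        image_image 1 2 3 flip: M_def)
qed

lemma mixed23_geodesic:
  assumes "sff_sq_norm M B g D F x = local_bound" "p \<in> factor_dist2 AT Ap As x" "q \<in> factor_dist3 AT Ap As x"
  shows "second_fundamental_form M B g D F x p q = 0"
proof -
  obtain v w where p: "p = chart_vec M k x (0, v, 0)" "q = chart_vec M k x (0, 0, w)"
    using assms(2,3) unfolding factor_dist_chart by blast
  show ?thesis
    unfolding p m.II_sff[OF inj_vec, symmetric]
    by (rule main_estimate(2)[OF assms(1)]) (simp add: T2_def T3_def)
qed

lemma dlog_eq_0_if_mixed:
  assumes w: "warped_factor g (F x) m.T J T1 T' m.II (grad_image f) C" and f: "f \<in> {f1, f2}"
    and T': "T' = range (\<lambda>n. vec (j n))" and nz: "j n0 \<noteq> 0"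
    and mixed: "\<And>u n. second_fundamental_form M B g D F x (chart_vec M k x (u, 0, 0)) (chart_vec M k x (j n)) = 0"
  shows "dlog f u = 0"
proof -
  have "grad_image f = 0"
  proof (rule warped_factor.gamma_eq_0_if_mixed_zero[OF w])
    show "vec (j n0) \<in> T'" by (simp add: T')
    show "vec (j n0) \<noteq> 0" using nz by (simp add: m.vec_eq_0_iff[OF inj_vec])
    fix p q assume "p \<in> T1" "q \<in> T'"
    then obtain u n where "p = vec (u, 0, 0)" "q = vec (j n)" unfolding T1_def T' by blast
    then show "m.II p q = 0" using mixed by (simp add: m.II_sff[OF inj_vec])
  qed
  then show ?thesis using grad_image(1)[OF f, of u 0 0] by simp
qed

end

context crs begin

abbreviation at_point where "at_point \<equiv> crs_point B g D \<phi> \<xi> \<eta> AT gT Ap gp As gs f1 f2 F \<theta>"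

lemma point_exists:
  obtains kT kp ks where "at_point kT kp ks a b c"
proof -
  obtain kT where kT: "kT \<in> AT" "a \<in> fst kT" using chart_exists[OF MT] .
  obtain kp where kp: "kp \<in> Ap" "b \<in> fst kp" using chart_exists[OF Mp] .
  obtain ks where ks: "ks \<in> As" "c \<in> fst ks" using chart_exists[OF Ms] .
  have "at_point kT kp ks a b c"
    by unfold_locales (fact kT kp ks)+
  then show ?thesis by (rule that)
qed

lemma locally_constant_warping:
  assumes f: "f \<in> {f1, f2}" and z: "\<And>k a u. k \<in> AT \<Longrightarrow> a \<in> fst k \<Longrightarrow> act (chart_vec AT k a u) (ln \<circ> f) = 0"
  shows "locally_constant f"
proof -
  have "locally_constant (ln \<circ> f)"
    by (rule locally_constant_if_act_zero[OF MT smooth_ln_warping[OF f] z])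
  moreover have "f constant_on U" if "(ln \<circ> f) constant_on U" for U
  proof -
    obtain d where "\<And>y. y \<in> U \<Longrightarrow> ln (f y) = d" using \<open>(ln \<circ> f) constant_on U\<close> unfolding constant_on_def by auto
    then have "f y = exp d" if "y \<in> U" for y using that warping(2)[OF f, of y] by force
    then show ?thesis unfolding constant_on_def by blast
  qed
  ultimately show ?thesis unfolding locally_constant_def by blast
qed

text \<open>At a point of the product over the given point of \<open>N\<^sub>T\<close> the vanishing of the mixed block forces the
  gradient, and thereby the logarithmic derivative of the warping function, to vanish.\<close>

lemma locally_constant_if_mixed:
  shows "mixed_totally_geodesic M B g D F (factor_dist1 AT Ap As) (factor_dist2 AT Ap As) \<Longrightarrow> locally_constant f1"
    and "mixed_totally_geodesic M B g D F (factor_dist1 AT Ap As) (factor_dist3 AT Ap As) \<Longrightarrow> locally_constant f2"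
proof -
  have "(mixed_totally_geodesic M B g D F (factor_dist1 AT Ap As) (factor_dist2 AT Ap As) \<longrightarrow>
        act (chart_vec AT k a u) (ln \<circ> f1) = 0) \<and>
      (mixed_totally_geodesic M B g D F (factor_dist1 AT Ap As) (factor_dist3 AT Ap As) \<longrightarrow>
        act (chart_vec AT k a u) (ln \<circ> f2) = 0)" if k: "k \<in> AT" "a \<in> fst k" for k a u
  proof -
    fix b :: 'b and c :: 'c
    obtain kp where kp: "kp \<in> Ap" "b \<in> fst kp" using chart_exists[OF Mp] .
    obtain ks where ks: "ks \<in> As" "c \<in> fst ks" using chart_exists[OF Ms] .
    interpret p: crs_point B g D \<phi> \<xi> \<eta> AT gT Ap gp As gs f1 f2 F \<theta> k kp ks a b c
      by unfold_locales (fact k kp ks)+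
    have "(0, One, 0) \<noteq> (0 :: 'e \<times> 'f \<times> 'k)" "(0, 0, One) \<noteq> (0 :: 'e \<times> 'f \<times> 'k)"
      by (simp_all add: zero_prod_def)
    then show ?thesis
      using p.dlog_eq_0_if_mixed[OF p.factor2 _ p.T2_def, of One u] p.dlog_eq_0_if_mixed[OF p.factor3 _ p.T3_def, of One u]
      unfolding mixed_totally_geodesic_def p.dlog_def by (auto simp: p.factor_dist_chart)
  qed
  then show "mixed_totally_geodesic M B g D F (factor_dist1 AT Ap As) (factor_dist2 AT Ap As) \<Longrightarrow> locally_constant f1"
    "mixed_totally_geodesic M B g D F (factor_dist1 AT Ap As) (factor_dist3 AT Ap As) \<Longrightarrow> locally_constant f2"
    by (auto intro!: locally_constant_warping)
qed

definition bound where
  "bound x = 2 * real DIM('f) * sq_norm (induced_metric B g F) x (gradient M (induced_metric B g F) (\<lambda>(b, _). ln (f1 b)) x)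
      + 2 * real DIM('k) * (1 + 2 * (cot (\<theta> x))\<^sup>2)
          * sq_norm (induced_metric B g F) x (gradient M (induced_metric B g F) (\<lambda>(b, _). ln (f2 b)) x)"

lemma bound_point:
  assumes "at_point kT kp ks a b c"
  shows "bound (a, b, c) = crs_point.local_bound B g AT Ap As f1 f2 F \<theta> a b c"
proof -
  interpret p: crs_point B g D \<phi> \<xi> \<eta> AT gT Ap gp As gs f1 f2 F \<theta> kT kp ks a b c by (rule assms)
  show ?thesis
    unfolding p.local_bound_def bound_def using p.grad_image(3)[of f1] p.grad_image(3)[of f2] by (simp add: p.grad_def)
qed

lemma inequality: "bound x \<le> sff_sq_norm M B g D F x"
proof -
  obtain a b c where x: "x = (a, b, c)" by (cases x)
  obtain kT kp ks where c: "at_point kT kp ks a b c"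
    using point_exists .
  show ?thesis unfolding x bound_point[OF c] by (rule crs_point.main_estimate(1)[OF c])
qed

lemma equality:
  assumes eq: "\<And>x. sff_sq_norm M B g D F x = bound x"
  shows "totally_geodesic AT B g D (F \<circ> leaf1 b c)"
    and "totally_umbilical Ap B g D (F \<circ> leaf2 a c)"
    and "totally_umbilical As B g D (F \<circ> leaf3 a b)"
    and "mixed_totally_geodesic M B g D F (factor_dist2 AT Ap As) (factor_dist3 AT Ap As)"
proof -
  have eq': "sff_sq_norm M B g D F (a, b, c) = crs_point.local_bound B g AT Ap As f1 f2 F \<theta> a b c"
    if "at_point kT kp ks a b c" for kT kp ks a b c
    unfolding eq by (rule bound_point[OF that])
  show "totally_geodesic AT B g D (F \<circ> leaf1 b c)"
    unfolding totally_geodesic_def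
  proof (intro allI ballI)
    fix a p q assume pq: "p \<in> tangent_space AT a" "q \<in> tangent_space AT a"
    obtain kT kp ks where c: "at_point kT kp ks a b c"
      using point_exists .
    show "second_fundamental_form AT B g D (F \<circ> leaf1 b c) a p q = 0"
      by (rule crs_point.leaf1_geodesic[OF c eq'[OF c] pq])
  qed
  show "totally_umbilical Ap B g D (F \<circ> leaf2 a c)"
    unfolding totally_umbilical_def
  proof (intro allI ballI)
    fix b p q assume pq: "p \<in> tangent_space Ap b" "q \<in> tangent_space Ap b"
    obtain kT kp ks where c: "at_point kT kp ks a b c"
      using point_exists .
    show "second_fundamental_form Ap B g D (F \<circ> leaf2 a c) b p q =
      induced_metric B g (F \<circ> leaf2 a c) b p q *\<^sub>R mean_curvature Ap B g D (F \<circ> leaf2 a c) b"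
      by (rule crs_point.leaf2_umbilical[OF c eq'[OF c] pq])
  qed
  show "totally_umbilical As B g D (F \<circ> leaf3 a b)"
    unfolding totally_umbilical_def
  proof (intro allI ballI)
    fix c p q assume pq: "p \<in> tangent_space As c" "q \<in> tangent_space As c"
    obtain kT kp ks where c: "at_point kT kp ks a b c"
      using point_exists .
    show "second_fundamental_form As B g D (F \<circ> leaf3 a b) c p q =
      induced_metric B g (F \<circ> leaf3 a b) c p q *\<^sub>R mean_curvature As B g D (F \<circ> leaf3 a b) c"
      by (rule crs_point.leaf3_umbilical[OF c eq'[OF c] pq])
  qed
  show "mixed_totally_geodesic M B g D F (factor_dist2 AT Ap As) (factor_dist3 AT Ap As)"
    unfolding mixed_totally_geodesic_def
  proof (intro allI ballI)
    fix x p q assume pq: "p \<in> factor_dist2 AT Ap As x" "q \<in> factor_dist3 AT Ap As x"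
    obtain a b c where x: "x = (a, b, c)" by (cases x)
    obtain kT kp ks where c: "at_point kT kp ks a b c"
      using point_exists .
    show "second_fundamental_form M B g D F x p q = 0"
      using crs_point.mixed23_geodesic[OF c eq'[OF c]] pq unfolding x by blast
  qed
qed

end

theorem theorem5p1:
  fixes B :: "('q::{t2_space,second_countable_topology}, 'm::euclidean_space) atlas"
    and g :: "'q metric" and D :: "'q connection"
    and \<phi> :: "'q \<Rightarrow> 'q tvec \<Rightarrow> 'q tvec" and \<xi> :: "'q vfield" and \<eta> :: "'q \<Rightarrow> 'q tvec \<Rightarrow> real"
    and AT :: "('a::{t2_space,second_countable_topology}, 'e::euclidean_space) atlas"
    and Ap :: "('b::{t2_space,second_countable_topology}, 'f::euclidean_space) atlas"
    and As :: "('c::{t2_space,second_countable_topology}, 'k::euclidean_space) atlas"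
    and gT :: "'a metric" and gp :: "'b metric" and gs :: "'c metric"
    and f1 f2 :: "'a \<Rightarrow> real"
    and F :: "'a \<times> 'b \<times> 'c \<Rightarrow> 'q" and \<theta> :: "'a \<times> 'b \<times> 'c \<Rightarrow> real"
    and m p n1 n2 :: nat
  defines "M \<equiv> triple_atlas AT Ap As"
  defines "h \<equiv> second_fundamental_form M B g D F"
    and "gM \<equiv> induced_metric B g F"
  defines "rhs \<equiv> (\<lambda>x. 2 * real n1 * sq_norm gM x (gradient M gM (\<lambda>(b, _). ln (f1 b)) x)
      + 2 * real n2 * (1 + 2 * (cot (\<theta> x))\<^sup>2)
          * sq_norm gM x (gradient M gM (\<lambda>(b, _). ln (f2 b)) x))"
  assumes "DIM('m) = 2 * m + 1"
    and "DIM('e) = 2 * p + 1" and "DIM('f) = n1" and "DIM('k) = n2"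
    and "cosymplectic B g \<phi> \<xi> \<eta> D"
    and "CRS_biwarped AT gT Ap gp As gs f1 f2 B g \<phi> \<xi> F \<theta>"
    and "\<forall>x y. proper_pointwise_slant As B g \<phi> (F \<circ> leaf3 x y) (\<theta> \<circ> leaf3 x y)"
  shows "(\<forall>x. sff_sq_norm M B g D F x \<ge> rhs x) \<and>
    ((\<forall>x. sff_sq_norm M B g D F x = rhs x) \<longrightarrow>
       (\<forall>y z. totally_geodesic AT B g D (F \<circ> leaf1 y z)) \<and>
       (\<forall>x z. totally_umbilical Ap B g D (F \<circ> leaf2 x z)) \<and>
       (\<forall>x y. totally_umbilical As B g D (F \<circ> leaf3 x y)) \<and>
       mixed_totally_geodesic M B g D F (factor_dist2 AT Ap As) (factor_dist3 AT Ap As) \<and>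
       (\<not> locally_constant f1 \<longrightarrow>
          \<not> mixed_totally_geodesic M B g D F (factor_dist1 AT Ap As) (factor_dist2 AT Ap As)) \<and>
       (\<not> locally_constant f2 \<longrightarrow>
          \<not> mixed_totally_geodesic M B g D F (factor_dist1 AT Ap As) (factor_dist3 AT Ap As)))"
proof -
  interpret c: crs B g D \<phi> \<xi> \<eta> AT gT Ap gp As gs f1 f2 F \<theta>
    by unfold_locales fact+
  have M: "M = c.M" by (simp add: M_def c.M_def)
  have rhs: "rhs x = c.bound x" for x
    unfolding rhs_def c.bound_def gM_def M \<open>DIM('f) = n1\<close> \<open>DIM('k) = n2\<close> ..
  show ?thesis
    unfolding M rhs using c.inequality c.equality c.locally_constant_if_mixed by blast
qed

end
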